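(* Let $k\in\mathbb{N}$ and let $B_1,\dots,B_k\subseteq\mathbb{N}$ be sets such that, for each $i\in\{1,\dots,k\}$, $B_i$ is a set of the form $B_+$ or $B_-$ associated with functions $(h_{1,i},h_{2,i})\in\mathcal{R}_{c_{1,i}}\times\mathcal{R}_{c_{2,i}}$ (and a corresponding $\psi_i$), where $c_{1,i}\in[1,2)$ and $c_{2,i}\in[1,6/5)$. Let $(X,\mathcal{B},\mu)$ be a $\sigma$-finite measure space and let $\{S_i:\ i\in\{1,\dots,k\}\}$ be a family of invertible, $\mu$-invariant, pairwise commuting transformations of $X$. Then for any $p\in(1,\infty)$ and any $f\in L^p_\mu(X)$, the limit \[ \lim_{\min\{N_1,\dots,N_k\}\to\infty}\frac{1}{\prod_{i=1}^k|B_i\cap[1,N_i]|}\sum_{l\in\prod_{i=1}^k B_i\cap[1,N_i]}f\circ S^{(l)}(x) \] exists for $\mu$-almost every $x\in X$, where $S^{(l_1,\dots,l_k)}=S_1^{l_1}\circ\dots\circ S_k^{l_k}$.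
   Context: Notation: $\mathbb{N}=\{1,2,\dots\}$; $\{x\}=x-\lfloor x\rfloor$; $f\sim g$ means $f(x)/g(x)\to1$ as $x\to\infty$; $f\lesssim g$ means $f\le Cg$ for some constant $C>0$. A $\mu$-invariant transformation is a measurable map preserving $\mu$. Class $\mathcal{L}$: fix $x_0\ge1$; $\mathcal{L}$ is the set of all $\ell\colon[x_0,\infty)\to[1,\infty)$ of the form $\ell(x)=\exp\big(\int_{x_0}^x\frac{\vartheta(t)}{t}dt\big)$ with $\vartheta\in\mathcal{C}^2([x_0,\infty))$ real-valued and $\vartheta(x)\to0$, $x\vartheta'(x)\to0$, $x^2\vartheta''(x)\to0$ as $x\to\infty$. Class $\mathcal{L}_0$: the set of all $\ell\colon[x_0,\infty)\to[1,\infty)$ of the same form, where $\vartheta\in\mathcal{C}^2([x_0,\infty))$ is positive and decreasing, $\vartheta(x)\to0$, $\frac{x\vartheta'(x)}{\vartheta(x)}\to0$, $\frac{x^2\vartheta''(x)}{\vartheta(x)}\to0$ as $x\to\infty$, for every $\varepsilon>0$ one has $\vartheta(x)\gtrsim_\varepsilon x^{-\varepsilon}$, and $\lim_{x\to\infty}\ell(x)=\infty$. Class $\mathcal{R}_c$: for $c\in(1,\infty)$, $\mathcal{R}_c$ is the set of all strictly increasing convex $h\colon[x_0,\infty)\to[1,\infty)$ of the form $h(x)=x^c\ell(x)$ with $\ell\in\mathcal{L}$; $\mathcal{R}_1$ is the set of all strictly increasing convex $h\colon[x_0,\infty)\to[1,\infty)$ of the form $h(x)=x\ell(x)$ with $\ell\in\mathcal{L}_0$.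 Sets $B_\pm$: given $h_1\in\mathcal{R}_{c_1}$, $h_2\in\mathcal{R}_{c_2}$ with $c_1,c_2\in[1,2)$, let $\varphi_1,\varphi_2$ be the compositional inverses of $h_1,h_2$, and fix $\psi\in\mathcal{C}^2([1,\infty))$, $\psi\colon[1,\infty)\to(0,1/2]$, with $\psi(x)\sim\varphi_2'(x)$, $\psi'(x)\sim\varphi_2''(x)$, $\psi''(x)\sim\varphi_2'''(x)$ as $x\to\infty$. Then \[ B_+=\{n\in\mathbb{N}:\{\varphi_1(n)\}<\psi(n)\},\qquad B_-=\{n\in\mathbb{N}:\{-\varphi_1(n)\}<\psi(n)\}, \] where only those $n$ in the domain of $\varphi_1$ are considered. *)

theory Defs
  imports "HOL-Analysis.Analysis" "HOL-Library.Landau_Symbols"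
begin

text \<open>
  Functions on a half-line are total functions \<^typ>\<open>real \<Rightarrow> real\<close> of which only the values on
  the half-line matter. Derivatives in the regularity condition are relative to the set
  (one-sided at the end point); in conditions at infinity \<^const>\<open>deriv\<close> is the same derivative,
  since only interior points are involved.
\<close>

definition C2_on :: "real set \<Rightarrow> (real \<Rightarrow> real) \<Rightarrow> bool" where
  "C2_on A f \<longleftrightarrow> (\<exists>f' f''.
     (\<forall>x\<in>A. (f has_real_derivative f' x) (at x within A)) \<and>
     (\<forall>x\<in>A. (f' has_real_derivative f'' x) (at x within A)) \<and>
     continuous_on A f'')"

definition exp_form :: "real \<Rightarrow> (real \<Rightarrow> real) \<Rightarrow> (real \<Rightarrow> real) \<Rightarrow> bool" where
  "exp_form x0 \<theta> l \<longleftrightarrow>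
     (\<forall>x\<ge>x0. 1 \<le> l x \<and> l x = exp (integral {x0..x} (\<lambda>t. \<theta> t / t)))"

definition class_L :: "real \<Rightarrow> (real \<Rightarrow> real) set" where
  "class_L x0 = {l. \<exists>\<theta>. C2_on {x0..} \<theta> \<and> exp_form x0 \<theta> l \<and>
     (\<theta> \<longlongrightarrow> 0) at_top \<and>
     ((\<lambda>x. x * deriv \<theta> x) \<longlongrightarrow> 0) at_top \<and>
     ((\<lambda>x. x\<^sup>2 * deriv (deriv \<theta>) x) \<longlongrightarrow> 0) at_top}"

definition class_L0 :: "real \<Rightarrow> (real \<Rightarrow> real) set" where
  "class_L0 x0 = {l. \<exists>\<theta>. C2_on {x0..} \<theta> \<and> exp_form x0 \<theta> l \<and>
     (\<forall>x\<ge>x0. 0 < \<theta> x) \<and> antimono_on {x0..} \<theta> \<and>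
     (\<theta> \<longlongrightarrow> 0) at_top \<and>
     ((\<lambda>x. x * deriv \<theta> x / \<theta> x) \<longlongrightarrow> 0) at_top \<and>
     ((\<lambda>x. x\<^sup>2 * deriv (deriv \<theta>) x / \<theta> x) \<longlongrightarrow> 0) at_top \<and>
     (\<forall>\<epsilon>>0. \<exists>C>0. \<forall>x\<ge>x0. x powr (-\<epsilon>) \<le> C * \<theta> x) \<and>
     filterlim l at_top at_top}"

definition class_R :: "real \<Rightarrow> real \<Rightarrow> (real \<Rightarrow> real) set" where
  "class_R x0 c = {h. strict_mono_on {x0..} h \<and> convex_on {x0..} h \<and> (\<forall>x\<ge>x0. 1 \<le> h x) \<and>
     (\<exists>l \<in> (if c = 1 then class_L0 x0 else class_L x0). \<forall>x\<ge>x0. h x = x powr c * l x)}"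

text \<open>The compositional inverse of \<open>h\<close>; it is meaningful on \<open>h ` {x0..}\<close> only.\<close>

definition comp_inv :: "real \<Rightarrow> (real \<Rightarrow> real) \<Rightarrow> real \<Rightarrow> real" where
  "comp_inv x0 h = inv_into {x0..} h"

definition admissible_psi :: "real \<Rightarrow> (real \<Rightarrow> real) \<Rightarrow> (real \<Rightarrow> real) \<Rightarrow> bool" where
  "admissible_psi x0 h2 \<psi> \<longleftrightarrow> C2_on {1..} \<psi> \<and> (\<forall>x\<ge>1. 0 < \<psi> x \<and> \<psi> x \<le> 1 / 2) \<and>
     \<psi> \<sim>[at_top] deriv (comp_inv x0 h2) \<and>
     deriv \<psi> \<sim>[at_top] deriv (deriv (comp_inv x0 h2)) \<and>
     deriv (deriv \<psi>) \<sim>[at_top] deriv (deriv (deriv (comp_inv x0 h2)))"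

definition B_plus :: "real \<Rightarrow> (real \<Rightarrow> real) \<Rightarrow> (real \<Rightarrow> real) \<Rightarrow> nat set" where
  "B_plus x0 h1 \<psi> = {n. 1 \<le> n \<and> real n \<in> h1 ` {x0..} \<and>
     frac (comp_inv x0 h1 (real n)) < \<psi> (real n)}"

definition B_minus :: "real \<Rightarrow> (real \<Rightarrow> real) \<Rightarrow> (real \<Rightarrow> real) \<Rightarrow> nat set" where
  "B_minus x0 h1 \<psi> = {n. 1 \<le> n \<and> real n \<in> h1 ` {x0..} \<and>
     frac (- comp_inv x0 h1 (real n)) < \<psi> (real n)}"

text \<open>The inverse of \<open>T\<close> is not required to be measurable.\<close>

definition invertible_invariant :: "'a measure \<Rightarrow> ('a \<Rightarrow> 'a) \<Rightarrow> bool" where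
  "invertible_invariant M T \<longleftrightarrow>
     T \<in> measurable M M \<and> distr M M T = M \<and> bij_betw T (space M) (space M)"

text \<open>\<open>multi_pow S k l\<close> is \<open>S 1 ^^ l 1 \<circ> \<dots> \<circ> S k ^^ l k\<close>.\<close>

primrec multi_pow :: "(nat \<Rightarrow> 'a \<Rightarrow> 'a) \<Rightarrow> nat \<Rightarrow> (nat \<Rightarrow> nat) \<Rightarrow> 'a \<Rightarrow> 'a" where
  "multi_pow S 0 l = id"
| "multi_pow S (Suc k) l = multi_pow S k l \<circ> (S (Suc k) ^^ l (Suc k))"

definition ergodic_avg ::
  "(nat \<Rightarrow> nat set) \<Rightarrow> (nat \<Rightarrow> 'a \<Rightarrow> 'a) \<Rightarrow> nat \<Rightarrow> ('a \<Rightarrow> complex) \<Rightarrow> (nat \<Rightarrow> nat) \<Rightarrow> 'a \<Rightarrow> complex" where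
  "ergodic_avg B S k f N x =
     (\<Sum>l \<in> (\<Pi>\<^sub>E i\<in>{1..k}. B i \<inter> {1..N i}). f (multi_pow S k l x)) /
     of_nat (\<Prod>i\<in>{1..k}. card (B i \<inter> {1..N i}))"

end

theory Submission
  imports Defs "HOL-Real_Asymp.Real_Asymp"
begin

text \<open>
  The indicator of \<open>B\<^sub>\<plusminus>\<close> differs from \<open>\<psi>\<close> by two sawtooth functions of \<open>\<phi>\<^sub>1\<close>. Expanding these into trigonometric
  polynomials and applying van der Corput's second derivative bound shows that the Fourier transform of
  \<open>1\<^sub>B - \<psi>\<close> on \<open>[1, N]\<close> is smaller than \<open>\<Sum>\<psi>\<close> by a power of \<open>N\<close>, uniformly in the frequency. Transference turns this
  into a power saving in \<open>L\<^sup>2\<close> for the difference between the average along \<open>B\<close> and the \<open>\<psi>\<close>-weighted ergodic average,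
  and interpolation with the trivial bounds in \<open>L\<^sup>1\<close> and \<open>L\<^sup>\<infinity>\<close> gives one in every \<open>L\<^sup>p\<close>. Hence the differences along
  \<open>N = i\<^sup>k\<close> are summable, so the average along \<open>B\<close> inherits the maximal inequality and the pointwise convergence from
  Birkhoff's averages, positivity filling the gaps between consecutive powers. Several transformations are treated
  by induction as in the theorem of Dunford and Zygmund: applying the last averaging operator to the supremum
  of the tails of the inner averages, which tends to \<open>0\<close> in \<open>L\<^sup>p\<close>, leaves only the average of the inner limit.
\<close>

section \<open>Exponential sums\<close>

text \<open>Three requirements shape the argument. The Fourier bound must be uniform in the
  frequency, because transference sees only the supremum of the multiplier; hence the linear phase
  \<open>\<xi> * n\<close> is carried through all exponential sums, whose second differences do not
  feel it. The saving must be a power of \<open>N\<close>, because it has to be summable along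
  \<open>i ^ k\<close>: these indices have consecutive ratios tending to 1, so that positivity
  recovers convergence and not merely a maximal bound, which is all that doubling scales would give.
  And the saving is measured against the sum of \<open>\<psi>\<close>. This is where
  \<open>c2 < 6/5\<close> enters: it makes \<open>\<psi> n\<close> at least a constant times
  \<open>n powr (-1/5)\<close>, so that an error of order \<open>N powr (79/100)\<close> is at most
  a constant times \<open>\<psi> N * N powr (99/100)\<close>. The measure may be infinite, so
  nonzero constants are not integrable. Birkhoff's theorem is therefore derived from a weak-type
  bound and the nullity of invariant sets of oscillation, and p-integrable functions are cut at
  small positive heights to become integrable.\<close>

definition ee :: "real \<Rightarrow> complex" where "ee t = cis (2 * pi * t)"

lemma norm_ee [simp]: "norm (ee t) = 1"
  by (simp add: ee_def)

lemma ee_0 [simp]: "ee 0 = 1"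
  by (simp add: ee_def)

lemma ee_add: "ee (s + t) = ee s * ee t"
  by (simp add: ee_def cis_mult algebra_simps)

lemma ee_of_int [simp]: "ee (of_int k) = 1"
  using cis_multiple_2pi[of "of_int k"] by (simp add: ee_def)

lemma ee_add_int [simp]: "ee (t + of_int k) = ee t"
  by (simp add: ee_add)

lemma cnj_ee: "cnj (ee t) = ee (- t)"
  by (simp add: ee_def cis_cnj)

lemma norm_ee_diff_le: "norm (ee s - ee t) \<le> 2 * pi * \<bar>s - t\<bar>"
proof -
  have *: "norm (cis a - cis b) \<le> \<bar>a - b\<bar>" for a b :: real
  proof -
    have "cis a - cis b = cis b * (exp (\<i> * of_real (a - b)) - 1)"
      by (simp add: cis_conv_exp algebra_simps flip: exp_add)
    also have "norm \<dots> = norm (cis (a - b) - 1)"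
      by (simp add: norm_mult cis_conv_exp)
    also have "\<dots> = 2 * \<bar>sin ((a - b) / 2)\<bar>"
      using dist_exp_i_1[of "a - b"] by (simp add: cis_conv_exp)
    also have "\<dots> \<le> \<bar>a - b\<bar>"
      using abs_sin_x_le_abs_x[of "(a - b)/2"] by simp
    finally show ?thesis .
  qed
  from *[of "2 * pi * s" "2 * pi * t"] show ?thesis
    by (simp add: ee_def abs_mult flip: right_diff_distrib)
qed

text \<open>A concave function lies above its chord, here the one over [0, pi/2].\<close>

lemma sin_pi_ge:
  fixes t :: real
  assumes "0 \<le> t" "t \<le> 1/2"
  shows "2 * t \<le> sin (pi * t)"
proof -
  have c: "concave_on {0..pi/2} sin"
  proof (rule f''_le0_imp_concave)
    show "(sin has_real_derivative cos x) (at x)" for x :: real by (auto intro: DERIV_sin)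
    show "(cos has_real_derivative - sin x) (at x)" for x :: real by (auto intro: DERIV_cos)
    show "- sin x \<le> 0" if "x \<in> {0..pi/2}" for x using that by (auto intro!: sin_ge_zero)
  qed auto
  have "(1 - 2*t) * sin 0 + (2*t) * sin (pi/2) \<le> sin ((1 - 2*t) *\<^sub>R 0 + (2*t) *\<^sub>R (pi/2))"
    using assms by (intro concave_onD[OF c]) auto
  then show ?thesis by (simp add: mult.commute)
qed

lemma sin_pi_ge_min:
  fixes t d :: real
  assumes "0 \<le> d" "d \<le> t" "t \<le> 1 - d"
  shows "2 * d \<le> sin (pi * t)"
proof (cases "t \<le> 1/2")
  case True
  then show ?thesis using sin_pi_ge[of t] assms by linarith
next
  case False
  have "sin (pi * (1 - t)) = sin (pi * t)"
    using sin_pi_minus[of "pi*t"] by (simp add: algebra_simps)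
  moreover have "2 * (1 - t) \<le> sin (pi * (1 - t))"
    using assms False by (intro sin_pi_ge) auto
  moreover have "2 * d \<le> 2 * (1 - t)" using assms by simp
  ultimately show ?thesis by (metis order_trans)
qed

text \<open>The explicit inverse of \<open>1 - ee t\<close> is 1/2 + (i/2) cot(pi t). Its real part
  is constant, so only the cotangent contributes to the variation in the summation by parts.\<close>

lemma one_minus_ee_mult:
  assumes "sin (pi * t) \<noteq> 0"
  shows "(1 - ee t) * (Complex (1/2) (cot (pi * t) / 2)) = 1"
proof -
  let ?x = "pi * t"
  have 1: "ee t = Complex (1 - 2 * (sin ?x)\<^sup>2) (2 * sin ?x * cos ?x)"
    by (simp add: ee_def complex_eq_iff cos_double_sin[of ?x, simplified mult.assoc] 
        sin_double[of ?x] mult.assoc)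
  have "cos ?x * cos ?x + sin ?x * sin ?x = 1"
    using sin_cos_squared_add2[of ?x] by (simp add: power2_eq_square)
  then show ?thesis unfolding 1 using assms
    by (simp add: complex_eq_iff cot_def field_simps power2_eq_square flip: distrib_left)
qed

lemma cot_diff:
  fixes x y :: real
  assumes "sin x \<noteq> 0" "sin y \<noteq> 0"
  shows "cot x - cot y = sin (y - x) / (sin x * sin y)"
  using assms by (simp add: cot_def sin_diff field_simps)

lemma cot_antimono:
  fixes x y :: real
  assumes "0 < x" "x \<le> y" "y < pi"
  shows "cot y \<le> cot x"
proof -
  have s: "sin x > 0" "sin y > 0" "sin (y - x) \<ge> 0"
    using assms by (auto intro!: sin_gt_zero sin_ge_zero)
  have "cot x - cot y = sin (y - x) / (sin x * sin y)"
    using s by (intro cot_diff) auto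
  also have "\<dots> \<ge> 0" using s by simp
  finally show ?thesis by simp
qed

lemma abs_cot_le:
  assumes "0 < d" "d \<le> t" "t \<le> 1 - d"
  shows "\<bar>cot (pi * t)\<bar> \<le> 1 / (2 * d)"
proof -
  have s: "2 * d \<le> sin (pi * t)" using assms by (intro sin_pi_ge_min) auto
  have "\<bar>cot (pi * t)\<bar> = \<bar>cos (pi * t)\<bar> / sin (pi * t)"
    using s assms by (simp add: cot_def)
  also have "\<dots> \<le> 1 / (2 * d)"
    using s assms by (intro frac_le) auto
  finally show ?thesis .
qed

text \<open>Abel summation in telescoped form: \<open>z n = (z n - z (n + 1)) * u n\<close> with
  \<open>u = 1/2 + (i/2) cot\<close>, whose total variation is controlled by monotonicity of \<open>cot\<close>.\<close>

lemma Kusmin_Landau_aux: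
  fixes g :: "nat \<Rightarrow> real"
  assumes d: "0 < d" and ab: "a < b"
    and dec: "\<And>n. a \<le> n \<Longrightarrow> Suc n < b \<Longrightarrow> g (n+2) - g (n+1) \<le> g (n+1) - g n"
    and rng: "\<And>n. a \<le> n \<Longrightarrow> n < b \<Longrightarrow> d \<le> g (n+1) - g n \<and> g (n+1) - g n \<le> 1 - d"
  defines "u \<equiv> \<lambda>n. Complex (1/2) (cot (pi * (g (n+1) - g n)) / 2)"
  shows "norm ((\<Sum>n=a..<b. ee (g n)) + ee (g b) * u (b - 1)) 
     \<le> norm (u a) + (cot (pi * (g b - g (b - 1))) - cot (pi * (g (a+1) - g a))) / 2"
  using ab dec rng
proof (induction "b - a - 1" arbitrary: b)
  case 0
  then have b: "b = Suc a" by simp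
  have "0 < 2 * d" using d by simp
  also have "2 * d \<le> sin (pi * (g (a+1) - g a))"
    using 0(4)[of a] d b by (intro sin_pi_ge_min) auto
  finally have "(1 - ee (g (a+1) - g a)) * u a = 1" unfolding u_def
    by (intro one_minus_ee_mult) auto
  then have "ee (g a) * ((1 - ee (g (a+1) - g a)) * u a) = ee (g a)" by simp
  moreover have "ee (g (a+1)) = ee (g a) * ee (g (a+1) - g a)"
    by (simp flip: ee_add)
  ultimately have "ee (g a) + ee (g b) * u (b - 1) = ee (g a) * u a"
    using b by (simp add: algebra_simps)
  then show ?case using b by (simp add: norm_mult)
next
  case (Suc k)
  then obtain b' where b: "b = Suc b'" and ab': "a < b'"
    by (cases b) auto
  have IH: "norm ((\<Sum>n=a..<b'. ee (g n)) + ee (g b') * u (b' - 1)) 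
     \<le> norm (u a) + (cot (pi * (g b' - g (b' - 1))) - cot (pi * (g (a+1) - g a))) / 2"
    using Suc.hyps(2) ab' b Suc.prems by (intro Suc.hyps(1)) auto
  have "0 < 2 * d" using d by simp
  also have "2 * d \<le> sin (pi * (g (b'+1) - g b'))"
    using Suc.prems(3)[of b'] d b ab' by (intro sin_pi_ge_min) auto
  finally have "(1 - ee (g (b'+1) - g b')) * u b' = 1" unfolding u_def
    by (intro one_minus_ee_mult) auto
  then have "ee (g b') * ((1 - ee (g (b'+1) - g b')) * u b') = ee (g b')" by simp
  moreover have "ee (g (b'+1)) = ee (g b') * ee (g (b'+1) - g b')"
    by (simp flip: ee_add)
  ultimately have "ee (g b') + ee (g b) * u (b - 1) = ee (g b') * u b'"
    using b by (simp add: algebra_simps)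
  \<comment> \<open>Adding one term moves the boundary correction, and the change is the purely
    imaginary \<open>u b' - u (b' - 1)\<close> times a unimodular factor. Since the differences of
    \<open>g\<close> decrease, the cotangents increase, so these norms telescope and the induction
    closes.\<close>
  then have eq: "(\<Sum>n=a..<b. ee (g n)) + ee (g b) * u (b - 1) =
    ((\<Sum>n=a..<b'. ee (g n)) + ee (g b') * u (b' - 1)) + ee (g b') * (u b' - u (b' - 1))"
    using b ab' by (simp add: algebra_simps)
  have "cot (pi * (g b' - g (b' - 1))) \<le> cot (pi * (g (b'+1) - g b'))"
  proof (rule cot_antimono)
    have r: "d \<le> g (b'+1) - g b'" "g b' - g (b' - 1) \<le> 1 - d"
      using Suc.prems(3)[of b'] Suc.prems(3)[of "b'-1"] ab' b by auto
    show "0 < pi * (g (b'+1) - g b')" using r d by (intro mult_pos_pos) auto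
    show "pi * (g b' - g (b' - 1)) < pi" using r d by simp
    show "pi * (g (b'+1) - g b') \<le> pi * (g b' - g (b' - 1))"
      using Suc.prems(2)[of "b'-1"] ab' b by (intro mult_left_mono) (auto simp: numeral_2_eq_2)
  qed
  then have "norm (u b' - u (b' - 1)) = (cot (pi * (g (b'+1) - g b')) - cot (pi * (g b' - g (b' - 1)))) / 2"
    using ab' by (simp add: u_def cmod_def)
  then have "norm (ee (g b') * (u b' - u (b' - 1))) = (cot (pi * (g (b'+1) - g b')) - cot (pi * (g b' - g (b' - 1)))) / 2"
    by (simp add: norm_mult)
  with IH show ?case unfolding eq
    using b by (intro norm_triangle_le) (simp add: field_simps)
qed

text \<open>Each part of the Abel summation is at most \<open>1 / (2 * d)\<close>: the values of
  \<open>u\<close> at both ends and half the difference of the cotangents, 3 / (2 d) in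
  total.\<close>

lemma Kusmin_Landau_unit:
  fixes g :: "nat \<Rightarrow> real"
  assumes d: "0 < d" "d \<le> 1/2"
    and dec: "\<And>n. a \<le> n \<Longrightarrow> Suc n < b \<Longrightarrow> g (n+2) - g (n+1) \<le> g (n+1) - g n"
    and rng: "\<And>n. a \<le> n \<Longrightarrow> n < b \<Longrightarrow> d \<le> g (n+1) - g n \<and> g (n+1) - g n \<le> 1 - d"
  shows "norm (\<Sum>n=a..<b. ee (g n)) \<le> 2 / d"
proof (cases "a < b")
  case True
  define u where "u = (\<lambda>n. Complex (1/2) (cot (pi * (g (n+1) - g n)) / 2))"
  have cu: "\<bar>cot (pi * (g (n+1) - g n))\<bar> \<le> 1 / (2 * d)" if "a \<le> n" "n < b" for n
    using rng[OF that] d by (intro abs_cot_le) auto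
  have nu: "norm (u n) \<le> 1 / (2*d)" if "a \<le> n" "n < b" for n
  proof -
    have "norm (u n) \<le> 1/2 + \<bar>cot (pi * (g (n+1) - g n)) / 2\<bar>"
      using cmod_le[of "u n"] by (simp add: u_def)
    also have "\<dots> \<le> 1 / 2 + 1 / (2*d) / 2" using cu[OF that] by simp
    also have "\<dots> \<le> 1/(2*d)" using d by (simp add: field_simps)
    finally show ?thesis .
  qed
  have cua: "\<bar>cot (pi * (g (a+1) - g a))\<bar> \<le> 1 / (2 * d)" using cu[of a] True by simp
  have cub: "\<bar>cot (pi * (g b - g (b - 1)))\<bar> \<le> 1 / (2 * d)" using cu[of "b - 1"] True by force
  have "norm (\<Sum>n=a..<b. ee (g n)) \<le> norm ((\<Sum>n=a..<b. ee (g n)) + ee (g b) * u (b - 1)) + norm (ee (g b) * u (b - 1))"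
    by (metis add_diff_cancel_right' norm_triangle_ineq4)
  also have "norm (ee (g b) * u (b - 1)) = norm (u (b - 1))" by (simp add: norm_mult)
  also have "norm ((\<Sum>n=a..<b. ee (g n)) + ee (g b) * u (b - 1)) \<le> 
     norm (u a) + (cot (pi * (g b - g (b - 1))) - cot (pi * (g (a+1) - g a))) / 2"
    unfolding u_def by (rule Kusmin_Landau_aux[OF d(1) True dec rng]) 
  also have "\<dots> + norm (u (b-1)) \<le> (1/(2*d)) + (1/(2*d) + 1/(2*d))/2 + 1/(2*d)"
    using nu[of a] nu[of "b-1"] cua cub True
    by (intro add_mono divide_right_mono) (auto simp: abs_le_iff simp del: One_nat_def)
  also have "\<dots> \<le> 2/d" using d by (simp add: field_simps)
  finally show ?thesis by simp
qed (use d in auto)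

text \<open>Subtracting \<open>k * n\<close> from the phase changes no value of \<open>ee\<close>
  and moves the differences into the unit interval.\<close>

lemma Kusmin_Landau:
  fixes g :: "nat \<Rightarrow> real" and k :: int
  assumes d: "0 < d" "d \<le> 1/2"
    and dec: "\<And>n. a \<le> n \<Longrightarrow> Suc n < b \<Longrightarrow> g (n+2) - g (n+1) \<le> g (n+1) - g n"
    and rng: "\<And>n. a \<le> n \<Longrightarrow> n < b \<Longrightarrow> of_int k + d \<le> g (n+1) - g n \<and> g (n+1) - g n \<le> of_int k + 1 - d"
  shows "norm (\<Sum>n=a..<b. ee (g n)) \<le> 2 / d"
proof -
  define f where "f n = g n - k * n" for n
  have "norm (\<Sum>n=a..<b. ee (f n)) \<le> 2 / d"
    using dec rng
    by (intro Kusmin_Landau_unit d) (fastforce simp: f_def algebra_simps)+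
  moreover have "ee (f n) = ee (g n)" for n
    using ee_add_int[of "f n" "k * int n"] by (simp add: f_def)
  ultimately show ?thesis by simp
qed

section \<open>Van der Corput's second derivative bound\<close>

lemma card_separated_le:
  fixes \<theta> :: "nat \<Rightarrow> real"
  assumes S: "S \<subseteq> {a..<b}" and l: "0 < l"
    and sep: "\<And>i j. a \<le> i \<Longrightarrow> i \<le> j \<Longrightarrow> j < b \<Longrightarrow> l * (real j - real i) \<le> \<theta> i - \<theta> j"
    and wid: "\<And>i j. i \<in> S \<Longrightarrow> j \<in> S \<Longrightarrow> \<theta> i - \<theta> j \<le> d" and d: "0 \<le> d"
  shows "real (card S) \<le> d / l + 1"
proof (cases "S = {}")
  case False
  have fin: "finite S" using S finite_subset by blast
  define p q where "p = Min S" and "q = Max S"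
  have pq: "p \<in> S" "q \<in> S" "p \<le> q" using fin False by (auto simp: p_def q_def)
  have "S \<subseteq> {p..q}" using fin by (auto simp: p_def q_def)
  then have "card S \<le> card {p..q}" by (intro card_mono) auto
  then have "real (card S) \<le> real q - real p + 1" using pq by simp
  moreover have "l * (real q - real p) \<le> d"
    using sep[of p q] wid[OF pq(1,2)] pq S by force
  then have "real q - real p \<le> d / l" using l by (simp add: field_simps)
  ultimately show ?thesis by linarith
qed (use d l in auto)

lemma interval_nat_eq:
  fixes S :: "nat set"
  assumes "finite S" "\<And>i j n. i \<in> S \<Longrightarrow> j \<in> S \<Longrightarrow> i \<le> n \<Longrightarrow> n \<le> j \<Longrightarrow> n \<in> S" 
  obtains p q where "S = {p..<q}"
proof (cases "S = {}")
  case True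
  then show ?thesis using that[of 0 0] by simp
next
  case False
  have "S = {Min S..<Suc (Max S)}"
  proof
    show "S \<subseteq> {Min S..<Suc (Max S)}" using assms(1) by (auto simp: less_Suc_eq_le)
    show "{Min S..<Suc (Max S)} \<subseteq> S"
      using assms(2)[of "Min S" "Max S"] False assms(1) by auto
  qed
  then show ?thesis by (rule that)
qed

text \<open>The indices are grouped by the integer part of the phase difference
  \<open>\<theta>\<close>, which falls by at least \<open>l\<close> per step and by at most
  \<open>V\<close> in total; so there are at most \<open>V + 2\<close> groups. Within a group,
  differences at distance at least \<open>d\<close> from the integers are handled by Kusmin-Landau
  at cost \<open>2 / d\<close>; the two runs close to an integer are counted trivially, at most
  \<open>d / l + 1\<close> terms each. The choice \<open>d = sqrt l\<close> balances the
  two.\<close>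

lemma van_der_Corput:
  fixes g :: "nat \<Rightarrow> real"
  assumes l: "0 < l" "l \<le> 1/4"
    and dec: "\<And>n. a \<le> n \<Longrightarrow> Suc n < b \<Longrightarrow> l \<le> (g (n+1) - g n) - (g (n+2) - g (n+1))"
    and V: "0 \<le> V" "a < b \<Longrightarrow> (g (a+1) - g a) - (g b - g (b-1)) \<le> V"
  shows "norm (\<Sum>n=a..<b. ee (g n)) \<le> (V + 2) * (5 / sqrt l)"
proof (cases "a < b")
  case True
  define \<theta> where "\<theta> n = g (n+1) - g n" for n
  define I where "I = {a..<b}"
  define d where "d = sqrt l"
  have d: "0 < d" "d \<le> 1/2" "d * d = l"
    using l real_sqrt_le_mono[of l "1/4"] by (auto simp: d_def real_sqrt_divide)
  have sep: "l * (real j - real i) \<le> \<theta> i - \<theta> j" if "a \<le> i" "i \<le> j" "j < b" for i j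
    using that(2,3)
  proof (induction j rule: dec_induct)
    case (step m)
    have "l \<le> \<theta> m - \<theta> (Suc m)"
      using dec[of m] step that(1) by (simp add: \<theta>_def)
    then show ?case using step by (simp add: algebra_simps)
  qed simp
  have anti: "\<theta> j \<le> \<theta> i" if "a \<le> i" "i \<le> j" "j < b" for i j
  proof -
    have "0 \<le> l * (real j - real i)" using l that by simp
    with sep[OF that] show ?thesis by linarith
  qed
  define K where "K = (\<lambda>n. \<lfloor>\<theta> n\<rfloor>) ` I"
  have cK: "real (card K) \<le> V + 2"
  proof -
    have "K \<subseteq> {\<lfloor>\<theta> (b-1)\<rfloor>..\<lfloor>\<theta> a\<rfloor>}"
      using anti True unfolding K_def I_def by (auto intro!: floor_mono)
    then have "card K \<le> card {\<lfloor>\<theta> (b-1)\<rfloor>..\<lfloor>\<theta> a\<rfloor>}" by (intro card_mono) auto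
    moreover have "\<lfloor>\<theta> (b-1)\<rfloor> \<le> \<lfloor>\<theta> a\<rfloor>" using anti[of a "b-1"] True by (intro floor_mono) auto
    ultimately have "real (card K) \<le> of_int (\<lfloor>\<theta> a\<rfloor> - \<lfloor>\<theta> (b-1)\<rfloor> + 1)" by simp
    moreover have "of_int \<lfloor>\<theta> a\<rfloor> \<le> \<theta> a" "\<theta> (b-1) < of_int \<lfloor>\<theta> (b-1)\<rfloor> + 1" by linarith+
    moreover have "\<theta> a - \<theta> (b-1) \<le> V" using V(2) True by (simp add: \<theta>_def)
    ultimately show ?thesis by linarith
  qed
  have inner: "norm (\<Sum>n\<in>{n\<in>I. \<lfloor>\<theta> n\<rfloor> = k}. ee (g n)) \<le> 5 / d" for k
  proof -
    define A1 A2 A3 where "A1 = {n\<in>I. of_int k \<le> \<theta> n \<and> \<theta> n < of_int k + d}"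
      and "A2 = {n\<in>I. of_int k + d \<le> \<theta> n \<and> \<theta> n \<le> of_int k + 1 - d}"
      and "A3 = {n\<in>I. of_int k + 1 - d < \<theta> n \<and> \<theta> n < of_int k + 1}"
    have fin: "finite A1" "finite A2" "finite A3" by (auto simp: A1_def A2_def A3_def I_def)
    have U: "{n\<in>I. \<lfloor>\<theta> n\<rfloor> = k} = A1 \<union> (A2 \<union> A3)"
      using d by (auto simp: A1_def A2_def A3_def floor_eq_iff)
    have dj: "A1 \<inter> (A2 \<union> A3) = {}" "A2 \<inter> A3 = {}"
      using d by (auto simp: A1_def A2_def A3_def)
    have "(\<Sum>n\<in>{n\<in>I. \<lfloor>\<theta> n\<rfloor> = k}. ee (g n)) = (\<Sum>n\<in>A1. ee (g n)) + ((\<Sum>n\<in>A2. ee (g n)) + (\<Sum>n\<in>A3. ee (g n)))"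
      unfolding U using fin dj by (subst sum.union_disjoint; (subst sum.union_disjoint)?) auto
    moreover have "norm (\<Sum>n\<in>A1. ee (g n)) \<le> d / l + 1"
    proof -
      have "norm (\<Sum>n\<in>A1. ee (g n)) \<le> card A1"
        using norm_sum[of "\<lambda>n. ee (g n)" A1] by simp
      also have "\<dots> \<le> d / l + 1"
        using l d by (intro card_separated_le[OF _ _ sep]) (auto simp: A1_def I_def)
      finally show ?thesis .
    qed
    moreover have "norm (\<Sum>n\<in>A3. ee (g n)) \<le> d / l + 1"
    proof -
      have "norm (\<Sum>n\<in>A3. ee (g n)) \<le> card A3"
        using norm_sum[of "\<lambda>n. ee (g n)" A3] by simp
      also have "\<dots> \<le> d / l + 1"
        using l d by (intro card_separated_le[OF _ _ sep]) (auto simp: A3_def I_def)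
      finally show ?thesis .
    qed
    moreover have "norm (\<Sum>n\<in>A2. ee (g n)) \<le> 2 / d"
    proof -
      \<comment> \<open>Monotone differences make the middle group an interval of indices, as
        Kusmin-Landau requires.\<close>
      have "n \<in> A2" if "i \<in> A2" "j \<in> A2" "i \<le> n" "n \<le> j" for i j n
        using that anti[of i n] anti[of n j] by (auto simp: A2_def I_def)
      then obtain p q where pq: "A2 = {p..<q}"
        using interval_nat_eq[OF fin(2)] by metis
      have mem: "n \<in> I" "of_int k + d \<le> g (n+1) - g n" "g (n+1) - g n \<le> of_int k + 1 - d"
        if "p \<le> n" "n < q" for n
      proof -
        have "n \<in> A2" using that pq by simp
        then show "n \<in> I" "of_int k + d \<le> g (n+1) - g n" "g (n+1) - g n \<le> of_int k + 1 - d"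
          by (auto simp: A2_def \<theta>_def)
      qed
      show ?thesis unfolding pq
      proof (rule Kusmin_Landau[where k = k])
        fix n assume n: "p \<le> n" "Suc n < q"
        show "g (n+2) - g (n+1) \<le> g (n+1) - g n"
          using mem(1)[of n] mem(1)[of "Suc n"] n dec[of n] l by (auto simp: I_def)
      qed (use mem d in auto)
    qed
    ultimately have "norm (\<Sum>n\<in>{n\<in>I. \<lfloor>\<theta> n\<rfloor> = k}. ee (g n)) \<le> (d/l + 1) + (2/d + (d/l+1))"
      by (simp only: norm_triangle_mono)
    also have "d / l = 1 / d" using d by (simp flip: d(3))
    also have "1/d + 1 + (2/d + (1/d + 1)) \<le> 5/d"
    proof -
      have "2 \<le> 1/d" using d by (simp add: field_simps)
      then show ?thesis by (simp add: divide_inverse)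
    qed
    finally show ?thesis .
  qed
  have "(\<Sum>n=a..<b. ee (g n)) = (\<Sum>k\<in>K. \<Sum>n\<in>{n\<in>I. \<lfloor>\<theta> n\<rfloor> = k}. ee (g n))"
    unfolding K_def I_def by (rule sum.image_gen) simp
  also have "norm \<dots> \<le> (\<Sum>k\<in>K. 5 / d)" by (intro sum_norm_le inner)
  also have "\<dots> = real (card K) * (5/d)" by simp
  also have "\<dots> \<le> (V + 2) * (5 / d)" using cK d by (intro mult_right_mono) auto
  finally show ?thesis by (simp add: d_def)
qed (use V l in auto)

text \<open>Summation by parts: the factor \<open>q\<close> enters only through its last value and
  its total variation.\<close>

lemma Abel_norm_le:
  fixes z q :: "nat \<Rightarrow> complex"
  assumes Z: "\<And>c. a \<le> c \<Longrightarrow> c \<le> b \<Longrightarrow> norm (\<Sum>n=a..<c. z n) \<le> Z"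
    and ab: "a < b"
  shows "norm (\<Sum>n=a..<b. z n * q n) \<le> Z * (norm (q (b-1)) + (\<Sum>n=a..<b-1. norm (q n - q (Suc n))))"
proof -
  define P where "P c = (\<Sum>n=a..<c. z n)" for c
  have "(\<Sum>n=a..<c. z n * q n) = P c * q (c - 1) + (\<Sum>n=a..<c-1. P (Suc n) * (q n - q (Suc n)))"
    if "a < c" for c
    using that
  proof (induction c)
    case (Suc c)
    show ?case
    proof (cases "a < c")
      case True
      then obtain c' where c: "c = Suc c'" "a \<le> c'" by (cases c) auto
      show ?thesis using Suc.IH[OF True] True c by (simp add: P_def algebra_simps)
    next
      case False
      then have "c = a" using Suc.prems by simp
      then show ?thesis by (simp add: P_def)
    qed
  qed simp
  from this[OF ab] have "norm (\<Sum>n=a..<b. z n * q n) \<le> 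
     norm (P b) * norm (q (b - 1)) + (\<Sum>n=a..<b-1. norm (P (Suc n)) * norm (q n - q (Suc n)))"
    by (auto intro!: norm_triangle_le add_mono sum_norm_le simp: norm_mult)
  also have "\<dots> \<le> Z * norm (q (b - 1)) + (\<Sum>n=a..<b-1. Z * norm (q n - q (Suc n)))"
    using ab by (intro add_mono sum_mono mult_right_mono) (auto simp: P_def simp del: sum.op_ivl_Suc intro!: Z)
  finally show ?thesis by (simp add: algebra_simps sum_distrib_left)
qed

section \<open>Trigonometric approximation of the sawtooth\<close>

text \<open>The coefficients outside \<open>[-d, d]\<close> are unconstrained, so one function
  admits many \<open>c\<close>.\<close>

definition trigpoly :: "nat \<Rightarrow> (int \<Rightarrow> complex) \<Rightarrow> (real \<Rightarrow> complex) \<Rightarrow> bool" where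
  "trigpoly d c f \<longleftrightarrow> (\<forall>v. f v = (\<Sum>m\<in>{- int d..int d}. c m * ee (of_int m * v)))"

text \<open>Convolution of two finite coefficient sequences, which gives the coefficients of a
  product.\<close>

definition trig_conv :: "nat \<Rightarrow> nat \<Rightarrow> (int \<Rightarrow> complex) \<Rightarrow> (int \<Rightarrow> complex) \<Rightarrow> int \<Rightarrow> complex" where
  "trig_conv d d' a b k = (\<Sum>p\<in>{p\<in>{- int d..int d} \<times> {- int d'..int d'}. fst p + snd p = k}. a (fst p) * b (snd p))"

lemma trigpoly_mult_conv:
  assumes "trigpoly d a f" "trigpoly d' b g"
  shows "trigpoly (d + d') (trig_conv d d' a b) (\<lambda>v. f v * g v)"
proof -
  let ?I = "{- int d..int d}" and ?J = "{- int d'..int d'}" and ?K = "{- int (d + d')..int (d + d')}"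
  have "f v * g v = (\<Sum>m\<in>?K. trig_conv d d' a b m * ee (of_int m * v))" for v
  proof -
    have "f v * g v = (\<Sum>i\<in>?I. \<Sum>j\<in>?J. (a i * ee (of_int i * v)) * (b j * ee (of_int j * v)))"
      using assms unfolding trigpoly_def by (simp add: sum_product)
    also have "\<dots> = (\<Sum>p\<in>?I \<times> ?J. a (fst p) * b (snd p) * ee (of_int (fst p + snd p) * v))"
      by (simp add: sum.cartesian_product case_prod_unfold algebra_simps flip: ee_add)
    also have "\<dots> = (\<Sum>k\<in>?K. \<Sum>p\<in>{p\<in>?I \<times> ?J. fst p + snd p = k}. a (fst p) * b (snd p) * ee (of_int (fst p + snd p) * v))"
      by (rule sum.group[symmetric]) auto
    also have "\<dots> = (\<Sum>m\<in>?K. trig_conv d d' a b m * ee (of_int m * v))"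
      unfolding trig_conv_def sum_distrib_right by (intro sum.cong refl) auto
    finally show ?thesis .
  qed
  then show ?thesis unfolding trigpoly_def by blast
qed

lemma trigpoly_mult:
  assumes "trigpoly d a f" "trigpoly d' b g"
  shows "\<exists>c. trigpoly (d + d') c (\<lambda>v. f v * g v)"
  using trigpoly_mult_conv[OF assms] by blast

lemma trigpoly_power:
  assumes "trigpoly d a f"
  shows "\<exists>c. trigpoly (n * d) c (\<lambda>v. f v ^ n)"
proof (induction n)
  case 0
  have "trigpoly 0 (\<lambda>_. 1) (\<lambda>v. 1)" by (simp add: trigpoly_def)
  then show ?case by auto
next
  case (Suc n)
  then show ?case using trigpoly_mult[OF assms] by auto
qed

text \<open>The one-sided Dirichlet kernel, of modulus |sin(pi M v) / sin(pi v)|.\<close>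

definition Dir :: "nat \<Rightarrow> real \<Rightarrow> complex" where
  "Dir M v = (\<Sum>j<M. ee (real j * v))"

lemma trigpoly_Dir: "\<exists>c. trigpoly M c (Dir M)"
proof -
  let ?c = "\<lambda>m. if 0 \<le> m \<and> m < int M then 1 else 0 :: complex"
  have "Dir M v = (\<Sum>m\<in>{- int M..int M}. ?c m * ee (of_int m * v))" for v
  proof -
    have "(\<Sum>m\<in>{- int M..int M}. ?c m * ee (of_int m * v)) = (\<Sum>m\<in>int ` {..<M}. ?c m * ee (of_int m * v))"
      by (rule sum.mono_neutral_right) (auto simp: image_iff, metis nat_0_le nat_less_iff lessThan_iff zless_nat_eq_int_zless)
    also have "\<dots> = (\<Sum>j<M. ee (real j * v))"
      by (subst sum.reindex) (auto simp: inj_on_def)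
    finally show ?thesis by (simp add: Dir_def)
  qed
  then show ?thesis unfolding trigpoly_def by (intro exI[of _ ?c] allI)
qed

lemma trigpoly_cnj:
  assumes "trigpoly d a f"
  shows "trigpoly d (\<lambda>m. cnj (a (- m))) (\<lambda>v. cnj (f v))"
proof -
  have "cnj (f v) = (\<Sum>m\<in>{- int d..int d}. cnj (a (-m)) * ee (of_int m * v))" for v
  proof -
    have "cnj (f v) = (\<Sum>m\<in>{- int d..int d}. cnj (a m) * ee (- of_int m * v))"
      using assms by (simp add: trigpoly_def cnj_ee)
    also have "\<dots> = (\<Sum>m\<in>uminus ` {- int d..int d}. cnj (a (-m)) * ee (of_int m * v))"
      by (subst sum.reindex) (auto simp: inj_on_def)
    finally show ?thesis by simp
  qed
  then show ?thesis unfolding trigpoly_def by blast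
qed

lemma ee_has_vector_derivative:
  "((\<lambda>u. ee (a * u + b)) has_vector_derivative (2 * pi * a * \<i> * ee (a * u + b))) (at u within S)"
proof -
  have "((\<lambda>u. exp (\<i> * complex_of_real (2 * pi * (a * u + b)))) has_vector_derivative
      exp (\<i> * complex_of_real (2 * pi * (a * u + b))) * (\<i> * of_real (2 * pi * a))) (at u within S)"
    by (rule has_vector_derivative_real_field | auto intro!: derivative_eq_intros)+ 
  then show ?thesis
    by (simp add: ee_def cis_conv_exp algebra_simps)
qed

lemma ee_integral:
  "((\<lambda>u. ee (of_int m * u + b)) has_integral (if m = 0 then ee b else 0)) {0..1}"
proof (cases "m = 0")
  case True
  then show ?thesis using has_integral_const_real[of "ee b" 0 1] by simp
next
  case False
  have "((\<lambda>u. ee (of_int m * u + b)) has_integral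
     (ee (of_int m * 1 + b) / (2 * pi * m * \<i>) - ee (of_int m * 0 + b) / (2 * pi * m * \<i>))) {0..1}"
  proof (rule fundamental_theorem_of_calculus)
    fix x :: real
    show "((\<lambda>u. ee (of_int m * u + b) / (2 * pi * m * \<i>)) has_vector_derivative ee (of_int m * x + b)) (at x within {0..1})"
      using has_vector_derivative_mult_right[OF ee_has_vector_derivative[of "of_int m" b x "{0..1}"], of "1 / (2 * pi * m * \<i>)"] False
      by (simp add: field_simps)
  qed simp
  moreover have "ee (of_int m * 1 + b) = ee b"
    using ee_add_int[of b m] by (simp add: add.commute)
  ultimately show ?thesis using False by simp
qed

text \<open>Only the constant term survives integration over a full period. The translate
  \<open>b\<close> is what later allows the kernel to be shifted.\<close>

lemma trigpoly_integral:
  assumes "trigpoly d c f"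
  shows "((\<lambda>u. f (u + b)) has_integral c 0) {0..1}"
proof -
  have "((\<lambda>u. \<Sum>m\<in>{- int d..int d}. c m * ee (of_int m * u + of_int m * b)) has_integral
     (\<Sum>m\<in>{- int d..int d}. c m * (if m = 0 then ee (of_int m * b) else 0))) {0..1}"
    by (intro has_integral_sum has_integral_mult_right ee_integral) auto
  also have "(\<Sum>m\<in>{- int d..int d}. c m * (if m = 0 then ee (of_int m * b) else 0)) = (\<Sum>m\<in>{0}. c m)"
    by (rule sum.mono_neutral_cong_right) auto
  finally show ?thesis using assms by (simp add: trigpoly_def algebra_simps)
qed

lemma trigpoly_coeff:
  assumes "trigpoly d c f" "m \<in> {- int d..int d}"
  shows "((\<lambda>u. f u * ee (- of_int m * u)) has_integral c m) {0..1}"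
proof -
  have "((\<lambda>u. \<Sum>n\<in>{- int d..int d}. c n * ee (of_int (n - m) * u + 0)) has_integral
     (\<Sum>n\<in>{- int d..int d}. c n * (if n - m = 0 then ee 0 else 0))) {0..1}"
    by (intro has_integral_sum has_integral_mult_right ee_integral) auto
  also have "(\<Sum>n\<in>{- int d..int d}. c n * (if n - m = 0 then ee 0 else 0)) = (\<Sum>n\<in>{m}. c n)"
    using assms(2) by (intro sum.mono_neutral_cong_right) auto
  finally show ?thesis using assms
    by (simp add: trigpoly_def sum_distrib_right mult.assoc left_diff_distrib flip: ee_add)
qed

text \<open>With \<open>\<tau>\<close> the fractional part of \<open>t\<close>, the integrand is a
  linear function times an exponential on either side of the jump at \<open>1 - \<tau>\<close>.
  \<open>G c\<close> is an antiderivative for the linear factor \<open>c + u\<close>; it is used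
  with \<open>c = \<tau> - 1/2\<close> before the jump and \<open>c = \<tau> - 3/2\<close> after
  it.\<close>

lemma sawtooth_coeff:
  fixes t :: real and m :: int
  shows "((\<lambda>u. of_real (frac (t + u) - 1/2) * ee (of_int m * u)) has_integral 
     (if m = 0 then 0 else ee (- of_int m * t) / (2 * pi * m * \<i>))) {0..1}"
proof -
  define \<tau> where "\<tau> = frac t"
  have \<tau>: "0 \<le> \<tau>" "\<tau> < 1" by (auto simp: \<tau>_def frac_lt_1)
  have t: "t = of_int \<lfloor>t\<rfloor> + \<tau>" by (simp add: \<tau>_def frac_def)
  have fr: "frac (t + u) = (if u < 1 - \<tau> then \<tau> + u else \<tau> + u - 1)" if "0 \<le> u" "u \<le> 1" for u
  proof -
    have "\<lfloor>t + u\<rfloor> = (if u < 1 - \<tau> then \<lfloor>t\<rfloor> else \<lfloor>t\<rfloor> + 1)"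
      using that \<tau> t by (simp add: floor_eq_iff; linarith)
    then show ?thesis using t by (simp add: frac_def)
  qed
  define G where "G c u = (if m = 0 then of_real ((c + u)\<^sup>2 / 2) else 
     of_real (c + u) * ee (of_int m * u) / (2 * pi * m * \<i>) + ee (of_int m * u) / (4 * pi\<^sup>2 * (of_int m)\<^sup>2))" 
    for c u :: real
  have G: "((\<lambda>u. of_real (c + u) * ee (of_int m * u)) has_integral (G c b - G c a)) {a..b}" if "a \<le> b" for a b c
  proof (rule fundamental_theorem_of_calculus[OF that])
    fix x assume "x \<in> {a..b}"
    show "(G c has_vector_derivative of_real (c + x) * ee (of_int m * x)) (at x within {a..b})"
    proof (cases "m = 0")
      case True
      have "((\<lambda>u. (c + u)\<^sup>2 / 2) has_real_derivative (c + x)) (at x within {a..b})"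
        by (auto intro!: derivative_eq_intros)
      then have "((\<lambda>u. of_real ((c + u)\<^sup>2 / 2) :: complex) has_vector_derivative of_real (c + x)) (at x within {a..b})"
        by (intro has_vector_derivative_of_real) (simp add: has_real_derivative_iff_has_vector_derivative)
      then show ?thesis using True by (simp add: G_def[abs_def])
    next
      case False
      have e: "((\<lambda>u. ee (of_int m * u)) has_vector_derivative (2 * pi * m * \<i> * ee (of_int m * x))) (at x within {a..b})"
        using ee_has_vector_derivative[of "of_int m" 0 x "{a..b}"] by simp
      have l: "((\<lambda>u. of_real (c + u) :: complex) has_vector_derivative of_real 1) (at x within {a..b})"
        by (intro has_vector_derivative_of_real) (auto intro!: derivative_eq_intros simp flip: has_real_derivative_iff_has_vector_derivative)
      have "((\<lambda>u. of_real (c + u) * ee (of_int m * u) / (2 * pi * m * \<i>) + ee (of_int m * u) / (4 * pi\<^sup>2 * (of_int m)\<^sup>2))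
         has_vector_derivative ((of_real (c + x) * (2 * pi * m * \<i> * ee (of_int m * x)) + of_real 1 * ee (of_int m * x)) / (2 * pi * m * \<i>)
           + (2 * pi * m * \<i> * ee (of_int m * x)) / (4 * pi\<^sup>2 * (of_int m)\<^sup>2))) (at x within {a..b})"
        by (intro has_vector_derivative_add has_vector_derivative_divide has_vector_derivative_mult e l)
      also have "((of_real (c + x) * (2 * pi * m * \<i> * ee (of_int m * x)) + of_real 1 * ee (of_int m * x)) / (2 * pi * m * \<i>)
           + (2 * pi * m * \<i> * ee (of_int m * x)) / (4 * pi\<^sup>2 * (of_int m)\<^sup>2)) = of_real (c + x) * ee (of_int m * x)"
      proof -
        have "pi * m * \<i> \<noteq> 0" using False by simp
        define E P k where "E = ee (of_int m * x)" and "P = complex_of_real pi" and "k = (of_int m :: complex)"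
        have nz: "P \<noteq> 0" "k \<noteq> 0" using False by (auto simp: P_def k_def)
        have "((of_real (c + x) * (2 * P * k * \<i> * E) + E) / (2 * P * k * \<i>)
           + (2 * P * k * \<i> * E) / (4 * P\<^sup>2 * k\<^sup>2)) = of_real (c + x) * E"
        proof -
          have 1: "(of_real (c + x) * (2 * P * k * \<i> * E) + E) / (2 * P * k * \<i>) = of_real (c+x) * E - \<i> * E / (2 * P * k)"
            using nz by (simp add: field_simps)
          have 2: "(2 * P * k * \<i> * E) / (4 * P\<^sup>2 * k\<^sup>2) = \<i> * E / (2 * P * k)"
            using nz by (simp add: field_simps power2_eq_square)
          show ?thesis unfolding 1 2 by simp
        qed
        then show ?thesis by (simp add: E_def P_def k_def)
      qed
      finally show ?thesis using False by (simp add: G_def[abs_def])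
    qed
  qed
  have 1: "((\<lambda>u. of_real (frac (t + u) - 1/2) * ee (of_int m * u)) has_integral (G (\<tau> - 1/2) (1 - \<tau>) - G (\<tau> - 1/2) 0)) {0..1 - \<tau>}"
    using fr \<tau> by (intro has_integral_spike_finite[OF _ _ G, of "{1 - \<tau>}"]) auto
  have 2: "((\<lambda>u. of_real (frac (t + u) - 1/2) * ee (of_int m * u)) has_integral (G (\<tau> - 3/2) 1 - G (\<tau> - 3/2) (1 - \<tau>))) {1 - \<tau>..1}"
    using fr \<tau> by (intro has_integral_spike_finite[OF _ _ G, of "{}"]) auto
  have "((\<lambda>u. of_real (frac (t + u) - 1/2) * ee (of_int m * u)) has_integral 
     ((G (\<tau> - 1/2) (1 - \<tau>) - G (\<tau> - 1/2) 0) + (G (\<tau> - 3/2) 1 - G (\<tau> - 3/2) (1 - \<tau>)))) {0..1}"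
    using \<tau> by (intro has_integral_combine[OF _ _ 1 2]) auto
  also have "((G (\<tau> - 1/2) (1 - \<tau>) - G (\<tau> - 1/2) 0) + (G (\<tau> - 3/2) 1 - G (\<tau> - 3/2) (1 - \<tau>)))
     = (if m = 0 then 0 else ee (- of_int m * t) / (2 * pi * m * \<i>))"
  proof (cases "m = 0")
    case True
    have "(\<tau> - 1/2 + (1 - \<tau>))\<^sup>2 / 2 - (\<tau> - 1/2 + 0)\<^sup>2/2 + ((\<tau> - 3/2 + 1)\<^sup>2/2 - (\<tau> - 3/2 + (1 - \<tau>))\<^sup>2/2) = 0"
      by (simp add: power2_eq_square algebra_simps)
    then show ?thesis using True unfolding G_def
      by (simp flip: of_real_diff of_real_add)
  next
    case False
    have "of_int m * (1 - \<tau>) = - of_int m * t + of_int (m * (1 + \<lfloor>t\<rfloor>))"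
      by (subst t) (simp add: algebra_simps)
    then have E: "ee (of_int m * (1 - \<tau>)) = ee (- of_int m * t)" by (simp only: ee_add_int)
    have E1: "ee (of_int m * 1) = 1" by simp
    define P k e where "P = complex_of_real pi" and "k = (of_int m :: complex)" and "e = ee (- of_int m * t)"
    have nz: "P \<noteq> 0" "k \<noteq> 0" using False by (auto simp: P_def k_def)
    have E2: "ee (of_int m - \<tau> * of_int m) = ee (- (t * of_int m))"
      using E by (simp add: algebra_simps)
    show ?thesis using False unfolding G_def
      by (simp add: E2 E1 add_divide_distrib diff_divide_distrib algebra_simps)
  qed
  finally show ?thesis .
qed

lemma norm_Dir_le:
  assumes "0 < \<eta>" "\<eta> \<le> 1/2" "\<eta> \<le> v" "v \<le> 1 - \<eta>"
  shows "norm (Dir M v) \<le> 1 / (2 * \<eta>)"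
proof -
  have s: "2 * \<eta> \<le> sin (pi * v)" using assms by (intro sin_pi_ge_min) auto
  have e: "norm (ee v - 1) = 2 * \<bar>sin (pi * v)\<bar>"
    using dist_exp_i_1[of "2 * pi * v"] by (simp add: ee_def cis_conv_exp)
  then have ge: "4 * \<eta> \<le> norm (ee v - 1)" using s assms by simp
  have "Dir M v = (\<Sum>j<M. ee v ^ j)"
  proof -
    have "ee (real j * v) = ee v ^ j" for j
      by (induction j) (simp_all add: ee_add algebra_simps)
    then show ?thesis by (simp add: Dir_def)
  qed
  moreover have "ee v \<noteq> 1" using ge assms by auto
  ultimately have "Dir M v = (ee v ^ M - 1) / (ee v - 1)" by (simp add: geometric_sum)
  then have "norm (Dir M v) = norm (ee v ^ M - 1) / norm (ee v - 1)" by (simp add: norm_divide)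
  also have "\<dots> \<le> 2 / (4 * \<eta>)"
  proof (intro frac_le)
    have "norm (ee v ^ M - 1) \<le> norm (ee v ^ M) + norm (1::complex)" by (rule norm_triangle_ineq4)
    then show "norm (ee v ^ M - 1) \<le> 2" by (simp add: norm_power)
  qed (use ge assms in auto)
  finally show ?thesis by simp
qed

text \<open>All points \<open>j * v\<close> stay within an eighth of a turn, so every real part is
  at least cos(pi/3) = 1/2 and nothing cancels.\<close>

lemma norm_Dir_ge:
  assumes "0 \<le> v" "v \<le> 1 / (8 * real M)" "0 < M"
  shows "real M / 2 \<le> norm (Dir M v)"
proof -
  have "(\<Sum>j<M. 1/2) \<le> (\<Sum>j<M. Re (ee (real j * v)))"
  proof (rule sum_mono)
    fix j assume "j \<in> {..<M}"
    then have "real j * v \<le> real M * (1 / (8 * real M))"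
      using assms by (intro mult_mono) auto
    then have "real j * v \<le> 1/8" using assms by simp
    then have "2 * pi * (real j * v) \<le> 2 * pi * (1/8)" by (intro mult_left_mono) auto
    then have "cos (pi / 3) \<le> cos (2 * pi * (real j * v))"
      using assms by (intro cos_monotone_0_pi_le) auto
    then show "1/2 \<le> Re (ee (real j * v))" by (simp add: ee_def cos_60)
  qed
  also have "\<dots> = Re (Dir M v)" by (simp add: Dir_def)
  also have "\<dots> \<le> norm (Dir M v)" by (rule complex_Re_le_cmod)
  finally show ?thesis by simp
qed

lemma continuous_on_Dir [continuous_intros]:
  "continuous_on S f \<Longrightarrow> continuous_on S (\<lambda>x. Dir M (f x))"
  unfolding Dir_def ee_def by (intro continuous_intros)

text \<open>\<open>J\<close> is \<open>|Dir M|\<close> to the eighth power, normalised. With so high a power the crude pointwise bound away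
  from the origin still yields a degree small enough for the exponents in \<open>return_time_block\<close>.\<close>

lemma Jackson_kernel:
  assumes M: "0 < M" and \<eta>: "0 < \<eta>" "\<eta> \<le> 1/2"
  obtains J c where "trigpoly (8 * M) c (\<lambda>v. of_real (J v))" "\<And>m. norm (c m) \<le> 1" "c 0 = 1"
    "\<And>v. 0 \<le> J v" "\<And>v. \<eta> \<le> v \<Longrightarrow> v \<le> 1 - \<eta> \<Longrightarrow> J v \<le> 8 / (real M ^ 7 * \<eta> ^ 8)"
proof -
  obtain a where a: "trigpoly M a (Dir M)" using trigpoly_Dir by blast
  obtain b where b: "trigpoly (M + M) b (\<lambda>v. Dir M v * cnj (Dir M v))"
    using trigpoly_mult[OF a trigpoly_cnj[OF a]] by blast
  have "8 * M = 4 * (M + M)" by simp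
  then obtain c' where c': "trigpoly (8 * M) c' (\<lambda>v. (Dir M v * cnj (Dir M v)) ^ 4)"
    using trigpoly_power[OF b, of 4] by metis
  have eq: "(Dir M v * cnj (Dir M v)) ^ 4 = of_real (norm (Dir M v) ^ 8)" for v
    by (simp add: complex_norm_square[symmetric] flip: power_mult)
  \<comment> \<open>Coefficients outside the range are set to 0 so that the bound by
    \<open>Z\<close>, and after normalisation by 1, holds for every \<open>m\<close>.\<close>
  define c where "c m = (if m \<in> {- int (8*M)..int (8*M)} then c' m else 0)" for m
  have c: "trigpoly (8 * M) c (\<lambda>v. of_real (norm (Dir M v) ^ 8))"
  proof -
    have "(\<Sum>m\<in>{- int (8*M)..int (8*M)}. c m * ee (of_int m * v)) = (\<Sum>m\<in>{- int (8*M)..int (8*M)}. c' m * ee (of_int m * v))" for v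
      by (intro sum.cong) (auto simp: c_def)
    then show ?thesis using c' unfolding eq trigpoly_def by simp
  qed
  define Z where "Z = integral {0..1} (\<lambda>v. norm (Dir M v) ^ 8)"
  have int: "(\<lambda>v. norm (Dir M v) ^ 8) integrable_on {0..1}"
    by (intro integrable_continuous_interval continuous_intros)
  have Z: "((\<lambda>v. norm (Dir M v) ^ 8) has_integral Z) {0..1}"
    unfolding Z_def using int by (rule integrable_integral)
  have "((\<lambda>v. of_real (norm (Dir M v) ^ 8) :: complex) has_integral c 0) {0..1}"
    using trigpoly_integral[OF c, of 0] by simp
  moreover have "((\<lambda>v. of_real (norm (Dir M v) ^ 8) :: complex) has_integral of_real Z) {0..1}"
    using Z by (rule has_integral_of_real)
  ultimately have c0: "c 0 = of_real Z" by (rule has_integral_unique)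
  have cm: "norm (c m) \<le> Z" for m
  proof (cases "m \<in> {- int (8*M)..int (8*M)}")
    case True
    have h: "((\<lambda>u. of_real (norm (Dir M u) ^ 8) * ee (- of_int m * u)) has_integral c m) {0..1}"
      by (rule trigpoly_coeff[OF c True])
    have "norm (integral {0..1} (\<lambda>u. of_real (norm (Dir M u) ^ 8) * ee (- of_int m * u))) \<le> Z"
      unfolding Z_def using h by (intro integral_norm_bound_integral int) (auto simp: norm_mult norm_power)
    then show ?thesis using h by (simp add: integral_unique)
  next
    case False
    have "0 \<le> Z" unfolding Z_def by (intro integral_nonneg int) auto
    moreover have "c m = 0" unfolding c_def using False by (rule if_not_P)
    ultimately show ?thesis by simp
  qed
  \<comment> \<open>The interval \<open>[0, 1 / (8 M)]\<close> of nearly maximal values alone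
    contributes \<open>(M / 2) ^ 8 / (8 M)\<close>. Against \<open>(1 / (2 \<eta>)) ^ 8\<close> away
    from the origin this leaves the quotient \<open>8 / (M ^ 7 \<eta> ^ 8)\<close>.\<close>
  have Zge: "real M ^ 7 / 2 ^ 11 \<le> Z"
  proof -
    let ?r = "1 / (8 * real M)"
    have r: "0 \<le> ?r" "?r \<le> 1" using M by auto
    have "((\<lambda>v. (real M / 2) ^ 8) has_integral ((?r - 0) * (real M / 2) ^ 8)) {0..?r}"
      using has_integral_const_real[of "(real M / 2) ^ 8" 0 ?r] r by simp
    moreover have int2: "(\<lambda>v. norm (Dir M v) ^ 8) integrable_on {0..?r}"
      by (intro integrable_continuous_interval continuous_intros)
    ultimately have "(?r - 0) * (real M / 2) ^ 8 \<le> integral {0..?r} (\<lambda>v. norm (Dir M v) ^ 8)"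
      using norm_Dir_ge[OF _ _ M] M
      by (intro has_integral_le[OF _ integrable_integral]) (auto intro!: power_mono)
    also have "\<dots> \<le> Z" unfolding Z_def using int int2 r
      by (intro integral_subset_le) auto
    also have "(?r - 0) * (real M / 2) ^ 8 = real M ^ 7 / 2 ^ 11"
      using M by (simp add: field_simps eval_nat_numeral)
    finally show ?thesis .
  qed
  have Zpos: "0 < Z"
  proof -
    have "0 < real M ^ 7 / 2 ^ 11" using M by simp
    with Zge show ?thesis by linarith
  qed
  define J where "J v = norm (Dir M v) ^ 8 / Z" for v
  show ?thesis
  proof (rule that[of "\<lambda>m. c m / of_real Z" J])
    show "trigpoly (8 * M) (\<lambda>m. c m / of_real Z) (\<lambda>v. of_real (J v))"
      using c by (simp add: trigpoly_def J_def sum_divide_distrib)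
    show "norm (c m / of_real Z) \<le> 1" for m
      using cm[of m] Zpos by (simp add: norm_divide)
    show "c 0 / of_real Z = 1" using c0 Zpos by simp
    show "0 \<le> J v" for v using Zpos by (simp add: J_def)
    show "J v \<le> 8 / (real M ^ 7 * \<eta> ^ 8)" if "\<eta> \<le> v" "v \<le> 1 - \<eta>" for v
    proof -
      have "J v \<le> (1 / (2 * \<eta>)) ^ 8 / (real M ^ 7 / 2 ^ 11)"
        unfolding J_def using norm_Dir_le[OF \<eta> that] Zge M
        by (intro frac_le power_mono) auto
      also have "\<dots> = 8 / (real M ^ 7 * \<eta> ^ 8)"
        using M \<eta> by (simp add: power_divide power_mult_distrib field_simps)
      finally show ?thesis .
    qed
  qed
qed

lemma frac_add_le:
  assumes "0 \<le> (u::real)" shows "frac (t + u) \<le> frac t + u"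
proof -
  have "\<lfloor>t\<rfloor> \<le> \<lfloor>t + u\<rfloor>" using assms by (intro floor_mono) simp
  then show ?thesis by (simp add: frac_def)
qed

text \<open>Convolution multiplies Fourier coefficients, so only the frequencies of the kernel
  survive. At \<open>m = 0\<close> the bound \<open>1 / \<bar>of_int m\<bar>\<close> is 0 by the
  convention on division: there is no constant term, because the sawtooth has mean zero.\<close>

lemma sawtooth_convolution:
  assumes J: "trigpoly R c (\<lambda>v. of_real (J v))" "\<And>m. norm (c m) \<le> 1"
  shows "\<exists>a P. (\<forall>m. norm (a m) \<le> 1 / \<bar>of_int m\<bar>) \<and>
     (\<forall>t. of_real (P t) = (\<Sum>m\<in>{- int R..int R}. a m * ee (of_int m * t))) \<and>
     (\<forall>t. ((\<lambda>u. (frac (t + u) - 1/2) * J (u + b)) has_integral P t) {0..1})"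
proof -
  define a' where "a' m = (if m = 0 then 0 else c m * ee (of_int m * b) / (2 * pi * of_int m * \<i>))" for m :: int
  have main: "((\<lambda>u. of_real ((frac (t + u) - 1/2) * J (u + b))) has_integral 
      (\<Sum>m\<in>{- int R..int R}. a' m * ee (- of_int m * t))) {0..1}" for t
  proof -
    have "((\<lambda>u. \<Sum>m\<in>{- int R..int R}. (c m * ee (of_int m * b)) * (of_real (frac (t + u) - 1/2) * ee (of_int m * u))) has_integral
      (\<Sum>m\<in>{- int R..int R}. (c m * ee (of_int m * b)) * (if m = 0 then 0 else ee (- of_int m * t) / (2 * pi * m * \<i>)))) {0..1}"
      by (intro has_integral_sum has_integral_mult_right sawtooth_coeff) auto
    also have "(\<lambda>u. \<Sum>m\<in>{- int R..int R}. (c m * ee (of_int m * b)) * (of_real (frac (t + u) - 1/2) * ee (of_int m * u)))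
       = (\<lambda>u. of_real ((frac (t + u) - 1/2) * J (u + b)))"
    proof
      fix u
      have "of_real (J (u + b)) = (\<Sum>m\<in>{- int R..int R}. c m * (ee (of_int m * b) * ee (of_int m * u)))"
        using J(1) by (simp add: trigpoly_def algebra_simps flip: ee_add)
      then show "(\<Sum>m\<in>{- int R..int R}. (c m * ee (of_int m * b)) * (of_real (frac (t + u) - 1/2) * ee (of_int m * u)))
         = of_real ((frac (t + u) - 1/2) * J (u + b))"
        unfolding of_real_mult by (simp only: sum_distrib_left mult_ac)
    qed
    also have "(\<Sum>m\<in>{- int R..int R}. (c m * ee (of_int m * b)) * (if m = 0 then 0 else ee (- of_int m * t) / (2 * pi * m * \<i>)))
       = (\<Sum>m\<in>{- int R..int R}. a' m * ee (- of_int m * t))"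
      by (intro sum.cong) (auto simp: a'_def)
    finally show ?thesis .
  qed
  define P where "P t = integral {0..1} (\<lambda>u. (frac (t + u) - 1/2) * J (u + b))" for t
  have P: "((\<lambda>u. (frac (t + u) - 1/2) * J (u + b)) has_integral P t) {0..1}" for t
    unfolding P_def using has_integral_Re[OF main[of t]] 
    by (intro integrable_integral) (auto simp: integrable_on_def)
  have eq: "of_real (P t) = (\<Sum>m\<in>{- int R..int R}. a' m * ee (- of_int m * t))" for t
    using has_integral_unique[OF has_integral_of_real[OF P] main] .
  also have "(\<Sum>m\<in>{- int R..int R}. a' m * ee (- of_int m * t)) = (\<Sum>m\<in>uminus ` {- int R..int R}. a' (- m) * ee (of_int m * t))" for t
    by (subst sum.reindex) (auto simp: inj_on_def)
  finally have eq': "of_real (P t) = (\<Sum>m\<in>{- int R..int R}. a' (- m) * ee (of_int m * t))" for t by simp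
  have na: "norm (a' (- m)) \<le> 1 / \<bar>of_int m\<bar>" for m
  proof (cases "m = 0")
    case False
    then have "norm (a' (-m)) = norm (c (-m)) / (2 * pi * \<bar>of_int m\<bar>)"
      by (simp add: a'_def norm_divide norm_mult)
    also have "\<dots> \<le> 1 / (1 * \<bar>of_int m\<bar>)"
      using J(2)[of "-m"] False pi_gt3 by (intro frac_le mult_right_mono) auto
    finally show ?thesis by simp
  qed (simp add: a'_def)
  show ?thesis
    by (rule exI[of _ "\<lambda>m. a' (- m)"], rule exI[of _ P]) (use na eq' P in blast)
qed

text \<open>The sawtooth is convolved with the kernel shifted by \<open>\<eta>\<close> to either side: since it only jumps downwards,
  a kernel concentrated on one side of the origin gives one-sided bounds.\<close>

lemma sawtooth_sandwich:
  assumes M: "0 < M" and \<eta>: "0 < \<eta>" "\<eta> \<le> 1/2"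
  defines "\<kappa> \<equiv> 2 * \<eta> + 8 / (real M ^ 7 * \<eta> ^ 8)"
  shows "\<exists>a P b Q. (\<forall>m. norm (a m) \<le> 1 / \<bar>of_int m\<bar> \<and> norm (b m) \<le> 1 / \<bar>of_int m\<bar>) \<and>
     (\<forall>t. of_real (P t) = (\<Sum>m\<in>{- int (8*M)..int (8*M)}. a m * ee (of_int m * t))) \<and>
     (\<forall>t. of_real (Q t) = (\<Sum>m\<in>{- int (8*M)..int (8*M)}. b m * ee (of_int m * t))) \<and>
     (\<forall>t. P t - \<kappa> \<le> frac t - 1/2 \<and> frac t - 1/2 \<le> Q t + \<kappa>)"
proof -
  obtain J c where J: "trigpoly (8 * M) c (\<lambda>v. of_real (J v))" "\<And>m. norm (c m) \<le> 1" "c 0 = 1"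
    "\<And>v. 0 \<le> J v" "\<And>v. \<eta> \<le> v \<Longrightarrow> v \<le> 1 - \<eta> \<Longrightarrow> J v \<le> 8 / (real M ^ 7 * \<eta> ^ 8)"
    by (rule Jackson_kernel[OF M \<eta>]) (rule that)
  have J1: "((\<lambda>u. J (u + b)) has_integral 1) {0..1}" for b
  proof -
    have "((\<lambda>u. of_real (J (u + b)) :: complex) has_integral c 0) {0..1}" 
      by (rule trigpoly_integral[OF J(1)])
    then have "((\<lambda>u. Re (of_real (J (u + b)))) has_integral Re (c 0)) {0..1}" by (rule has_integral_Re)
    then show ?thesis using J(3) by simp
  qed
  let ?T = "8 / (real M ^ 7 * \<eta> ^ 8)"
  have T: "0 \<le> ?T" using \<eta> by simp
  have Ji: "((\<lambda>u. (\<alpha> * J (u + b) + \<beta>)) has_integral (\<alpha> + \<beta>)) {0..1}" for \<alpha> \<beta> b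
    using has_integral_add[OF has_integral_mult_right[OF J1, of \<alpha> b] has_integral_const_real[of \<beta> 0 1]] by simp
  \<comment> \<open>On \<open>[0, 1]\<close> the kernel \<open>J (u - \<eta>)\<close> is
    concentrated on \<open>u \<le> 2 * \<eta>\<close>, since beyond this point
    \<open>u - \<eta>\<close> lies in \<open>[\<eta>, 1 - \<eta>]\<close>. So its first moment is at
    most \<open>2 * \<eta>\<close> plus the tail.\<close>
  have k1: "u * J (u + - \<eta>) \<le> 2 * \<eta> * J (u + -\<eta>) + ?T" if "0 \<le> u" "u \<le> 1" for u
  proof (cases "u \<le> 2 * \<eta>")
    case True
    then show ?thesis using mult_right_mono[OF True J(4)] T by (simp add: add_increasing2)
  next
    case False
    have "u * J (u + - \<eta>) \<le> 1 * J (u + - \<eta>)" using that J(4) by (intro mult_right_mono) auto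
    also have "\<dots> \<le> ?T" using J(5)[of "u - \<eta>"] False that by simp
    finally show ?thesis using J(4)[of "u - \<eta>"] \<eta> by (simp add: add_increasing)
  qed
  \<comment> \<open>The mirror image: \<open>J (u + \<eta>)\<close> is concentrated near
    \<open>u = 1\<close>, which modulo 1 is just to the left of 0.\<close>
  have k2: "(1 - u) * J (u + \<eta>) \<le> 2 * \<eta> * J (u + \<eta>) + ?T" if "0 \<le> u" "u \<le> 1" for u
  proof (cases "1 - u \<le> 2 * \<eta>")
    case True
    then show ?thesis using mult_right_mono[OF True J(4)] T by (simp add: add_increasing2)
  next
    case False
    have "(1 - u) * J (u + \<eta>) \<le> 1 * J (u + \<eta>)" using that J(4) by (intro mult_right_mono) auto
    also have "\<dots> \<le> ?T" using J(5)[of "u + \<eta>"] False that by simp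
    finally show ?thesis using J(4)[of "u + \<eta>"] \<eta> by (simp add: add_increasing)
  qed
  obtain a P where P: "\<forall>m. norm (a m) \<le> 1 / \<bar>of_int m\<bar>"
     "\<forall>t. of_real (P t) = (\<Sum>m\<in>{- int (8*M)..int (8*M)}. a m * ee (of_int m * t))"
     "\<forall>t. ((\<lambda>u. (frac (t + u) - 1/2) * J (u + -\<eta>)) has_integral P t) {0..1}"
    using sawtooth_convolution[OF J(1,2), of "-\<eta>"] by blast
  obtain b Q where Q: "\<forall>m. norm (b m) \<le> 1 / \<bar>of_int m\<bar>"
     "\<forall>t. of_real (Q t) = (\<Sum>m\<in>{- int (8*M)..int (8*M)}. b m * ee (of_int m * t))"
     "\<forall>t. ((\<lambda>u. (frac (t + u) - 1/2) * J (u + \<eta>)) has_integral Q t) {0..1}"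
    using sawtooth_convolution[OF J(1,2), of "\<eta>"] by blast
  have "P t \<le> (frac t - 1/2 + 2 * \<eta>) + ?T" for t
  proof (rule has_integral_le[OF P(3)[rule_format] Ji[of "frac t - 1/2 + 2 * \<eta>" "-\<eta>" ?T]])
    fix u :: real assume u: "u \<in> {0..1}"
    have "(frac (t + u) - 1/2) * J (u + -\<eta>) \<le> (frac t - 1/2 + u) * J (u + -\<eta>)"
      using frac_add_le[of u t] u J(4) by (intro mult_right_mono) auto
    then show "(frac (t + u) - 1/2) * J (u + -\<eta>) \<le> (frac t - 1/2 + 2 * \<eta>) * J (u + -\<eta>) + ?T"
      using k1[of u] u by (simp add: algebra_simps)
  qed
  moreover have "(frac t - 1/2 - 2 * \<eta>) + - ?T \<le> Q t" for t
  proof (rule has_integral_le[OF Ji[of "frac t - 1/2 - 2 * \<eta>" "\<eta>" "-?T"] Q(3)[rule_format]])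
    fix u :: real assume u: "u \<in> {0..1}"
    \<comment> \<open>Since \<open>frac (t + 1) = frac t\<close>, the step forward from
      \<open>t + u\<close> to \<open>t + 1\<close> bounds the sawtooth at \<open>t + u\<close> from
      below.\<close>
    have "frac (t + 1) \<le> frac (t + u) + (1 - u)"
      using frac_add_le[of "1 - u" "t + u"] u by simp
    then have "(frac t - 1/2 - (1 - u)) * J (u + \<eta>) \<le> (frac (t + u) - 1/2) * J (u + \<eta>)"
      using u J(4) by (intro mult_right_mono) (auto simp: frac_1_eq)
    then show "(frac t - 1/2 - 2 * \<eta>) * J (u + \<eta>) + - ?T \<le> (frac (t + u) - 1/2) * J (u + \<eta>)"
      using k2[of u] u by (simp add: algebra_simps)
  qed
  ultimately have "P t - \<kappa> \<le> frac t - 1/2 \<and> frac t - 1/2 \<le> Q t + \<kappa>" for t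
    unfolding \<kappa>_def by (smt (verit, best))
  with P(1,2) Q(1,2) show ?thesis by blast
qed

text \<open>The sum of \<open>P\<close> against \<open>w\<close> is controlled by weighted
  exponential sums. The remainder is dominated by the nonnegative quantity
  \<open>Q - P + 3 * \<kappa>\<close> with the weight dropped; its sum again shows cancellation in
  \<open>P\<close> and \<open>Q\<close>, which is why unweighted exponential sums occur in the
  hypothesis.\<close>

lemma sawtooth_sum_le:
  fixes t :: "nat \<Rightarrow> real" and w :: "nat \<Rightarrow> complex"
  assumes M: "0 < M" and \<eta>: "0 < \<eta>" "\<eta> \<le> 1/2" and I: "finite I"
    and w: "\<And>n. n \<in> I \<Longrightarrow> norm (w n) \<le> 1"
    and q: "\<And>m. 1 \<le> m \<Longrightarrow> m \<le> 8 * M \<Longrightarrow> 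
       norm (\<Sum>n\<in>I. ee (real m * t n) * w n) \<le> q m \<and> norm (\<Sum>n\<in>I. ee (- real m * t n) * w n) \<le> q m \<and> 
       norm (\<Sum>n\<in>I. ee (real m * t n)) \<le> q m \<and> norm (\<Sum>n\<in>I. ee (- real m * t n)) \<le> q m"
  defines "\<kappa> \<equiv> 2 * \<eta> + 8 / (real M ^ 7 * \<eta> ^ 8)"
  shows "norm (\<Sum>n\<in>I. of_real (frac (t n) - 1/2) * w n) \<le> 3 * \<kappa> * card I + 6 * (\<Sum>m=1..8*M. q m / m)"
proof -
  let ?R = "{- int (8*M)..int (8*M)}"
  obtain a P b Q where PQ: "\<forall>m. norm (a m) \<le> 1 / \<bar>of_int m\<bar> \<and> norm (b m) \<le> 1 / \<bar>of_int m\<bar>"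
     "\<forall>t. complex_of_real (P t) = (\<Sum>m\<in>?R. a m * ee (of_int m * t))"
     "\<forall>t. complex_of_real (Q t) = (\<Sum>m\<in>?R. b m * ee (of_int m * t))"
     "\<forall>t. P t - \<kappa> \<le> frac t - 1/2 \<and> frac t - 1/2 \<le> Q t + \<kappa>"
    using sawtooth_sandwich[OF M \<eta>] unfolding \<kappa>_def by blast
  define S where "S = (\<Sum>m=1..8*M. q m / m)"
  have tp: "norm (\<Sum>n\<in>I. complex_of_real (U (t n)) * v n) \<le> 2 * S"
    if U: "\<forall>m. norm (d m) \<le> 1 / \<bar>of_int m\<bar>" "\<forall>t. complex_of_real (U t) = (\<Sum>m\<in>?R. d m * ee (of_int m * t))"
    and v: "\<And>m. 1 \<le> m \<Longrightarrow> m \<le> 8 * M \<Longrightarrow> norm (\<Sum>n\<in>I. ee (real m * t n) * v n) \<le> q m \<and> norm (\<Sum>n\<in>I. ee (- real m * t n) * v n) \<le> q m"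
    for U d v
  proof -
    have "(\<Sum>n\<in>I. complex_of_real (U (t n)) * v n) = (\<Sum>m\<in>?R. d m * (\<Sum>n\<in>I. ee (of_int m * t n) * v n))"
      unfolding U(2)[rule_format] sum_distrib_left sum_distrib_right
      by (subst sum.swap) (simp add: mult.assoc)
    also have "norm \<dots> \<le> (\<Sum>m\<in>?R. if m = 0 then 0 else q (nat \<bar>m\<bar>) / \<bar>of_int m\<bar>)"
    proof (rule sum_norm_le)
      fix m assume m: "m \<in> ?R"
      show "norm (d m * (\<Sum>n\<in>I. ee (of_int m * t n) * v n)) \<le> (if m = 0 then 0 else q (nat \<bar>m\<bar>) / \<bar>of_int m\<bar>)"
      proof (cases "m = 0")
        case True
        then show ?thesis using U(1)[rule_format, of 0] by simp
      next
        case False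
        define k where "k = nat \<bar>m\<bar>"
        have k: "1 \<le> k" "k \<le> 8 * M" using m False by (auto simp: k_def)
        have "of_int m = real k \<or> of_int m = - real k" using False by (auto simp: k_def)
        then have "norm (\<Sum>n\<in>I. ee (of_int m * t n) * v n) \<le> q k"
          using v[OF k] by auto
        then have "norm (d m * (\<Sum>n\<in>I. ee (of_int m * t n) * v n)) \<le> 1 / \<bar>of_int m\<bar> * q k"
          unfolding norm_mult using U(1) by (intro mult_mono) auto
        then show ?thesis using False by (simp add: k_def)
      qed
    qed
    also have "\<dots> = (\<Sum>m\<in>int ` {1..8*M} \<union> (\<lambda>k. - int k) ` {1..8*M}. q (nat \<bar>m\<bar>) / \<bar>of_int m\<bar>)"
    proof (rule sum.mono_neutral_cong_right)
      show "\<forall>i\<in>?R - (int ` {1..8*M} \<union> (\<lambda>k. - int k) ` {1..8*M}). (if i = 0 then 0 else q (nat \<bar>i\<bar>) / \<bar>of_int i\<bar>) = 0"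
      proof
        fix i assume i: "i \<in> ?R - (int ` {1..8*M} \<union> (\<lambda>k. - int k) ` {1..8*M})"
        have "i = 0"
        proof (rule ccontr)
          assume "i \<noteq> 0"
          then have "nat \<bar>i\<bar> \<in> {1..8*M}" "i = int (nat \<bar>i\<bar>) \<or> i = - int (nat \<bar>i\<bar>)" using i by auto
          then show False using i by blast
        qed
        then show "(if i = 0 then 0 else q (nat \<bar>i\<bar>) / \<bar>of_int i\<bar>) = 0" by simp
      qed
    qed auto
    also have "\<dots> = (\<Sum>m\<in>int ` {1..8*M}. q (nat \<bar>m\<bar>) / \<bar>of_int m\<bar>) + (\<Sum>m\<in>(\<lambda>k. - int k) ` {1..8*M}. q (nat \<bar>m\<bar>) / \<bar>of_int m\<bar>)"
      by (rule sum.union_disjoint) auto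
    also have "\<dots> = 2 * S"
      by (subst (1 2) sum.reindex) (auto simp: inj_on_def S_def)
    finally show ?thesis .
  qed
  have p1: "norm (\<Sum>n\<in>I. of_real (P (t n)) * w n) \<le> 2 * S"
    using PQ(1,2) q by (intro tp[of a P w]) auto
  have p2: "norm (\<Sum>n\<in>I. complex_of_real (P (t n)) * 1) \<le> 2 * S"
    using PQ(1,2) q by (intro tp[of a P "\<lambda>_. 1"]) auto
  have p3: "norm (\<Sum>n\<in>I. complex_of_real (Q (t n)) * 1) \<le> 2 * S"
    using PQ(1,3) q by (intro tp[of b Q "\<lambda>_. 1"]) auto
  have p2': "\<bar>\<Sum>n\<in>I. P (t n)\<bar> \<le> 2 * S" and p3': "\<bar>\<Sum>n\<in>I. Q (t n)\<bar> \<le> 2 * S"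
    using p2 p3 by (simp_all flip: of_real_sum)
  have "norm (\<Sum>n\<in>I. of_real (frac (t n) - 1/2 - P (t n)) * w n) \<le> (\<Sum>n\<in>I. Q (t n) - P (t n) + 3 * \<kappa>)"
  proof (rule sum_norm_le)
    fix n assume n: "n \<in> I"
    have "norm (of_real (frac (t n) - 1/2 - P (t n)) * w n) \<le> \<bar>frac (t n) - 1/2 - P (t n)\<bar> * 1"
      unfolding norm_mult norm_of_real using w[OF n] by (intro mult_left_mono) auto
    \<comment> \<open>The difference lies between \<open>- \<kappa>\<close> and
      \<open>Q - P + \<kappa>\<close>. Both ends obey the bound, because the sandwich forces
      \<open>Q - P \<ge> - 2 * \<kappa>\<close>.\<close>
    also have "\<dots> \<le> Q (t n) - P (t n) + 3 * \<kappa>"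
    proof -
      have "P (t n) - \<kappa> \<le> frac (t n) - 1/2" "frac (t n) - 1/2 \<le> Q (t n) + \<kappa>" using PQ(4) by blast+
      moreover have "0 \<le> \<kappa>" using \<eta> by (simp add: \<kappa>_def)
      ultimately show ?thesis unfolding mult_1_right by linarith
    qed
    finally show "norm (of_real (frac (t n) - 1/2 - P (t n)) * w n) \<le> Q (t n) - P (t n) + 3 * \<kappa>" .
  qed
  also have "\<dots> = (\<Sum>n\<in>I. Q (t n)) - (\<Sum>n\<in>I. P (t n)) + 3 * \<kappa> * card I"
    by (simp add: sum.distrib sum_subtractf)
  finally have e: "norm (\<Sum>n\<in>I. of_real (frac (t n) - 1/2 - P (t n)) * w n) \<le> 4 * S + 3 * \<kappa> * card I"
    using p2' p3' by linarith
  have "(\<Sum>n\<in>I. of_real (frac (t n) - 1/2) * w n) = (\<Sum>n\<in>I. of_real (P (t n)) * w n) + (\<Sum>n\<in>I. of_real (frac (t n) - 1/2 - P (t n)) * w n)"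
    by (simp add: sum.distrib[symmetric] algebra_simps)
  then have "norm (\<Sum>n\<in>I. of_real (frac (t n) - 1/2) * w n) \<le> 2 * S + (4 * S + 3 * \<kappa> * card I)"
    using norm_triangle_mono[OF p1 e] by simp
  then show ?thesis by (simp add: S_def)
qed

section \<open>Regularly varying functions and their inverses\<close>

text \<open>One formula covers both classes: \<open>h' = h * (c + \<theta>) / y\<close> and
  \<open>h'' = h / y\<^sup>2 * ((c + \<theta>) * (c + \<theta> - 1) + y * \<theta>')\<close>. For
  \<open>c > 1\<close> the last factor tends to \<open>c * (c - 1) > 0\<close>. For
  \<open>c = 1\<close> it tends to 0, but more slowly than every negative power; hence the loss
  \<open>y powr (-\<epsilon>)\<close> in the lower bound for \<open>h''\<close>.\<close>

lemma class_R_regularity: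
  assumes x0: "1 \<le> x0" and c: "1 \<le> c" "c < 2" and h: "h \<in> class_R x0 c"
  obtains h' h'' where
    "\<And>y. x0 < y \<Longrightarrow> (h has_real_derivative h' y) (at y)"
    "\<And>y. x0 < y \<Longrightarrow> (h' has_real_derivative h'' y) (at y)"
    "continuous_on {x0..} h" "strict_mono_on {x0..} h" "\<And>y. x0 \<le> y \<Longrightarrow> y \<le> h y"
    "\<forall>\<^sub>F y in at_top. h y / (2 * y) \<le> h' y \<and> h' y \<le> 5 / 2 * (h y / y)"
    "\<And>\<epsilon>. 0 < \<epsilon> \<Longrightarrow> \<forall>\<^sub>F y in at_top. y powr (-\<epsilon>) * h y / y\<^sup>2 \<le> h'' y"
    "\<And>\<epsilon>. 0 < \<epsilon> \<Longrightarrow> \<forall>\<^sub>F y in at_top. h y \<le> y powr (c + \<epsilon>)"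
proof -
  obtain l where l: "l \<in> (if c = 1 then class_L0 x0 else class_L x0)" and hl: "\<And>x. x \<ge> x0 \<Longrightarrow> h x = x powr c * l x"
    and sm: "strict_mono_on {x0..} h"
    using h unfolding class_R_def by auto
  have "\<exists>\<theta>. C2_on {x0..} \<theta> \<and> exp_form x0 \<theta> l \<and> (\<theta> \<longlongrightarrow> 0) at_top \<and>
     (if c = 1 then (\<forall>x\<ge>x0. 0 < \<theta> x) \<and> ((\<lambda>x. x * deriv \<theta> x / \<theta> x) \<longlongrightarrow> 0) at_top \<and> 
        (\<forall>\<epsilon>>0. \<exists>C>0. \<forall>x\<ge>x0. x powr (-\<epsilon>) \<le> C * \<theta> x)
      else ((\<lambda>x. x * deriv \<theta> x) \<longlongrightarrow> 0) at_top)"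
  proof (cases "c = 1")
    case True
    then show ?thesis using l unfolding class_L0_def by auto
  next
    case False
    then show ?thesis using l unfolding class_L_def by auto
  qed
  then obtain \<theta> where \<theta>: "C2_on {x0..} \<theta>" "exp_form x0 \<theta> l" "(\<theta> \<longlongrightarrow> 0) at_top"
    and \<theta>c: "if c = 1 then (\<forall>x\<ge>x0. 0 < \<theta> x) \<and> ((\<lambda>x. x * deriv \<theta> x / \<theta> x) \<longlongrightarrow> 0) at_top \<and> 
        (\<forall>\<epsilon>>0. \<exists>C>0. \<forall>x\<ge>x0. x powr (-\<epsilon>) \<le> C * \<theta> x)
      else ((\<lambda>x. x * deriv \<theta> x) \<longlongrightarrow> 0) at_top" by blast
  obtain \<theta>' where \<theta>': "\<And>x. x0 \<le> x \<Longrightarrow> (\<theta> has_real_derivative \<theta>' x) (at x within {x0..})"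
    using \<theta>(1) unfolding C2_on_def by auto
  have \<theta>'at: "(\<theta> has_real_derivative \<theta>' x) (at x)" if "x0 < x" for x
  proof -
    have "at x within {x0..} = at x" using that by (intro at_within_open_subset[of x "{x0<..}"]) auto
    then show ?thesis using \<theta>'[of x] that by simp
  qed
  have d\<theta>: "deriv \<theta> x = \<theta>' x" if "x0 < x" for x
    using \<theta>'at[OF that] by (rule DERIV_imp_deriv)
  have cont\<theta>: "continuous_on {x0..} \<theta>"
    using \<theta>' by (intro DERIV_continuous_on) auto
  define L where "L x = integral {x0..x} (\<lambda>t. \<theta> t / t)" for x
  have L: "(L has_real_derivative \<theta> x / x) (at x within {x0..b})" if "x0 \<le> x" "x \<le> b" for x b
    unfolding L_def using that x0 cont\<theta>
    by (intro integral_has_real_derivative) (auto intro!: continuous_intros elim: continuous_on_subset)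
  have Lat: "(L has_real_derivative \<theta> x / x) (at x)" if "x0 < x" for x
    using L[of x "x + 1"] that at_within_Icc_at[of x0 x "x+1"] by simp
  have contL: "continuous_on {x0..b} L" for b
    using L by (intro DERIV_continuous_on) auto
  have hx: "h x = x powr c * exp (L x)" if "x0 \<le> x" for x
    using \<theta>(2) hl[OF that] that unfolding exp_form_def L_def by auto
  have l1: "1 \<le> l x" if "x0 \<le> x" for x using \<theta>(2) that unfolding exp_form_def by auto
  define h' where "h' y = h y * (c + \<theta> y) / y" for y
  define h'' where "h'' y = h y / y\<^sup>2 * ((c + \<theta> y) * (c + \<theta> y - 1) + y * \<theta>' y)" for y
  have D1: "(h has_real_derivative h' y) (at y)" if "x0 < y" for y
  proof (rule has_field_derivative_transform_within_open[where S = "{x0<..}"])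
    have y: "y > 0" using that x0 by simp
    show "((\<lambda>x. x powr c * exp (L x)) has_real_derivative h' y) (at y)"
      unfolding h'_def hx[OF less_imp_le[OF that]]
      using DERIV_mult[OF has_real_derivative_powr[OF y, of c] DERIV_fun_exp[OF Lat[OF that]]] y
      by (simp add: powr_diff field_simps)
  qed (use that hx in auto)
  have D2: "(h' has_real_derivative h'' y) (at y)" if "x0 < y" for y
  proof -
    have y: "y > 0" using that x0 by simp
    have "((\<lambda>y. h y * (c + \<theta> y) / y) has_real_derivative 
       ((h' y * (c + \<theta> y) + (0 + \<theta>' y) * h y) * y - (h y * (c + \<theta> y)) * 1) / (y * y)) (at y)"
      using y by (intro DERIV_divide DERIV_mult DERIV_add DERIV_const D1 \<theta>'at that DERIV_ident) auto
    moreover have "((h' y * (c + \<theta> y) + (0 + \<theta>' y) * h y) * y - (h y * (c + \<theta> y)) * 1) / (y * y) = h'' y"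
      using y by (simp add: h'_def h''_def field_simps power2_eq_square)
    ultimately show ?thesis unfolding h'_def[abs_def] by simp
  qed
  have conth: "continuous_on {x0..} h"
  proof -
    have "continuous_on {x0..b} h" for b
    proof -
      have "continuous_on {x0..b} (\<lambda>x. x powr c * exp (L x))"
        using contL x0 by (intro continuous_intros) auto
      then show ?thesis by (rule continuous_on_eq) (use hx in auto)
    qed
    then have "continuous (at x within {x0..}) h" if "x0 \<le> x" for x
    proof (cases "x = x0")
      case True
      have "continuous (at x within {x0..x+1}) h"
        using \<open>continuous_on {x0..x+1} h\<close> that by (simp add: continuous_on_eq_continuous_within)
      moreover have "at x within {x0..x+1} = at x within {x0..}"
        by (rule at_within_nhd[of x "{..<x+1}"]) (use that in auto)
      ultimately show ?thesis by simp
    next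
      case False
      then show ?thesis using D1[of x] that by (intro DERIV_continuous[OF has_field_derivative_at_within]) auto
    qed
    then show ?thesis by (simp add: continuous_on_eq_continuous_within)
  qed
  have hge: "y \<le> h y" if "x0 \<le> y" for y
  proof -
    have "y * 1 \<le> y powr c * l y"
      using that x0 c l1[OF that] powr_mono[of 1 c y] by (intro mult_mono) auto
    then show ?thesis using hl[OF that] by simp
  qed
  have ev0: "\<forall>\<^sub>F y in at_top. x0 < y" by (rule eventually_gt_at_top)
  have th_small: "\<forall>\<^sub>F y in at_top. \<bar>\<theta> y\<bar> < e" if "0 < e" for e
    using tendstoD[OF \<theta>(3) that] by (simp add: dist_real_def)
  \<comment> \<open>The constants 1/2 and 5/2 come from \<open>1 \<le> c < 2\<close> and
    \<open>\<bar>\<theta>\<bar> < 1/2\<close>.\<close>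
  have E1: "\<forall>\<^sub>F y in at_top. h y / (2 * y) \<le> h' y \<and> h' y \<le> 5 / 2 * (h y / y)"
    using ev0 th_small[of "1/2", simplified]
  proof eventually_elim
    case (elim y)
    have y: "y > 0" "h y \<ge> 0" using elim hge[of y] x0 by auto
    have "h y / y * (1/2) \<le> h y / y * (c + \<theta> y)" "h y / y * (c + \<theta> y) \<le> h y / y * (5/2)"
      using y c elim by (intro mult_left_mono; simp)+
    then show ?case by (simp add: h'_def)
  qed
  have E2: "\<forall>\<^sub>F y in at_top. y powr (-\<epsilon>) * h y / y\<^sup>2 \<le> h'' y" if e: "0 < \<epsilon>" for \<epsilon>
  proof -
    have "\<forall>\<^sub>F y in at_top. y powr (-\<epsilon>) \<le> (c + \<theta> y) * (c + \<theta> y - 1) + y * \<theta>' y"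
    proof (cases "c = 1")
      case True
      with \<theta>c have pos: "\<And>x. x \<ge> x0 \<Longrightarrow> 0 < \<theta> x" and lim: "((\<lambda>x. x * deriv \<theta> x / \<theta> x) \<longlongrightarrow> 0) at_top"
        and low: "\<exists>C>0. \<forall>x\<ge>x0. x powr (-(\<epsilon>/2)) \<le> C * \<theta> x" using e by auto
      obtain C where C: "C > 0" "\<And>x. x \<ge> x0 \<Longrightarrow> x powr (-(\<epsilon>/2)) \<le> C * \<theta> x" using low by blast
      have "\<forall>\<^sub>F y in at_top. \<bar>y * deriv \<theta> y / \<theta> y\<bar> < 1/2"
        using tendstoD[OF lim, of "1/2"] by (simp add: dist_real_def)
      moreover have "\<forall>\<^sub>F y in at_top. y powr (-\<epsilon>) \<le> y powr (-(\<epsilon>/2)) / (2 * C)"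
        using e C(1) by real_asymp
      ultimately show ?thesis using ev0
      proof eventually_elim
        case (elim y)
        have t: "\<theta> y > 0" using pos elim by simp
        have "y powr (-\<epsilon>) \<le> y powr (-(\<epsilon>/2)) / (2 * C)" using elim by simp
        also have "\<dots> \<le> C * \<theta> y / (2 * C)" using C(2)[of y] C(1) elim by (intro divide_right_mono) auto
        also have "\<dots> = \<theta> y / 2" using C(1) by simp
        finally have "y powr (-\<epsilon>) \<le> \<theta> y / 2" .
        \<comment> \<open>For \<open>c = 1\<close> the factor is
          \<open>\<theta> * (1 + \<theta> + y * \<theta>' / \<theta>)\<close>. The class demands
          that \<open>y * \<theta>'\<close> be small relative to \<open>\<theta>\<close>, and this
          keeps the bracket above 1/2.\<close>
        also have "\<dots> \<le> \<theta> y * (1 + \<theta> y + y * \<theta>' y / \<theta> y)"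
        proof -
          have "\<bar>y * \<theta>' y / \<theta> y\<bar> < 1/2" using elim d\<theta>[of y] by simp
          then have "1/2 \<le> 1 + \<theta> y + y * \<theta>' y / \<theta> y" using t by linarith
          then have "\<theta> y * (1/2) \<le> \<theta> y * (1 + \<theta> y + y * \<theta>' y / \<theta> y)"
            using t by (intro mult_left_mono) auto
          then show ?thesis by simp
        qed
        also have "\<dots> = (c + \<theta> y) * (c + \<theta> y - 1) + y * \<theta>' y" using t True by (simp add: field_simps)
        finally show ?case .
      qed
    next
      case False
      then have lim: "((\<lambda>x. x * deriv \<theta> x) \<longlongrightarrow> 0) at_top" and c1: "1 < c" using \<theta>c c by auto
      have "((\<lambda>y. (c + \<theta> y) * (c + \<theta> y - 1) + y * deriv \<theta> y) \<longlongrightarrow> (c + 0) * (c + 0 - 1) + 0) at_top"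
        by (intro tendsto_intros \<theta>(3) lim)
      then have "\<forall>\<^sub>F y in at_top. (c + \<theta> y) * (c + \<theta> y - 1) + y * deriv \<theta> y > c * (c - 1) / 2"
        using c1 by (elim order_tendstoD) (auto simp: field_simps)
      moreover have "\<forall>\<^sub>F y in at_top. y powr (-\<epsilon>) < c * (c - 1) / 2"
      proof -
        have "((\<lambda>y. y powr (-\<epsilon>)) \<longlongrightarrow> 0) at_top" using e by real_asymp
        then show ?thesis using c1 by (elim order_tendstoD) auto
      qed
      ultimately show ?thesis using ev0
        by eventually_elim (use d\<theta> in auto)
    qed
    then show ?thesis using ev0
    proof eventually_elim
      case (elim y)
      have "h y / y\<^sup>2 * y powr (-\<epsilon>) \<le> h y / y\<^sup>2 * ((c + \<theta> y) * (c + \<theta> y - 1) + y * \<theta>' y)"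
        using elim hge[of y] x0 by (intro mult_left_mono) auto
      then show ?case by (simp add: h''_def mult.commute)
    qed
  qed
  have E3: "\<forall>\<^sub>F y in at_top. h y \<le> y powr (c + \<epsilon>)" if e: "0 < \<epsilon>" for \<epsilon>
  proof -
    obtain X where X: "X > x0" "\<And>y. y \<ge> X \<Longrightarrow> \<bar>\<theta> y\<bar> < \<epsilon> / 2"
    proof -
      obtain X' where "\<And>y. y \<ge> X' \<Longrightarrow> \<bar>\<theta> y\<bar> < \<epsilon> / 2"
        using th_small[of "\<epsilon>/2"] e unfolding eventually_at_top_linorder by auto
      then show ?thesis using that[of "max X' (x0+1)"] by auto
    qed
    \<comment> \<open>Beyond \<open>X\<close> the function \<open>L\<close> has slope at most
      \<open>\<epsilon> / 2\<close> in \<open>ln y\<close>; the other half of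
      \<open>\<epsilon>\<close> later absorbs the additive constant.\<close>
    have mono: "L y - \<epsilon>/2 * ln y \<le> L X - \<epsilon>/2 * ln X" if "X \<le> y" for y
    proof (rule DERIV_nonpos_imp_nonincreasing[OF that])
      fix z assume z: "X \<le> z" "z \<le> y"
      have "((\<lambda>y. L y - \<epsilon>/2 * ln y) has_real_derivative (\<theta> z / z - \<epsilon>/2 * (1/z))) (at z)"
        using z X x0 by (auto intro!: derivative_eq_intros Lat)
      moreover have "\<theta> z / z - \<epsilon>/2 * (1/z) \<le> 0"
      proof -
        have "\<theta> z \<le> \<epsilon> / 2" using X(2)[of z] z by linarith
        then have "\<theta> z / z \<le> (\<epsilon> / 2) / z" using z X x0 by (intro divide_right_mono) auto
        then show ?thesis by simp
      qed
      ultimately show "\<exists>d. ((\<lambda>y. L y - \<epsilon>/2 * ln y) has_real_derivative d) (at z) \<and> d \<le> 0" by blast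
    qed
    define C where "C = L X - \<epsilon>/2 * ln X"
    have "\<forall>\<^sub>F y in at_top. C + \<epsilon>/2 * ln y \<le> \<epsilon> * ln y" using e by real_asymp
    then show ?thesis using ev0 eventually_ge_at_top[of X]
    proof eventually_elim
      case (elim y)
      have y: "y > 0" using elim x0 by simp
      have "L y \<le> \<epsilon> * ln y" using mono[of y] elim by (simp add: C_def)
      then have "exp (L y) \<le> y powr \<epsilon>" using y by (simp add: powr_def)
      then show ?case using elim y by (simp add: hx powr_add mult_left_mono)
    qed
  qed
  show ?thesis by (rule that[OF D1 D2 conth sm hge E1 E2 E3])
qed

text \<open>As \<open>y \<le> h y\<close> makes \<open>h\<close> unbounded, the intermediate value
  theorem shows that its image is the whole half-line from \<open>h x0\<close>.\<close>

lemma comp_inv_regularity: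
  assumes cont: "continuous_on {x0..} h" and sm: "strict_mono_on {x0..} h" and ge: "\<forall>y\<ge>x0. y \<le> h y"
  shows "\<And>x. h x0 \<le> x \<Longrightarrow> h (comp_inv x0 h x) = x" "\<And>x. h x0 \<le> x \<Longrightarrow> x0 \<le> comp_inv x0 h x"
    "\<And>x. h x0 < x \<Longrightarrow> x0 < comp_inv x0 h x"
    "\<And>y. x0 \<le> y \<Longrightarrow> comp_inv x0 h (h y) = y"
    "\<And>x y. h x0 \<le> x \<Longrightarrow> x \<le> y \<Longrightarrow> comp_inv x0 h x \<le> comp_inv x0 h y"
    "filterlim (comp_inv x0 h) at_top at_top"
    "\<And>x. h x0 < x \<Longrightarrow> isCont (comp_inv x0 h) x"
    "\<And>x D. h x0 < x \<Longrightarrow> (h has_real_derivative D) (at (comp_inv x0 h x)) \<Longrightarrow> D \<noteq> 0 \<Longrightarrow>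
       (comp_inv x0 h has_real_derivative inverse D) (at x)"
proof -
  let ?p = "comp_inv x0 h"
  have inj: "inj_on h {x0..}" using sm by (rule strict_mono_on_imp_inj_on)
  have surj: "x \<in> h ` {x0..}" if hx: "h x0 \<le> x" for x
  proof -
    have "x0 \<le> max x x0" "x \<le> h (max x x0)" using ge[rule_format, of "max x x0"] by auto
    moreover have "continuous_on {x0..max x x0} h" using cont by (rule continuous_on_subset) auto
    ultimately obtain y where "x0 \<le> y" "h y = x" using IVT'[of h x0 x "max x x0"] hx by auto
    then show ?thesis by auto
  qed
  show hp: "h (?p x) = x" if "h x0 \<le> x" for x
    unfolding comp_inv_def by (rule f_inv_into_f[OF surj[OF that]])
  show pge: "x0 \<le> ?p x" if "h x0 \<le> x" for x
    using inv_into_into[OF surj[OF that]] unfolding comp_inv_def by simp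
  show pgt: "x0 < ?p x" if "h x0 < x" for x
    using pge[of x] hp[of x] that by (cases "?p x = x0") auto
  show ph: "?p (h y) = y" if "x0 \<le> y" for y
    unfolding comp_inv_def using inv_into_f_f[OF inj] that by simp
  show mono: "?p x \<le> ?p y" if "h x0 \<le> x" "x \<le> y" for x y
  proof (rule ccontr)
    assume "\<not> ?p x \<le> ?p y"
    then have "h (?p y) < h (?p x)" using pge[of x] pge[of y] that by (intro strict_mono_onD[OF sm]) auto
    then show False using hp[of x] hp[of y] that by simp
  qed
  show "filterlim ?p at_top at_top"
    unfolding filterlim_at_top
  proof
    fix Z :: real
    have "\<forall>\<^sub>F x in at_top. h (max Z x0) \<le> x" by (rule eventually_ge_at_top)
    then show "\<forall>\<^sub>F x in at_top. Z \<le> ?p x"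
    proof eventually_elim
      case (elim x)
      have "h x0 \<le> h (max Z x0)" using strict_mono_on_leD[OF sm, of x0 "max Z x0"] by auto
      then have "?p (h (max Z x0)) \<le> ?p x" using elim by (intro mono) auto
      then show ?case using ph[of "max Z x0"] by simp
    qed
  qed
  show ic: "isCont ?p x" if x: "h x0 < x" for x
  proof -
    define y where "y = ?p x"
    have y: "x0 < y" "h y = x" using pgt[OF x] hp[of x] x by (auto simp: y_def)
    have "isCont ?p (h y)"
    proof (rule isCont_inverse_function[where d = "(y - x0) / 2" and f = h and x = y])
      fix z assume "\<bar>z - y\<bar> \<le> (y - x0) / 2"
      from abs_le_D2[OF this] have z: "x0 < z" using y(1) by (simp add: field_simps)
      show "?p (h z) = z" using z by (intro ph) simp
      show "isCont h z" using continuous_on_interior[OF cont, of z] z by (simp add: interior_real_atLeast)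
    qed (use y in simp)
    then show ?thesis using y by simp
  qed
  show "(?p has_real_derivative inverse D) (at x)" if x: "h x0 < x" "(h has_real_derivative D) (at (?p x))" "D \<noteq> 0" for x D
    by (rule DERIV_inverse_function[where f = h and a = "h x0" and b = "x + 1"]) (use x hp ic in auto)
qed

text \<open>The bounds for \<open>h\<close> are read at \<open>y = p x\<close>, where
  \<open>h y = x\<close>, through \<open>p' = 1 / h'\<close> and
  \<open>p'' = - h'' / h' ^ 3\<close>. The constants are the reciprocals of 5/2 and 1/2, and 8/125
  is the cube of 2/5.\<close>

lemma comp_inv_asymptotics:
  assumes x0: "1 \<le> x0" and c: "1 \<le> c" "c < 2" and h: "h \<in> class_R x0 c" and e: "0 < \<epsilon>"
  defines "p \<equiv> comp_inv x0 h"
  obtains p' p'' where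
    "\<And>x y. h x0 \<le> x \<Longrightarrow> x \<le> y \<Longrightarrow> p x \<le> p y" 
    "\<forall>\<^sub>F x in at_top. x0 < p x \<and> p x \<le> x \<and> h (p x) = x \<and> x \<le> p x powr (c + \<epsilon>) \<and>
       (p has_real_derivative p' x) (at x) \<and> (p' has_real_derivative p'' x) (at x) \<and>
       2 / 5 * (p x / x) \<le> p' x \<and> p' x \<le> 2 * (p x / x) \<and> p'' x \<le> - (8 / 125) * (p x powr (1 - \<epsilon>) / x\<^sup>2)"
proof -
  obtain h' h'' where H: "\<And>y. x0 < y \<Longrightarrow> (h has_real_derivative h' y) (at y)"
    "\<And>y. x0 < y \<Longrightarrow> (h' has_real_derivative h'' y) (at y)"
    "continuous_on {x0..} h" "strict_mono_on {x0..} h" "\<And>y. x0 \<le> y \<Longrightarrow> y \<le> h y"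
    "\<forall>\<^sub>F y in at_top. h y / (2 * y) \<le> h' y \<and> h' y \<le> 5 / 2 * (h y / y)"
    "\<And>\<epsilon>. 0 < \<epsilon> \<Longrightarrow> \<forall>\<^sub>F y in at_top. y powr (-\<epsilon>) * h y / y\<^sup>2 \<le> h'' y"
    "\<And>\<epsilon>. 0 < \<epsilon> \<Longrightarrow> \<forall>\<^sub>F y in at_top. h y \<le> y powr (c + \<epsilon>)"
    by (rule class_R_regularity[OF x0 c h]) (rule that)
  have "\<forall>y\<ge>x0. y \<le> h y" using H(5) by blast
  note P = comp_inv_regularity[OF H(3,4) this, folded p_def]
  define p' where "p' x = inverse (h' (p x))" for x
  define p'' where "p'' x = - h'' (p x) / h' (p x) ^ 3" for x
  have "\<forall>\<^sub>F y in at_top. (h y / (2 * y) \<le> h' y \<and> h' y \<le> 5 / 2 * (h y / y)) \<and> y powr (-\<epsilon>) * h y / y\<^sup>2 \<le> h'' y \<and> h y \<le> y powr (c + \<epsilon>)"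
    by (intro eventually_conj[OF H(6) eventually_conj[OF H(7)[OF e] H(8)[OF e]]])
  then have ev: "\<forall>\<^sub>F x in at_top. (h (p x) / (2 * p x) \<le> h' (p x) \<and> h' (p x) \<le> 5 / 2 * (h (p x) / p x)) \<and> 
      p x powr (-\<epsilon>) * h (p x) / (p x)\<^sup>2 \<le> h'' (p x) \<and> h (p x) \<le> p x powr (c + \<epsilon>)"
    using P(6) by (rule eventually_compose_filterlim)
  then obtain X where X: "\<And>x. X \<le> x \<Longrightarrow> (h (p x) / (2 * p x) \<le> h' (p x) \<and> h' (p x) \<le> 5 / 2 * (h (p x) / p x)) \<and> 
      p x powr (-\<epsilon>) * h (p x) / (p x)\<^sup>2 \<le> h'' (p x) \<and> h (p x) \<le> p x powr (c + \<epsilon>)"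
    unfolding eventually_at_top_linorder by blast
  define Y where "Y = max X (h x0)"
  have D1: "(p has_real_derivative p' x) (at x)" if "Y < x" for x
    unfolding p'_def
  proof (rule P(8))
    have x: "h x0 < x" "X \<le> x" using that by (auto simp: Y_def)
    show "h x0 < x" by fact
    show "(h has_real_derivative h' (p x)) (at (p x))" by (rule H(1)[OF P(3)[OF x(1)]])
    have "0 < h (p x) / (2 * p x)" using P(3)[OF x(1)] P(1)[of x] x H(5)[of x0] x0 by auto
    then show "h' (p x) \<noteq> 0" using X[OF x(2)] by auto
  qed
  have main: "x0 < p x \<and> p x \<le> x \<and> h (p x) = x \<and> x \<le> p x powr (c + \<epsilon>) \<and>
       (p has_real_derivative p' x) (at x) \<and> (p' has_real_derivative p'' x) (at x) \<and>
       2 / 5 * (p x / x) \<le> p' x \<and> p' x \<le> 2 * (p x / x) \<and> p'' x \<le> - (8 / 125) * (p x powr (1 - \<epsilon>) / x\<^sup>2)" if "Y < x" for x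
  proof -
    have x: "h x0 < x" "X \<le> x" using that by (auto simp: Y_def)
    define u where "u = p x"
    have u: "x0 < u" "h u = x" using P(3)[OF x(1)] P(1)[of x] x by (auto simp: u_def)
    have u0: "0 < u" "0 < x" "u \<le> x" using u H(5)[of x0] H(5)[of u] x0 x by auto
    have b: "x / (2 * u) \<le> h' u" "h' u \<le> 5/2 * (x / u)" "u powr (-\<epsilon>) * x / u\<^sup>2 \<le> h'' u" "x \<le> u powr (c + \<epsilon>)"
      using X[OF x(2)] u by (auto simp: u_def)
    have hp: "0 < h' u"
    proof -
      have "0 < x / (2 * u)" using u0 by simp
      with b(1) show ?thesis by linarith
    qed
    have d2: "(p' has_real_derivative p'' x) (at x)"
    proof -
      have "((\<lambda>x. h' (p x)) has_real_derivative h'' (p x) * p' x) (at x)"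
        using D1[OF that] H(2)[of "p x"] u by (intro DERIV_chain2) (auto simp: u_def)
      then have "((\<lambda>x. inverse (h' (p x))) has_real_derivative (- (inverse (h' (p x)) * (h'' (p x) * p' x) * inverse (h' (p x))))) (at x)"
        using hp by (intro DERIV_inverse') (auto simp: u_def)
      then show ?thesis unfolding p'_def[abs_def] p''_def
        by (simp add: power3_eq_cube field_simps)
    qed
    have "1 / (5/2 * (x / u)) \<le> 1 / h' u" "1 / h' u \<le> 1 / (x / (2 * u))"
      using b hp u0 by (intro divide_left_mono mult_pos_pos; simp)+
    then have p'b: "2 / 5 * (u / x) \<le> p' x" "p' x \<le> 2 * (u / x)"
      by (simp_all add: p'_def u_def inverse_eq_divide)
    have "8 / 125 * (u powr (1 - \<epsilon>) / x\<^sup>2) = (u powr (-\<epsilon>) * x / u\<^sup>2) / (5/2 * (x / u)) ^ 3"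
      using u0 by (simp add: powr_diff powr_minus field_simps eval_nat_numeral)
    also have "\<dots> \<le> h'' u / h' u ^ 3"
      using b u0 hp by (intro frac_le power_mono) (auto intro: order_trans[rotated])
    finally have "p'' x \<le> - (8 / 125) * (u powr (1 - \<epsilon>) / x\<^sup>2)"
      by (simp add: p''_def u_def)
    then show ?thesis using u u0 b d2 D1[OF that] p'b by (simp add: u_def)
  qed
  show ?thesis
  proof (rule that)
    show "p x \<le> p y" if "h x0 \<le> x" "x \<le> y" for x y by (rule P(5)[OF that])
    show "\<forall>\<^sub>F x in at_top. x0 < p x \<and> p x \<le> x \<and> h (p x) = x \<and> x \<le> p x powr (c + \<epsilon>) \<and>
       (p has_real_derivative p' x) (at x) \<and> (p' has_real_derivative p'' x) (at x) \<and>
       2 / 5 * (p x / x) \<le> p' x \<and> p' x \<le> 2 * (p x / x) \<and> p'' x \<le> - (8 / 125) * (p x powr (1 - \<epsilon>) / x\<^sup>2)"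
      using eventually_gt_at_top[of Y] by eventually_elim (rule main)
  qed
qed

text \<open>Monotonicity holds because \<open>\<psi>'\<close> is asymptotic to the second derivative
  of the inverse, which is negative. For the size, \<open>c + \<epsilon> = 6/5\<close> gives
  \<open>p x \<ge> x powr (5/6)\<close>, so that \<open>\<psi>\<close>, being asymptotic to
  \<open>p'\<close>, is at least of order \<open>p x / x \<ge> x powr (-1/6)\<close>; the exponent
  is then relaxed to -1/5.\<close>

lemma admissible_psi_regularity:
  assumes x0: "1 \<le> x0" and c: "1 \<le> c" "c < 6/5" and h: "h \<in> class_R x0 c" and psi: "admissible_psi x0 h \<psi>"
  obtains X C where "1 \<le> X" "0 < C" "\<And>x y. X \<le> x \<Longrightarrow> x \<le> y \<Longrightarrow> \<psi> y \<le> \<psi> x" "\<And>x. X \<le> x \<Longrightarrow> C * x powr (-1/5) \<le> \<psi> x"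
proof -
  define \<epsilon> where "\<epsilon> = (6/5 - c)"
  have e: "0 < \<epsilon>" using c by (simp add: \<epsilon>_def)
  have c2: "c < 2" using c by simp
  define p where "p = comp_inv x0 h"
  obtain p' p'' where P: "\<And>x y. h x0 \<le> x \<Longrightarrow> x \<le> y \<Longrightarrow> p x \<le> p y" 
    "\<forall>\<^sub>F x in at_top. x0 < p x \<and> p x \<le> x \<and> h (p x) = x \<and> x \<le> p x powr (c + \<epsilon>) \<and>
       (p has_real_derivative p' x) (at x) \<and> (p' has_real_derivative p'' x) (at x) \<and>
       2 / 5 * (p x / x) \<le> p' x \<and> p' x \<le> 2 * (p x / x) \<and> p'' x \<le> - (8 / 125) * (p x powr (1 - \<epsilon>) / x\<^sup>2)"
    by (rule comp_inv_asymptotics[OF x0 c(1) c2 h e, folded p_def]) (rule that)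
  obtain Y where Y: "\<And>x. Y \<le> x \<Longrightarrow> x0 < p x \<and> p x \<le> x \<and> h (p x) = x \<and> x \<le> p x powr (c + \<epsilon>) \<and>
       (p has_real_derivative p' x) (at x) \<and> (p' has_real_derivative p'' x) (at x) \<and>
       2 / 5 * (p x / x) \<le> p' x \<and> p' x \<le> 2 * (p x / x) \<and> p'' x \<le> - (8 / 125) * (p x powr (1 - \<epsilon>) / x\<^sup>2)"
    using P(2) unfolding eventually_at_top_linorder by blast
  have dp: "deriv p x = p' x" if "Y < x" for x using Y[of x] that by (intro DERIV_imp_deriv) auto
  have dp2: "deriv (deriv p) x = p'' x" if "Y < x" for x
  proof (rule DERIV_imp_deriv)
    show "(deriv p has_real_derivative p'' x) (at x)"
      by (rule has_field_derivative_transform_within_open[where S = "{Y<..}" and f = p']) (use Y[of x] dp that in auto)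
  qed
  obtain \<psi>' where \<psi>': "\<And>x. 1 \<le> x \<Longrightarrow> (\<psi> has_real_derivative \<psi>' x) (at x within {1..})"
    and as: "\<psi> \<sim>[at_top] deriv p" "deriv \<psi> \<sim>[at_top] deriv (deriv p)"
    using psi unfolding admissible_psi_def C2_on_def p_def by auto
  have d\<psi>: "(\<psi> has_real_derivative \<psi>' x) (at x)" if "1 < x" for x
  proof -
    have "at x within {1..} = at x" using that by (intro at_within_open_subset[of x "{1<..}"]) auto
    then show ?thesis using \<psi>'[of x] that by simp
  qed
  have neg: "\<forall>\<^sub>F x in at_top. \<psi>' x < 0"
    using asymp_equiv_eventually_neg_iff[OF as(2)] eventually_gt_at_top[of Y] eventually_gt_at_top[of 1]
  proof eventually_elim
    case (elim x)
    have "0 < p x powr (1 - \<epsilon>) / x\<^sup>2" using Y[of x] elim x0 by auto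
    then have "p'' x < 0" using Y[of x] elim by auto
    moreover have "deriv \<psi> x = \<psi>' x" using d\<psi>[of x] elim by (intro DERIV_imp_deriv) auto
    ultimately show ?case using elim dp2[of x] by simp
  qed
  have low: "\<forall>\<^sub>F x in at_top. 1/5 * x powr (-1/5) \<le> \<psi> x"
  proof -
    have "((\<lambda>x. deriv p x / \<psi> x) \<longlongrightarrow> 1) at_top"
    proof (rule asymp_equivD_strong)
      show "deriv p \<sim>[at_top] \<psi>" using as(1) by (rule asymp_equiv_symI)
      show "\<forall>\<^sub>F x in at_top. deriv p x \<noteq> 0 \<or> \<psi> x \<noteq> 0"
        using eventually_ge_at_top[of 1] by eventually_elim (use psi in \<open>auto simp: admissible_psi_def\<close>)
    qed
    then have "\<forall>\<^sub>F x in at_top. deriv p x / \<psi> x < 2" by (rule order_tendstoD) simp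
    then show ?thesis using eventually_gt_at_top[of Y] eventually_gt_at_top[of 1]
    proof eventually_elim
      case (elim x)
      have ps: "0 < \<psi> x" using psi elim by (auto simp: admissible_psi_def)
      note y = Y[OF less_imp_le[OF \<open>Y < x\<close>]]
      have pp: "0 < p x" using y x0 by auto
      have "p' x \<le> 2 * \<psi> x" using elim ps dp[of x] by (simp add: field_simps)
      moreover have "x powr (-1/5) \<le> p x / x"
      proof -
        have "x powr (5/6) \<le> (p x powr (6/5)) powr (5/6)"
          using y elim by (intro powr_mono2) (auto simp: \<epsilon>_def)
        also have "\<dots> = p x" using pp by (simp add: powr_powr)
        finally have "x powr (5/6) / x \<le> p x / x" using elim by (intro divide_right_mono) auto
        moreover have "x powr (5/6) / x = x powr (- 1/6)" using elim powr_diff[of x "5/6" 1] by simp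
        moreover have "x powr (-1/5) \<le> x powr (-1/6)" using elim by (intro powr_mono) auto
        ultimately show ?thesis by linarith
      qed
      ultimately show ?case using y by linarith
    qed
  qed
  obtain X where X: "\<And>x. X \<le> x \<Longrightarrow> \<psi>' x < 0" "\<And>x. X \<le> x \<Longrightarrow> 1/5 * x powr (-1/5) \<le> \<psi> x"
    using eventually_conj[OF neg low] unfolding eventually_at_top_linorder by blast
  show ?thesis
  proof (rule that[of "max X 2" "1/5"])
    show "\<psi> y \<le> \<psi> x" if "max X 2 \<le> x" "x \<le> y" for x y
    proof (rule DERIV_nonpos_imp_nonincreasing[OF that(2)])
      fix z assume "x \<le> z" "z \<le> y"
      then show "\<exists>d. (\<psi> has_real_derivative d) (at z) \<and> d \<le> 0"
        using d\<psi>[of z] X(1)[of z] that(1) by (intro exI[of _ "\<psi>' z"]) auto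
    qed
  qed (use X in auto)
qed

text \<open>With \<open>y = \<phi> N\<close> one has \<open>\<phi>' \<le> 2 y / N\<close> and \<open>\<phi>'' \<le> - c y powr (1 - \<epsilon>) / N\<^sup>2\<close> on \<open>[N, 2 N]\<close>, where
  \<open>N powr (1/2) \<le> y \<le> N\<close>; the exponents below come from these bounds with \<open>\<epsilon> = 1/25\<close>.\<close>

lemma comp_inv_exp_sum:
  assumes x0: "1 \<le> x0" and c: "1 \<le> c" "c < 2" and h: "h \<in> class_R x0 c"
  defines "p \<equiv> comp_inv x0 h"
  shows "\<exists>N0. \<forall>N N' m. \<forall>\<xi>::real. N0 \<le> N \<longrightarrow> N' \<le> 2 * N \<longrightarrow> 1 \<le> m \<longrightarrow> m \<le> N \<longrightarrow>
    norm (\<Sum>n=N..<N'. ee (real m * p (real n) + \<xi> * real n)) \<le> 80 * (real m powr (1/2) * real N powr (13/25) + real m powr (-1/2) * real N powr (19/25))"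
proof -
  \<comment> \<open>\<open>\<epsilon> \<le> 2 - c\<close> yields \<open>N \<le> y powr 2\<close>,
    and \<open>\<epsilon> \<le> 1/25\<close> yields
    \<open>y powr (1 - \<epsilon>) \<ge> y powr (24/25)\<close>, whose square root is the exponent
    12/25 below.\<close>
  define \<epsilon> :: real where "\<epsilon> = min (1/25) (2 - c)"
  have e: "0 < \<epsilon>" "\<epsilon> \<le> 1/25" "c + \<epsilon> \<le> 2" using c unfolding \<epsilon>_def by linarith+
  obtain p' p'' where P: "\<And>x y. h x0 \<le> x \<Longrightarrow> x \<le> y \<Longrightarrow> p x \<le> p y" 
    "\<forall>\<^sub>F x in at_top. x0 < p x \<and> p x \<le> x \<and> h (p x) = x \<and> x \<le> p x powr (c + \<epsilon>) \<and>
       (p has_real_derivative p' x) (at x) \<and> (p' has_real_derivative p'' x) (at x) \<and>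
       2 / 5 * (p x / x) \<le> p' x \<and> p' x \<le> 2 * (p x / x) \<and> p'' x \<le> - (8 / 125) * (p x powr (1 - \<epsilon>) / x\<^sup>2)"
    by (rule comp_inv_asymptotics[OF x0 c h e(1), folded p_def]) (rule that)
  obtain Y where Y: "\<And>x. Y \<le> x \<Longrightarrow> x0 < p x \<and> p x \<le> x \<and> h (p x) = x \<and> x \<le> p x powr (c + \<epsilon>) \<and>
       (p has_real_derivative p' x) (at x) \<and> (p' has_real_derivative p'' x) (at x) \<and>
       2 / 5 * (p x / x) \<le> p' x \<and> p' x \<le> 2 * (p x / x) \<and> p'' x \<le> - (8 / 125) * (p x powr (1 - \<epsilon>) / x\<^sup>2)"
    using P(2) unfolding eventually_at_top_linorder by blast
  define N0 where "N0 = nat \<lceil>max (max Y (h x0)) 1\<rceil>"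
  show ?thesis
  proof (intro exI[of _ N0] allI impI)
    fix N N' m :: nat and \<xi> :: real
    assume N: "N0 \<le> N" "N' \<le> 2 * N" "1 \<le> m" "m \<le> N"
    have N1: "Y \<le> N" "h x0 \<le> N" "1 \<le> real N" using N(1) unfolding N0_def by linarith+
    define y where "y = p N"
    note YN = Y[OF N1(1), folded y_def]
    have y: "1 \<le> y" "y \<le> N" "real N \<le> y powr 2"
    proof -
      show "1 \<le> y" "y \<le> N" using YN x0 by auto
      then have "y powr (c + \<epsilon>) \<le> y powr 2" using e by (intro powr_mono) auto
      then show "real N \<le> y powr 2" using YN by auto
    qed
    \<comment> \<open>A quarter of 8/125, because \<open>x \<le> 2 * N\<close> enlarges the
      denominator by a factor of at most 4.\<close>
    define l where "l = 2 / 125 * (y powr (1 - \<epsilon>) / (real N)\<^sup>2)"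
    have lpos: "0 < l" using y N1 by (simp add: l_def)
    have p2: "p'' x \<le> - l" if "real N \<le> x" "x \<le> 2 * real N" for x
    proof -
      have "p'' x \<le> - (8 / 125 * (p x powr (1 - \<epsilon>) / x\<^sup>2))" using Y[of x] N1 that by simp
      moreover have "l \<le> 8 / 125 * (p x powr (1 - \<epsilon>) / x\<^sup>2)"
      proof -
        have "y \<le> p x" using P(1)[of N x] N1 that by (simp add: y_def)
        then have "y powr (1 - \<epsilon>) / (2 * real N)\<^sup>2 \<le> p x powr (1 - \<epsilon>) / x\<^sup>2"
          using y N1 that e by (intro frac_le powr_mono2 power_mono) auto
        then show ?thesis by (simp add: l_def field_simps power_mult_distrib)
      qed
      ultimately show ?thesis by linarith
    qed
    \<comment> \<open>Adding \<open>l / 2 * x\<^sup>2\<close> leaves a concave function; concavity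
      at a midpoint turns the bound on \<open>p''\<close> into one on second differences.\<close>
    have conc: "concave_on {real N..2 * real N} (\<lambda>x. p x + l / 2 * x\<^sup>2)"
    proof (rule f''_le0_imp_concave)
      fix x assume "x \<in> {real N..2 * real N}"
      then have x: "real N \<le> x" "x \<le> 2 * real N" "Y \<le> x" using N1 by auto
      show "((\<lambda>x. p x + l / 2 * x\<^sup>2) has_real_derivative p' x + l * x) (at x)"
        using Y[OF x(3)] by (auto intro!: derivative_eq_intros)
      show "((\<lambda>x. p' x + l * x) has_real_derivative p'' x + l) (at x)"
        using Y[OF x(3)] by (auto intro!: derivative_eq_intros)
      show "p'' x + l \<le> 0" using p2[OF x(1,2)] by simp
    qed simp
    have dec: "l \<le> (p (n + 1) - p n) - (p (n + 2) - p (n + 1))" if "N \<le> n" "n + 2 \<le> 2 * N" for n :: nat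
    proof -
      have "(1 - 1/2) * (p n + l / 2 * (real n)\<^sup>2) + 1/2 * (p (n+2) + l / 2 * (n+2)\<^sup>2) \<le> 
         p ((1 - 1/2) *\<^sub>R real n + (1/2) *\<^sub>R (real n + 2)) + l / 2 * ((1 - 1/2) *\<^sub>R real n + (1/2) *\<^sub>R (real n+2))\<^sup>2"
        using concave_onD[OF conc, of "1/2" "real n" "real n + 2"] that by (simp add: add.commute)
      also have "(1 - 1/2) *\<^sub>R real n + (1/2) *\<^sub>R (real n + 2) = real n + 1" by (simp add: field_simps)
      finally show ?thesis by (simp add: power2_eq_square algebra_simps)
    qed
    define g where "g n = real m * p (real n) + \<xi> * real n" for n :: nat
    show "norm (\<Sum>n=N..<N'. ee (real m * p (real n) + \<xi> * real n)) \<le> 80 * (real m powr (1/2) * real N powr (13/25) + real m powr (-1/2) * real N powr (19/25))"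
    proof (cases "N < N'")
      case True
      \<comment> \<open>The second differences are at least \<open>m * l\<close> in size. The total
        drop of the first differences is at most the first of them without its linear part, as
        \<open>p\<close> increases; the contributions of \<open>\<xi>\<close> cancel.\<close>
      have vdC: "norm (\<Sum>n=N..<N'. ee (g n)) \<le> (2 * m * (y / N) + 2) * (5 / sqrt (m * l))"
      proof (rule van_der_Corput)
        show "0 < m * l" using lpos N by simp
        have "real m * y powr (1 - \<epsilon>) \<le> real N * y powr 1"
          using y N e by (intro mult_mono powr_mono) auto
        also have "\<dots> \<le> real N * real N" using y by (intro mult_left_mono) auto
        finally have "real m * y powr (1 - \<epsilon>) / (real N)\<^sup>2 \<le> 1" using N1 by (simp add: power2_eq_square)
        moreover have "m * l = 2 / 125 * (real m * y powr (1 - \<epsilon>) / (real N)\<^sup>2)" by (simp add: l_def)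
        ultimately have "m * l \<le> 2 / 125 * 1" by (metis mult_left_mono zero_le_divide_iff zero_le_numeral)
        then show "m * l \<le> 1/4" by simp
        show "m * l \<le> g (n+1) - g n - (g (n+2) - g (n+1))" if "N \<le> n" "Suc n < N'" for n
        proof -
          have "m * l \<le> m * ((p (n + 1) - p n) - (p (n + 2) - p (n + 1)))"
            using dec[of n] that N by (intro mult_left_mono) auto
          then show ?thesis by (simp add: g_def algebra_simps)
        qed
        show "0 \<le> 2 * m * (y / N)" using y by simp
        have "p (N + 1) - p N \<le> 2 * (y / N)"
        proof -
          have "\<exists>z. real N < z \<and> z < real N + 1 \<and> p (real N + 1) - p (real N) = (real N + 1 - real N) * p' z"
            using Y N1 by (intro MVT2) auto
          then obtain z where z: "real N < z" "z < real N + 1" "p (real N + 1) - p (real N) = p' z" by auto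
          have "p' z \<le> p' N"
          proof (rule DERIV_nonpos_imp_nonincreasing[where f = p'])
            fix x assume x: "real N \<le> x" "x \<le> z"
            then have "p'' x \<le> 0" using p2[of x] lpos z N1 by auto
            then show "\<exists>d. (p' has_real_derivative d) (at x) \<and> d \<le> 0" using Y[of x] x N1 by auto
          qed (use z in auto)
          then show ?thesis using z YN by (simp add: add.commute)
        qed
        then have "m * (p (N + 1) - p N) \<le> m * (2 * (y / N))" by (intro mult_left_mono) auto
        moreover have "p (N' - 1) \<le> p N'" using P(1)[of "real (N' - 1)" "real N'"] True N1 by auto
        then have "m * p (N' - 1) \<le> m * p N'" by (intro mult_left_mono) auto
        ultimately show "g (N+1) - g N - (g N' - g (N' - 1)) \<le> 2 * m * (y / N)"
          using True by (simp add: g_def algebra_simps of_nat_diff)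
      qed
      also have "\<dots> \<le> 80 * (real m powr (1/2) * real N powr (13/25) + real m powr (-1/2) * real N powr (19/25))"
      proof -
        have s: "1 / sqrt (m * l) \<le> 8 * (m powr (-1/2) * N * y powr (-12/25))"
        proof -
          have "y powr (24/25) \<le> y powr (1 - \<epsilon>)" using e y by (intro powr_mono) auto
          then have "m * (1/64 * (y powr (24/25) / (real N)\<^sup>2)) \<le> m * l"
            unfolding l_def using y N1 by (intro mult_left_mono mult_mono divide_right_mono) auto
          then have "sqrt (m * (1/64 * (y powr (24/25) / (real N)\<^sup>2))) \<le> sqrt (m * l)" by (rule real_sqrt_le_mono)
          moreover have "sqrt (m * (1/64 * (y powr (24/25) / (real N)\<^sup>2))) = m powr (1/2) * y powr (12/25) / (8 * N)"
          proof (rule real_sqrt_unique)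
            have "(y powr (12/25))\<^sup>2 = y powr (24/25)" by (simp add: power2_eq_square flip: powr_add)
            moreover have "(real m powr (1/2))\<^sup>2 = m" using N by (simp add: power2_eq_square flip: powr_add)
            ultimately show "(m powr (1/2) * y powr (12/25) / (8 * N))\<^sup>2 = m * (1/64 * (y powr (24/25) / (real N)\<^sup>2))"
              by (simp add: power_mult_distrib power_divide)
          qed simp
          ultimately have "m powr (1/2) * y powr (12/25) / (8 * N) \<le> sqrt (m * l)" by (simp only:)
          then have "1 / sqrt (m * l) \<le> 1 / (m powr (1/2) * y powr (12/25) / (8 * N))"
            using y N N1 lpos by (intro divide_left_mono) auto
          also have "\<dots> = 8 * (m powr (-1/2) * N * y powr (-12/25))"
            using y N N1 by (simp add: powr_minus field_simps)
          finally show ?thesis .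
        qed
        have "(2 * m * (y / N) + 2) * (5 / sqrt (m * l)) = 10 * (m * (y / N) + 1) * (1 / sqrt (m * l))"
          by (simp add: algebra_simps)
        also have "\<dots> \<le> 10 * (m * (y / N) + 1) * (8 * (m powr (-1/2) * N * y powr (-12/25)))"
          using y by (intro mult_left_mono s) auto
        also have "\<dots> = 80 * ((m * m powr (-1/2)) * (y * y powr (-12/25)) + m powr (-1/2) * (N * y powr (-12/25)))"
          using N1 by (simp add: field_simps)
        \<comment> \<open>The first term increases with \<open>y\<close> and uses
          \<open>y \<le> N\<close>. The second decreases and uses
          \<open>y \<ge> N powr (1/2)\<close>, which gives the exponent 1 - 6/25 = 19/25.\<close>
        also have "\<dots> \<le> 80 * (real m powr (1/2) * real N powr (13/25) + real m powr (-1/2) * real N powr (19/25))"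
        proof (intro mult_left_mono add_mono mult_mono)
          show "m * m powr (-1/2) \<le> real m powr (1/2)" using N powr_mult_base[of m "-1/2"] by simp
          have "y * y powr (-12/25) = y powr (13/25)" using y powr_mult_base[of y "-12/25"] by simp
          also have "\<dots> \<le> N powr (13/25)" using y by (intro powr_mono2) auto
          finally show "y * y powr (-12/25) \<le> N powr (13/25)" .
          have "(y powr 2) powr (-6/25) \<le> N powr (-6/25)"
            using y N1 by (intro powr_mono2') auto
          then have "N * y powr (-12/25) \<le> N * N powr (-6/25)"
            using N1 by (intro mult_left_mono) (auto simp: powr_powr)
          also have "\<dots> = N powr (19/25)" using N1 powr_mult_base[of N "-6/25"] by simp
          finally show "N * y powr (-12/25) \<le> N powr (19/25)" .
        qed (use y in auto)
        finally show ?thesis .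
      qed
      finally show ?thesis by (simp add: g_def)
    qed (use N1 in auto)
  qed
qed

section \<open>Fourier comparison of the return sets with their densities\<close>

text \<open>Subtracting \<open>\<psi>\<close> from \<open>t\<close> crosses an integer exactly when
  \<open>frac t < \<psi>\<close>. So an interval indicator minus its length is a difference of two
  sawtooths, which is what the trigonometric approximation needs.\<close>

lemma of_bool_frac_less:
  fixes t \<psi> :: real
  assumes "0 < \<psi>" "\<psi> \<le> 1"
  shows "of_bool (frac t < \<psi>) - \<psi> = (frac (t - \<psi>) - 1/2) - (frac t - 1/2)"
proof (cases "frac t < \<psi>")
  case True
  have "frac (t - \<psi>) = frac t - \<psi> + 1"
  proof -
    have "\<lfloor>t - \<psi>\<rfloor> = \<lfloor>t\<rfloor> - 1" using True assms unfolding frac_def by linarith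
    then show ?thesis by (simp add: frac_def)
  qed
  then show ?thesis using True by simp
next
  case False
  have "frac (t - \<psi>) = frac t - \<psi>"
  proof -
    have "\<lfloor>t - \<psi>\<rfloor> = \<lfloor>t\<rfloor>" using False assms unfolding frac_def by linarith
    then show ?thesis by (simp add: frac_def)
  qed
  then show ?thesis using False by simp
qed

text \<open>Each term is at most \<open>2 * sqrt (Suc R) - 2 * sqrt R\<close>, and these
  telescope.\<close>

lemma sum_inverse_sqrt_le: "(\<Sum>m=1..R. real m powr (-1/2)) \<le> 2 * sqrt R"
proof (induction R)
  case (Suc R)
  have "1 / sqrt (Suc R) \<le> 2 * sqrt (Suc R) - 2 * sqrt R"
  proof -
    have "0 \<le> (sqrt (Suc R) - sqrt R)\<^sup>2" by simp
    then have "1 \<le> 2 * real (Suc R) - 2 * (sqrt R * sqrt (Suc R))"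
      by (simp add: power2_diff algebra_simps)
    then have "1 / sqrt (Suc R) \<le> (2 * real (Suc R) - 2 * (sqrt R * sqrt (Suc R))) / sqrt (Suc R)"
      by (intro divide_right_mono) auto
    also have "\<dots> = 2 * ((Suc R) / sqrt (Suc R)) - 2 * sqrt R"
      by (simp add: diff_divide_distrib del: of_nat_Suc)
    also have "(Suc R) / sqrt (Suc R) = sqrt (Suc R)" by (rule real_div_sqrt) simp
    finally show ?thesis .
  qed
  moreover have "real (Suc R) powr (-1/2) = 1 / sqrt (Suc R)"
    using powr_minus[of "real (Suc R)" "1/2"] by (simp add: powr_half_sqrt inverse_eq_divide del: of_nat_Suc)
  ultimately show ?case using Suc by (simp del: of_nat_Suc)
qed simp

text \<open>Partial summation removes the slowly varying phase \<open>\<rho> * \<psi> n\<close>: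
  since \<open>\<psi>\<close> decreases, its total variation is at most \<open>m * \<psi> N\<close>,
  and 7 exceeds 2 pi. The negative leading coefficient is reached by conjugation, with
  \<open>- \<xi>\<close> in place of \<open>\<xi>\<close>.\<close>

lemma exp_sum_perturbed:
  fixes p \<psi> :: "nat \<Rightarrow> real"
  assumes bd: "\<And>N'' \<xi>. N'' \<le> N' \<Longrightarrow> norm (\<Sum>n=N..<N''. ee (real m * p n + \<xi> * real n)) \<le> b"
    and NN: "N < N'" and \<psi>: "\<And>n. N \<le> n \<Longrightarrow> \<psi> (Suc n) \<le> \<psi> n" "\<And>n. N \<le> n \<Longrightarrow> 0 \<le> \<psi> n"
    and \<tau>: "\<tau> = real m \<or> \<tau> = - real m" and \<rho>: "\<bar>\<rho>\<bar> \<le> real m"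
  shows "norm (\<Sum>n=N..<N'. ee (\<tau> * p n + \<xi> * real n + \<rho> * \<psi> n)) \<le> b * (1 + 7 * real m * \<psi> N)"
proof -
  have bd': "norm (\<Sum>n=N..<N''. ee (\<tau> * p n + \<xi> * real n)) \<le> b" if "N'' \<le> N'" for N''
  proof (cases "\<tau> = real m")
    case False
    have "(\<Sum>n=N..<N''. ee (\<tau> * p n + \<xi> * real n)) = cnj (\<Sum>n=N..<N''. ee (real m * p n + (- \<xi>) * real n))"
      using False \<tau> by (simp add: cnj_ee algebra_simps)
    then show ?thesis using bd[OF that, of "-\<xi>"] by (simp only: complex_mod_cnj)
  qed (use bd that in simp)
  have b: "0 \<le> b" using bd'[of 0] by simp
  have "norm (\<Sum>n=N..<N'. ee (\<tau> * p n + \<xi> * real n) * ee (\<rho> * \<psi> n)) \<le> 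
      b * (norm (ee (\<rho> * \<psi> (N' - 1))) + (\<Sum>n=N..<N'-1. norm (ee (\<rho> * \<psi> n) - ee (\<rho> * \<psi> (Suc n)))))"
    by (rule Abel_norm_le[OF bd' NN]) 
  also have "\<dots> \<le> b * (1 + 7 * real m * \<psi> N)"
  proof (intro mult_left_mono add_mono b)
    have "(\<Sum>n=N..<N'-1. norm (ee (\<rho> * \<psi> n) - ee (\<rho> * \<psi> (Suc n)))) \<le> (\<Sum>n=N..<N'-1. 7 * real m * (\<psi> n - \<psi> (Suc n)))"
    proof (rule sum_mono)
      fix n assume "n \<in> {N..<N'-1}"
      then have d: "0 \<le> \<psi> n - \<psi> (Suc n)" using \<psi>(1)[of n] by simp
      have "norm (ee (\<rho> * \<psi> n) - ee (\<rho> * \<psi> (Suc n))) \<le> 2 * pi * (\<bar>\<rho>\<bar> * (\<psi> n - \<psi> (Suc n)))"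
        using norm_ee_diff_le[of "\<rho> * \<psi> n" "\<rho> * \<psi> (Suc n)"] d
        by (simp add: abs_mult flip: right_diff_distrib)
      also have "\<dots> \<le> 7 * (m * (\<psi> n - \<psi> (Suc n)))"
        using pi_less_4 pi_approx d \<rho> by (intro mult_mono) auto
      finally show "norm (ee (\<rho> * \<psi> n) - ee (\<rho> * \<psi> (Suc n))) \<le> 7 * real m * (\<psi> n - \<psi> (Suc n))" by simp
    qed
    also have "\<dots> = 7 * real m * (\<psi> N - \<psi> (N' - 1))"
    proof -
      have "(\<Sum>n=N..<K. \<psi> n - \<psi> (Suc n)) = \<psi> N - \<psi> K" if "N \<le> K" for K
        using that by (induction K rule: dec_induct) auto
      then show ?thesis using NN by (simp flip: sum_distrib_left)
    qed
    also have "\<dots> \<le> 7 * real m * \<psi> N" using \<psi>(2)[of "N'-1"] NN by (intro mult_left_mono) auto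
    finally show "(\<Sum>n=N..<N'-1. norm (ee (\<rho> * \<psi> n) - ee (\<rho> * \<psi> (Suc n)))) \<le> 7 * real m * \<psi> N" .
  qed simp
  finally show ?thesis by (simp only: ee_add)
qed

text \<open>The degree \<open>M\<close> is about \<open>N powr (27/100)\<close> and the width is
  \<open>\<eta> = N powr (-21/100)\<close>. Since 7 times 27 minus 8 times 21 is 21, the kernel's
  tail has the order of \<open>\<eta>\<close>; moreover both \<open>\<kappa> * N\<close> and the
  largest unperturbed exponential term, of exponent 27/100 + 13/25, are of order
  \<open>N powr (79/100)\<close>. The lower bound on \<open>\<psi>\<close> converts this into
  \<open>\<psi> N * N powr (99/100)\<close>.\<close>

lemma return_time_block:
  fixes p \<psi> :: "nat \<Rightarrow> real"
  assumes ex: "\<And>N N' m \<xi>. N0 \<le> N \<Longrightarrow> N' \<le> 2 * N \<Longrightarrow> 1 \<le> m \<Longrightarrow> m \<le> N \<Longrightarrow>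
     norm (\<Sum>n=N..<N'. ee (real m * p n + \<xi> * real n)) \<le> 80 * (real m powr (1/2) * real N powr (13/25) + real m powr (-1/2) * real N powr (19/25))"
    and \<psi>: "\<And>n. N0 \<le> n \<Longrightarrow> \<psi> (Suc n) \<le> \<psi> n" "\<And>n. N0 \<le> n \<Longrightarrow> 0 < \<psi> n \<and> \<psi> n \<le> 1"
    and c: "0 < c" "\<And>n. N0 \<le> n \<Longrightarrow> c * real n powr (-1/5) \<le> \<psi> n"
    and \<sigma>: "\<sigma> = 1 \<or> \<sigma> = (-1::real)"
  shows "\<exists>N1 C. \<forall>N N' \<xi>. N1 \<le> N \<longrightarrow> N' \<le> 2 * N \<longrightarrow> 
    norm (\<Sum>n=N..<N'. of_real (of_bool (frac (\<sigma> * p n) < \<psi> n) - \<psi> n) * ee (\<xi> * real n)) \<le> C * (\<psi> N * real N powr (99/100))"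
proof -
  define K where "K = (\<Sum>m. real m powr (-3/2))"
  have K: "(\<Sum>m=1..R. real m powr (-3/2)) \<le> K" for R
    unfolding K_def by (rule sum_le_suminf) (auto simp: summable_real_powr_iff)
  have "\<forall>\<^sub>F N in at_top. 16 * real N powr (27/100) \<le> real N \<and> 1 \<le> real N powr (27/100) \<and> real N powr (-21/100) \<le> 1/2 \<and> 1 \<le> real N"
    by (intro eventually_conj; real_asymp)
  then obtain N2 where N2: "\<And>N. N2 \<le> N \<Longrightarrow> 16 * real N powr (27/100) \<le> real N \<and> 1 \<le> real N powr (27/100) \<and> real N powr (-21/100) \<le> 1/2 \<and> 1 \<le> real N"
    unfolding eventually_at_top_linorder by blast
  define C where "C = (2 * (30 + 7680 + 480 * \<bar>K\<bar>)) / c + 2 * 480 * (448 + 56)"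
  have main: "norm (\<Sum>n=N..<N'. of_real (of_bool (frac (\<sigma> * p n) < \<psi> n) - \<psi> n) * ee (\<xi> * real n)) \<le> C * (\<psi> N * real N powr (99/100))"
    if N: "max N0 N2 \<le> N" "N' \<le> 2 * N" for N N' \<xi>
  proof (cases "N < N'")
    case NN: True
    have N0: "N0 \<le> N" "N2 \<le> N" using N by auto
    note big = N2[OF N0(2)]
    have N1: "1 \<le> real N" using big by blast
    define M where "M = nat \<lceil>real N powr (27/100)\<rceil>"
    define \<eta> where "\<eta> = real N powr (-21/100)"
    have M: "real N powr (27/100) \<le> M" "real M \<le> 2 * real N powr (27/100)" "0 < M"
      using big unfolding M_def by linarith+
    have \<eta>: "0 < \<eta>" "\<eta> \<le> 1/2" using big by (auto simp: \<eta>_def)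
    define \<kappa> where "\<kappa> = 2 * \<eta> + 8 / (real M ^ 7 * \<eta> ^ 8)"
    have \<kappa>: "\<kappa> \<le> 10 * real N powr (-21/100)"
    proof -
      have "8 / (real M ^ 7 * \<eta> ^ 8) \<le> 8 / ((real N powr (27/100)) ^ 7 * \<eta> ^ 8)"
        using M \<eta> N1 by (intro divide_left_mono mult_right_mono power_mono) auto
      also have "(real N powr (27/100)) ^ 7 * \<eta> ^ 8 = real N powr (21/100)"
        using N1 by (simp add: \<eta>_def powr_power flip: powr_add)
      also have "8 / real N powr (21/100) = 8 * real N powr (-21/100)"
        using N1 by (simp add: powr_minus field_simps)
      finally show ?thesis by (simp add: \<kappa>_def \<eta>_def)
    qed
    define b where "b m = 80 * (real m powr (1/2) * real N powr (13/25) + real m powr (-1/2) * real N powr (19/25))" for m :: nat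
    define q where "q m = b m * (1 + 7 * real m * \<psi> N)" for m :: nat
    have qb: "norm (\<Sum>n=N..<N'. ee (\<tau> * p n + \<xi> * real n + \<rho> * \<psi> n)) \<le> q m"
      if m: "1 \<le> m" "m \<le> 8 * M" and "\<tau> = real m \<or> \<tau> = - real m" "\<bar>\<rho>\<bar> \<le> real m" for m \<tau> \<rho> \<xi>
      unfolding q_def
    proof (rule exp_sum_perturbed[OF _ NN _ _ that(3,4)])
      fix N'' \<xi> assume "N'' \<le> N'"
      moreover have "real m \<le> real N" using m(2) M(2) big by linarith
      ultimately show "norm (\<Sum>n=N..<N''. ee (real m * p n + \<xi> * real n)) \<le> b m"
        unfolding b_def using m N N0 by (intro ex) auto
    qed (use \<psi> N0 in \<open>auto intro: less_imp_le\<close>)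
    define S where "S = (\<Sum>m=1..8*M. q m / m)"
    define e where "e n = ee (\<xi> * real n)" for n :: nat
    \<comment> \<open>Needed for \<open>\<rho> = -1\<close> and \<open>\<rho> = 0\<close>, the
      phases of the two sawtooths whose difference is the centred indicator.\<close>
    have st: "norm (\<Sum>n\<in>{N..<N'}. of_real (frac (\<sigma> * p n + \<rho> * \<psi> n) - 1/2) * e n) \<le> 3 * \<kappa> * card {N..<N'} + 6 * S"
      if \<rho>: "\<bar>\<rho>\<bar> \<le> 1" for \<rho> unfolding \<kappa>_def S_def
    proof (rule sawtooth_sum_le[OF M(3) \<eta>])
      fix m assume m: "1 \<le> m" "m \<le> 8 * M"
      have \<tau>: "real m * \<sigma> = real m \<or> real m * \<sigma> = - real m" "- (real m * \<sigma>) = real m \<or> - (real m * \<sigma>) = - real m"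
        and \<rho>': "\<bar>real m * \<rho>\<bar> \<le> real m" "\<bar>- (real m * \<rho>)\<bar> \<le> real m" 
        using \<sigma> \<rho> by (auto simp: abs_mult mult_left_le)
      show "norm (\<Sum>n\<in>{N..<N'}. ee (real m * (\<sigma> * p n + \<rho> * \<psi> n)) * e n) \<le> q m \<and>
        norm (\<Sum>n\<in>{N..<N'}. ee (- real m * (\<sigma> * p n + \<rho> * \<psi> n)) * e n) \<le> q m \<and>
        norm (\<Sum>n\<in>{N..<N'}. ee (real m * (\<sigma> * p n + \<rho> * \<psi> n))) \<le> q m \<and>
        norm (\<Sum>n\<in>{N..<N'}. ee (- real m * (\<sigma> * p n + \<rho> * \<psi> n))) \<le> q m"
        using qb[OF m \<tau>(1) \<rho>'(1), of \<xi>] qb[OF m \<tau>(2) \<rho>'(2), of \<xi>] qb[OF m \<tau>(1) \<rho>'(1), of 0] qb[OF m \<tau>(2) \<rho>'(2), of 0]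
        by (simp add: e_def algebra_simps flip: ee_add)
    qed (auto simp: e_def)
    \<comment> \<open>Dividing \<open>q m\<close> by \<open>m\<close> produces four sums. Those
      without \<open>\<psi> N\<close> are of order at most \<open>N powr (79/100)\<close>. Those
      with it stem from the variation of \<open>\<psi>\<close> and have exponents 185/200 and
      179/200, both below 99/100.\<close>
    have SS: "S \<le> 80 * (16 * real N powr (79/100) + \<bar>K\<bar> * real N powr (79/100) + \<psi> N * (448 * real N powr (99/100)) + \<psi> N * (56 * real N powr (99/100)))"
    proof -
      have \<psi>N: "0 \<le> \<psi> N" using \<psi>(2)[OF N0(1)] by simp
      have "S = (\<Sum>m=1..8*M. 80 * (real m powr (-1/2) * real N powr (13/25) + real m powr (-3/2) * real N powr (19/25) 
          + 7 * \<psi> N * (real m powr (1/2) * real N powr (13/25)) + 7 * \<psi> N * (real m powr (-1/2) * real N powr (19/25))))"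
        unfolding S_def
      proof (rule sum.cong)
        fix m assume "m \<in> {1..8*M}"
        then have m: "0 < real m" by simp
        have 1: "real m powr (1/2) / m = real m powr (-1/2)" using m powr_diff[of "real m" "1/2" 1] by simp
        have 2: "real m powr (-1/2) / m = real m powr (-3/2)" using m powr_diff[of "real m" "-1/2" 1] by simp
        have "q m / m = 80 * ((real m powr (1/2) / m) * real N powr (13/25) + (real m powr (-1/2) / m) * real N powr (19/25)
          + 7 * \<psi> N * (real m powr (1/2) * real N powr (13/25)) + 7 * \<psi> N * (real m powr (-1/2) * real N powr (19/25)))"
          using m by (simp add: q_def b_def field_simps)
        then show "q m / m = 80 * (real m powr (-1/2) * real N powr (13/25) + real m powr (-3/2) * real N powr (19/25) 
          + 7 * \<psi> N * (real m powr (1/2) * real N powr (13/25)) + 7 * \<psi> N * (real m powr (-1/2) * real N powr (19/25)))"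
          unfolding 1 2 .
      qed simp
      also have "\<dots> = 80 * ((\<Sum>m=1..8*M. real m powr (-1/2)) * real N powr (13/25) + (\<Sum>m=1..8*M. real m powr (-3/2)) * real N powr (19/25) 
          + 7 * \<psi> N * ((\<Sum>m=1..8*M. real m powr (1/2)) * real N powr (13/25)) + 7 * \<psi> N * ((\<Sum>m=1..8*M. real m powr (-1/2)) * real N powr (19/25)))"
        by (simp add: sum.distrib sum_distrib_left sum_distrib_right)
      also have "\<dots> \<le> 80 * (16 * real N powr (79/100) + \<bar>K\<bar> * real N powr (79/100) + \<psi> N * (448 * real N powr (99/100)) + \<psi> N * (56 * real N powr (99/100)))"
      proof (intro mult_left_mono add_mono)
        have R: "real (8 * M) \<le> 16 * real N powr (27/100)" using M by simp
        have sR: "sqrt (real (8 * M)) \<le> 4 * real N powr (27/200)"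
        proof -
          have "sqrt (real (8 * M)) \<le> sqrt (16 * real N powr (27/100))" using R by (rule real_sqrt_le_mono)
          also have "\<dots> = 4 * real N powr (27/200)"
            by (rule real_sqrt_unique) (auto simp: power2_eq_square simp flip: powr_add)
          finally show ?thesis .
        qed
        \<comment> \<open>Bounding each term by 1 already suffices here: 27/100 + 13/25 =
          79/100.\<close>
        have "(\<Sum>m=1..8*M. real m powr (-1/2)) \<le> (\<Sum>m=1..8*M. 1)"
        proof (rule sum_mono)
          fix m assume "m \<in> {1..8*M}"
          then show "real m powr (-1/2) \<le> 1" using powr_mono[of "-1/2" 0 "real m"] by simp
        qed
        also have "\<dots> \<le> 16 * real N powr (27/100)" using R by simp
        finally have "(\<Sum>m=1..8*M. real m powr (-1/2)) * real N powr (13/25) \<le> 16 * real N powr (27/100) * real N powr (13/25)"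
          by (intro mult_right_mono) auto
        also have "\<dots> = 16 * real N powr (79/100)" by (simp flip: powr_add)
        finally show "(\<Sum>m=1..8*M. real m powr (-1/2)) * real N powr (13/25) \<le> 16 * real N powr (79/100)" .
        show "(\<Sum>m=1..8*M. real m powr (-3/2)) * real N powr (19/25) \<le> \<bar>K\<bar> * real N powr (79/100)"
          using K[of "8*M"] N1 by (intro mult_mono powr_mono) auto
        have "(\<Sum>m=1..8*M. real m powr (1/2)) \<le> (\<Sum>m=1..8*M. 4 * real N powr (27/200))"
        proof (rule sum_mono)
          fix m assume "m \<in> {1..8*M}"
          then have "sqrt (real m) \<le> sqrt (real (8*M))" by simp
          also note sR
          finally show "real m powr (1/2) \<le> 4 * real N powr (27/200)" by (simp add: powr_half_sqrt)
        qed
        also have "\<dots> = real (8*M) * (4 * real N powr (27/200))" by simp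
        also have "\<dots> \<le> 16 * real N powr (27/100) * (4 * real N powr (27/200))"
          using R by (intro mult_right_mono) auto
        also have "\<dots> = 64 * real N powr (81/200)" by (simp flip: powr_add)
        finally have "(\<Sum>m=1..8*M. real m powr (1/2)) * real N powr (13/25) \<le> 64 * real N powr (81/200) * real N powr (13/25)"
          by (intro mult_right_mono) auto
        also have "\<dots> = 64 * real N powr (185/200)" by (simp flip: powr_add)
        also have "\<dots> \<le> 64 * real N powr (99/100)" using N1 by (intro mult_left_mono powr_mono) auto
        finally have "\<psi> N * ((\<Sum>m=1..8*M. real m powr (1/2)) * real N powr (13/25)) \<le> \<psi> N * (64 * real N powr (99/100))"
          using \<psi>N by (intro mult_left_mono) auto
        then have "7 * (\<psi> N * ((\<Sum>m=1..8*M. real m powr (1/2)) * real N powr (13/25))) \<le> 7 * (\<psi> N * (64 * real N powr (99/100)))"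
          by (rule mult_left_mono) simp
        also have "\<dots> = \<psi> N * (448 * real N powr (99/100))" by simp
        finally show "7 * \<psi> N * ((\<Sum>m=1..8*M. real m powr (1/2)) * real N powr (13/25)) \<le> \<psi> N * (448 * real N powr (99/100))"
          by (simp only: mult.assoc)
        have "(\<Sum>m=1..8*M. real m powr (-1/2)) \<le> 8 * real N powr (27/200)"
          using sum_inverse_sqrt_le[of "8*M"] sR by simp
        then have "(\<Sum>m=1..8*M. real m powr (-1/2)) * real N powr (19/25) \<le> 8 * real N powr (27/200) * real N powr (19/25)"
          by (intro mult_right_mono) auto
        also have "\<dots> = 8 * real N powr (179/200)" by (simp flip: powr_add)
        also have "\<dots> \<le> 8 * real N powr (99/100)" using N1 by (intro mult_left_mono powr_mono) auto
        finally have "\<psi> N * ((\<Sum>m=1..8*M. real m powr (-1/2)) * real N powr (19/25)) \<le> \<psi> N * (8 * real N powr (99/100))"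
          using \<psi>N by (intro mult_left_mono) auto
        then have "7 * (\<psi> N * ((\<Sum>m=1..8*M. real m powr (-1/2)) * real N powr (19/25))) \<le> 7 * (\<psi> N * (8 * real N powr (99/100)))"
          by (rule mult_left_mono) simp
        also have "\<dots> = \<psi> N * (56 * real N powr (99/100))" by simp
        finally show "7 * \<psi> N * ((\<Sum>m=1..8*M. real m powr (-1/2)) * real N powr (19/25)) \<le> \<psi> N * (56 * real N powr (99/100))"
          by (simp only: mult.assoc)
      qed simp
      finally show ?thesis .
    qed
    have kI: "3 * \<kappa> * card {N..<N'} \<le> 30 * real N powr (79/100)"
    proof -
      have "real (card {N..<N'}) \<le> real N" using N by simp
      then have "\<kappa> * card {N..<N'} \<le> (10 * real N powr (-21/100)) * real N"
        using \<kappa> N1 by (intro mult_mono) auto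
      also have "\<dots> = 10 * real N powr (79/100)" using N1 powr_mult_base[of "real N" "-21/100"] by (simp add: mult.commute)
      finally show ?thesis by simp
    qed
    define D where "D = real N powr (79/100)"
    have "(\<Sum>n=N..<N'. of_real (of_bool (frac (\<sigma> * p n) < \<psi> n) - \<psi> n) * ee (\<xi> * real n)) = 
       (\<Sum>n\<in>{N..<N'}. of_real (frac (\<sigma> * p n + (-1) * \<psi> n) - 1/2) * e n) - (\<Sum>n\<in>{N..<N'}. of_real (frac (\<sigma> * p n + 0 * \<psi> n) - 1/2) * e n)"
      unfolding sum_subtractf[symmetric]
    proof (rule sum.cong)
      fix n assume "n \<in> {N..<N'}"
      then have "0 < \<psi> n" "\<psi> n \<le> 1" using \<psi>(2)[of n] N0 by auto
      note of_bool_frac_less[OF this, of "\<sigma> * p n"]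
      then show "of_real (of_bool (frac (\<sigma> * p n) < \<psi> n) - \<psi> n) * ee (\<xi> * real n) = 
         of_real (frac (\<sigma> * p n + (-1) * \<psi> n) - 1/2) * e n - of_real (frac (\<sigma> * p n + 0 * \<psi> n) - 1/2) * e n"
        unfolding e_def by (simp only: of_real_diff left_diff_distrib[symmetric]) simp
    qed simp
    also have "norm \<dots> \<le> (3 * \<kappa> * card {N..<N'} + 6 * S) + (3 * \<kappa> * card {N..<N'} + 6 * S)"
      by (intro order_trans[OF norm_triangle_ineq4] add_mono st) auto
    also have "\<dots> \<le> (30 * D + 6 * (80 * (16 * D + \<bar>K\<bar> * D + \<psi> N * (448 * real N powr (99/100)) + \<psi> N * (56 * real N powr (99/100))))) + 
        (30 * D + 6 * (80 * (16 * D + \<bar>K\<bar> * D + \<psi> N * (448 * real N powr (99/100)) + \<psi> N * (56 * real N powr (99/100)))))"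
      unfolding D_def by (intro add_mono mult_left_mono SS kI) auto
    also have "\<dots> = (2 * (30 + 7680 + 480 * \<bar>K\<bar>)) * D + 2 * 480 * (448 + 56) * (\<psi> N * real N powr (99/100))"
      by (simp add: algebra_simps)
    also have "\<dots> \<le> (2 * (30 + 7680 + 480 * \<bar>K\<bar>)) * (1 / c * (\<psi> N * real N powr (99/100))) + 2 * 480 * (448 + 56) * (\<psi> N * real N powr (99/100))"
    proof -
      have "c * real N powr (-1/5) * real N powr (99/100) \<le> \<psi> N * real N powr (99/100)"
        using c(2)[OF N0(1)] by (intro mult_right_mono) auto
      then have "c * D \<le> \<psi> N * real N powr (99/100)" by (simp add: D_def mult.assoc flip: powr_add)
      then have "D \<le> 1 / c * (\<psi> N * real N powr (99/100))" using c(1) by (simp add: field_simps)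
      then have "(2 * (30 + 7680 + 480 * \<bar>K\<bar>)) * D \<le> (2 * (30 + 7680 + 480 * \<bar>K\<bar>)) * (1 / c * (\<psi> N * real N powr (99/100)))"
        by (rule mult_left_mono) simp
      then show ?thesis by simp
    qed
    also have "\<dots> = C * (\<psi> N * real N powr (99/100))" by (simp add: C_def algebra_simps add_divide_distrib)
    finally show ?thesis .
  next
    case False
    have "0 \<le> \<psi> N" using \<psi>(2)[of N] N by simp
    moreover have "0 \<le> C" using c by (simp add: C_def)
    ultimately show ?thesis using False by simp
  qed
  then show ?thesis by blast
qed

text \<open>This is all that the ergodic part needs to know about \<open>B\<^sub>\<plusminus>\<close>; \<open>w\<close> plays the role of \<open>\<psi>\<close>.\<close>

definition fourier_close :: "nat set \<Rightarrow> (nat \<Rightarrow> real) \<Rightarrow> bool" where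
  "fourier_close B w \<longleftrightarrow> (\<forall>n. 0 < w n \<and> w n \<le> 1) \<and> antimono w \<and>
     (\<exists>c>0. \<forall>N\<ge>1. c * real N powr (4/5) \<le> (\<Sum>n=1..N. w n)) \<and>
     (\<exists>C>0. \<exists>\<delta>>0. \<forall>N\<ge>1. \<forall>\<xi>. norm (\<Sum>n=1..N. of_real (of_bool (n \<in> B) - w n) * ee (\<xi> * real n)) 
        \<le> C * real N powr (-\<delta>) * (\<Sum>n=1..N. w n))"

lemma ex_dyadic_exponent: 
  assumes "1 \<le> N" "0 < a" shows "\<exists>J. N < 2 ^ J \<and> real J \<le> (2 + 2 / a) * real N powr a"
proof -
  define J where "J = Suc (nat \<lfloor>log 2 (real N)\<rfloor>)"
  have l: "0 \<le> log 2 (real N)" using assms by simp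
  have "log 2 (real N) < J" using l unfolding J_def by linarith
  then have "real N < 2 powr J" using assms by (simp add: log_less_iff)
  then have 1: "N < 2 ^ J" by (simp add: powr_realpow)
  have "real J \<le> 1 + log 2 (real N)" using l unfolding J_def by linarith
  also have "log 2 (real N) = ln (real N) / ln 2" by (simp add: log_def)
  also have "\<dots> \<le> 2 * ln (real N)"
  proof -
    have "1/2 \<le> ln (2::real)" using ln2_ge_two_thirds by simp
    then have "ln (real N) / ln 2 \<le> ln (real N) / (1/2)" using assms by (intro divide_left_mono) auto
    then show ?thesis by simp
  qed
  also have "ln (real N) \<le> real N powr a / a" using assms by (intro ln_powr_bound) auto
  finally have "real J \<le> 1 + 2 * (real N powr a / a)" by simp
  also have "\<dots> \<le> 2 * real N powr a + 2 * (real N powr a / a)"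
    using assms ge_one_powr_ge_zero[of "real N" a] by simp
  finally show ?thesis using 1 by (intro exI[of _ J]) (simp add: algebra_simps)
qed

text \<open>\<open>J\<close> doublings starting from \<open>r0\<close> reach \<open>s\<close>, and
  each contributes one block.\<close>

lemma dyadic_sum_bound:
  fixes a :: "nat \<Rightarrow> complex"
  assumes "\<And>r s. r0 \<le> r \<Longrightarrow> r \<le> s \<Longrightarrow> s \<le> 2 * r \<Longrightarrow> s \<le> T \<Longrightarrow> norm (\<Sum>n=r..<s. a n) \<le> D" "0 \<le> D"
  shows "s \<le> r0 * 2 ^ J \<Longrightarrow> s \<le> T \<Longrightarrow> norm (\<Sum>n=r0..<s. a n) \<le> J * D"
proof (induction J arbitrary: s)
  case (Suc J)
  define r where "r = r0 * 2 ^ J"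
  show ?case
  proof (cases "s \<le> r")
    case True
    then have "norm (\<Sum>n=r0..<s. a n) \<le> J * D" using Suc by (simp add: r_def)
    also have "\<dots> \<le> Suc J * D" using assms(2) by (intro mult_right_mono) auto
    finally show ?thesis .
  next
    case False
    have r: "r0 \<le> r" by (simp add: r_def)
    have "norm (\<Sum>n=r0..<r. a n) \<le> J * D" using Suc.IH[of r] Suc.prems False by (simp add: r_def)
    moreover have "norm (\<Sum>n=r..<s. a n) \<le> D" using assms(1)[OF r, of s] Suc.prems False by (simp add: r_def)
    moreover have "(\<Sum>n=r0..<s. a n) = (\<Sum>n=r0..<r. a n) + (\<Sum>n=r..<s. a n)"
      using r False by (simp add: sum.atLeastLessThan_concat)
    ultimately show ?thesis by (auto intro: norm_triangle_le simp: algebra_simps)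
  qed
qed simp

text \<open>The initial segment up to about \<open>sqrt N\<close> is bounded trivially, which is
  affordable because the weights sum to at least \<open>c * N powr (4/5)\<close>. With
  \<open>d = 1/400\<close>, each later block saves
  \<open>r powr (-1/100) \<le> N powr (-2 * d)\<close>; the number of blocks is at most a constant
  times \<open>N powr d\<close> and so costs half of the saving.\<close>

lemma fourier_closeI:
  assumes bl: "\<And>N N' \<xi>. N1 \<le> N \<Longrightarrow> N' \<le> 2 * N \<Longrightarrow> 
    norm (\<Sum>n=N..<N'. of_real (of_bool (n \<in> B) - w n) * ee (\<xi> * real n)) \<le> C * (w N * real N powr (99/100))"
    and w: "\<And>n. 0 < w n \<and> w n \<le> 1" "antimono w" 
    and c: "0 < c" "\<And>n. 1 \<le> n \<Longrightarrow> c * real n powr (-1/5) \<le> w n"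
  shows "fourier_close B w"
proof -
  define W where "W N = (\<Sum>n=1..N. w n)" for N
  have Wge: "N * w N \<le> W N" for N
  proof -
    have "(\<Sum>n=1..N. w N) \<le> (\<Sum>n=1..N. w n)" using w(2) by (intro sum_mono) (auto simp: antimono_def)
    then show ?thesis by (simp add: W_def)
  qed
  have Wmono: "W M \<le> W N" if "M \<le> N" for M N
    unfolding W_def using that w(1) by (intro sum_mono2) (auto intro: less_imp_le)
  have W45: "c * real N powr (4/5) \<le> W N" if "1 \<le> N" for N
  proof -
    have "c * real N powr (4/5) = N * (c * real N powr (-1/5))" using that powr_mult_base[of "real N" "-1/5"] by simp
    also have "\<dots> \<le> N * w N" using c(2)[OF that] by (intro mult_left_mono) auto
    finally show ?thesis using Wge[of N] by simp
  qed
  have W0: "0 \<le> W N" for N using Wge[of N] w(1)[of N] by (smt (verit) mult_nonneg_nonneg of_nat_0_le_iff)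
  define N2 where "N2 = max N1 1"
  define C' where "C' = \<bar>C\<bar>"
  define d :: real where "d = 1/400"
  define a where "a \<xi> n = complex_of_real (of_bool (n \<in> B) - w n) * ee (\<xi> * real n)" for \<xi> n
  have a1: "norm (a \<xi> n) \<le> 1" for \<xi> n
  proof -
    have "\<bar>of_bool (n \<in> B) - w n\<bar> \<le> 1" using w(1)[of n] by (cases "n \<in> B") auto
    then show ?thesis unfolding a_def norm_mult norm_of_real by simp
  qed
  \<comment> \<open>The first entry covers the finitely many \<open>N < N2\<^sup>2\<close>, for
    which \<open>sqrt N\<close> lies below the range of the block bound. The second adds up the
    initial segment and the blocks.\<close>
  define E where "E = max (real N2 ^ 2 / c) (3 / c + C' * (2 + 2 / d)) + 1"
  have Epos: "0 < E"
  proof -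
    have "0 \<le> real N2 ^ 2 / c" using c by simp
    then show ?thesis unfolding E_def by linarith
  qed
  have EN: "real N2^2 / c \<le> E" by (simp add: E_def)
  have main: "norm (\<Sum>n=1..N. a \<xi> n) \<le> E * real N powr (-d) * W N" if N: "1 \<le> N" for N \<xi>
  proof (cases "N < N2^2")
    case True
    have "norm (\<Sum>n=1..N. a \<xi> n) \<le> (\<Sum>n=1..N. 1)" by (intro sum_norm_le a1)
    also have "\<dots> \<le> real N2 ^ 2" using True by (simp flip: of_nat_power)
    also have "\<dots> = real N2^2 / c * c * 1" using c by simp
    also have "\<dots> \<le> real N2^2 / c * c * real N powr (4/5 - d)"
      using N c by (intro mult_left_mono ge_one_powr_ge_zero) (auto simp: d_def)
    also have "real N powr (4/5 - d) = real N powr (-d) * real N powr (4/5)" by (simp flip: powr_add)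
    also have "real N2^2 / c * c * (real N powr (-d) * real N powr (4/5)) = real N2^2 / c * real N powr (-d) * (c * real N powr (4/5))"
      by simp
    also have "\<dots> \<le> E * real N powr (-d) * W N"
      using W45[OF N] c W0 Epos EN by (intro mult_mono) auto
    finally show ?thesis .
  next
    case False
    define r0 where "r0 = nat \<lceil>sqrt (real N)\<rceil>"
    have s1: "1 \<le> sqrt (real N)" using N by simp
    have r0: "sqrt (real N) \<le> r0" "real r0 \<le> 2 * sqrt (real N)" "0 < r0"
      using s1 unfolding r0_def by linarith+
    have "real N2 \<le> sqrt (real N)" using False by (intro real_le_rsqrt) (simp flip: of_nat_power)
    then have N2: "N2 \<le> r0" using r0(1) by linarith
    obtain J where J: "N < 2 ^ J" "real J \<le> (2 + 2 / d) * real N powr d"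
      using ex_dyadic_exponent[OF N, of d] by (auto simp: d_def)
    have "r0 \<le> N + 1"
    proof -
      have "sqrt (real N) \<le> real N" using N by (simp add: sqrt_le_D real_le_lsqrt power2_eq_square)
      then show ?thesis unfolding r0_def by linarith
    qed
    have blk: "norm (\<Sum>n=r..<s. a \<xi> n) \<le> C' * (W N * real N powr (-2*d))" 
      if rs: "r0 \<le> r" "r \<le> s" "s \<le> 2 * r" "s \<le> N + 1" for r s
    proof (cases "r = s")
      case False
      then have rN: "r \<le> N" "0 < r" using rs r0 by auto
      have "norm (\<Sum>n=r..<s. a \<xi> n) \<le> C * (w r * real r powr (99/100))"
        unfolding a_def using rs N2 by (intro bl) (auto simp: N2_def)
      also have "\<dots> \<le> C' * (w r * real r powr (99/100))"
        using w(1)[of r] by (intro mult_right_mono) (auto simp: C'_def)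
      also have "\<dots> \<le> C' * (W N * real N powr (-2*d))"
      proof (intro mult_left_mono)
        \<comment> \<open>For decreasing weights \<open>r * w r\<close> is at most the total weight
          up to \<open>r\<close>; this trades the weight at the start of the block for the total
          weight.\<close>
        have "w r * real r powr (99/100) = (r * w r) * real r powr (-1/100)"
          using rN powr_diff[of "real r" 1 "1/100"] by (simp add: powr_minus field_simps)
        also have "\<dots> \<le> W N * real N powr (-2*d)"
        proof (intro mult_mono)
          show "r * w r \<le> W N" using Wge[of r] Wmono[OF rN(1)] by simp
          have "real r powr (-1/100) \<le> sqrt (real N) powr (-1/100)"
            using rs r0 s1 by (intro powr_mono2') auto
          also have "\<dots> = real N powr (-2*d)" by (simp add: powr_half_sqrt[symmetric] powr_powr d_def)
          finally show "real r powr (-1/100) \<le> real N powr (-2*d)" .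
        qed (use W0 in auto)
        finally show "w r * real r powr (99/100) \<le> W N * real N powr (-2*d)" .
      qed (simp add: C'_def)
      finally show ?thesis .
    qed (use W0 in \<open>simp add: C'_def\<close>)
    have "norm (\<Sum>n=r0..<N+1. a \<xi> n) \<le> J * (C' * (W N * real N powr (-2*d)))"
    proof (rule dyadic_sum_bound[where T = "N+1"])
      have "N + 1 \<le> 1 * 2 ^ J" using J(1) by simp
      also have "\<dots> \<le> r0 * 2 ^ J" using r0 by (intro mult_right_mono) auto
      finally show "N + 1 \<le> r0 * 2 ^ J" .
    qed (use blk W0 in \<open>auto simp: C'_def\<close>)
    also have "\<dots> \<le> ((2 + 2/d) * real N powr d) * (C' * (W N * real N powr (-2*d)))"
      using J(2) W0 by (intro mult_right_mono) (auto simp: C'_def)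
    also have "\<dots> = C' * (2 + 2/d) * (real N powr d * real N powr (-2*d)) * W N" by simp
    also have "real N powr d * real N powr (-2*d) = real N powr (-d)" by (simp flip: powr_add)
    finally have p2: "norm (\<Sum>n=r0..<N+1. a \<xi> n) \<le> C' * (2 + 2/d) * real N powr (-d) * W N" .
    have "norm (\<Sum>n=1..<r0. a \<xi> n) \<le> (\<Sum>n=1..<r0. 1)" by (intro sum_norm_le a1)
    also have "\<dots> \<le> 2 * sqrt (real N)" using r0 by simp
    also have "\<dots> \<le> 3 * real N powr (4/5 - d)"
      unfolding powr_half_sqrt[symmetric, OF of_nat_0_le_iff] using N
      by (intro mult_mono powr_mono) (auto simp: d_def)
    also have "real N powr (4/5 - d) = real N powr (-d) * real N powr (4/5)" by (simp flip: powr_add)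
    also have "3 * (real N powr (-d) * real N powr (4/5)) = 3 / c * real N powr (-d) * (c * real N powr (4/5))"
      using c by simp
    also have "\<dots> \<le> 3 / c * real N powr (-d) * W N"
      using W45[OF N] c by (intro mult_left_mono) auto
    finally have p1: "norm (\<Sum>n=1..<r0. a \<xi> n) \<le> 3 / c * real N powr (-d) * W N" .
    have "(\<Sum>n=1..N. a \<xi> n) = (\<Sum>n=1..<r0. a \<xi> n) + (\<Sum>n=r0..<N+1. a \<xi> n)"
    proof -
      have "{1..N} = {1..<N+1}" by auto
      then show ?thesis using \<open>r0 \<le> N + 1\<close> r0 by (simp only: sum.atLeastLessThan_concat)
    qed
    then have "norm (\<Sum>n=1..N. a \<xi> n) \<le> 3 / c * real N powr (-d) * W N + C' * (2 + 2/d) * real N powr (-d) * W N"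
      using norm_triangle_mono[OF p1 p2] by simp
    also have "\<dots> = (3 / c + C' * (2 + 2/d)) * (real N powr (-d) * W N)" by (simp add: algebra_simps)
    also have "\<dots> \<le> E * (real N powr (-d) * W N)"
      using W0 by (intro mult_right_mono) (auto simp: E_def)
    finally show ?thesis by (simp add: mult.assoc)
  qed
  have "0 < d" by (simp add: d_def)
  with Epos show ?thesis unfolding fourier_close_def
    using w c(1) W45 main unfolding W_def a_def by blast
qed

lemma fourier_close_return_set:
  assumes x0: "1 \<le> x0" and c1: "1 \<le> c1" "c1 < 2" and c2: "1 \<le> c2" "c2 < 6/5"
    and h1: "h1 \<in> class_R x0 c1" and h2: "h2 \<in> class_R x0 c2" and psi: "admissible_psi x0 h2 \<psi>"
    and B: "B = B_plus x0 h1 \<psi> \<or> B = B_minus x0 h1 \<psi>"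
  shows "\<exists>w. fourier_close B w"
proof -
  define p where "p = comp_inv x0 h1"
  obtain \<sigma> :: real where \<sigma>: "\<sigma> = 1 \<or> \<sigma> = -1" and B': "B = {n. 1 \<le> n \<and> real n \<in> h1 ` {x0..} \<and> frac (\<sigma> * p (real n)) < \<psi> (real n)}"
  proof (cases "B = B_plus x0 h1 \<psi>")
    case True
    then show ?thesis by (intro that[of 1]) (auto simp: B_plus_def p_def)
  next
    case False
    then show ?thesis using B by (intro that[of "-1"]) (auto simp: B_minus_def p_def)
  qed
  obtain h' where H: "continuous_on {x0..} h1" "strict_mono_on {x0..} h1" "\<And>y. x0 \<le> y \<Longrightarrow> y \<le> h1 y"
    by (rule class_R_regularity[OF x0 c1 h1]) (rule that)
  have ge: "\<forall>y\<ge>x0. y \<le> h1 y" using H(3) by blast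
  have img: "x \<in> h1 ` {x0..}" if "h1 x0 \<le> x" for x
    using comp_inv_regularity(1,2)[OF H(1,2) ge that] by (metis atLeast_iff image_eqI)
  obtain N0 where N0: "\<forall>N N' m. \<forall>\<xi>::real. N0 \<le> N \<longrightarrow> N' \<le> 2 * N \<longrightarrow> 1 \<le> m \<longrightarrow> m \<le> N \<longrightarrow>
    norm (\<Sum>n=N..<N'. ee (real m * p (real n) + \<xi> * real n)) \<le> 80 * (real m powr (1/2) * real N powr (13/25) + real m powr (-1/2) * real N powr (19/25))"
    using comp_inv_exp_sum[OF x0 c1 h1] unfolding p_def by blast
  obtain X C where X: "1 \<le> X" "0 < C" "\<And>x y. X \<le> x \<Longrightarrow> x \<le> y \<Longrightarrow> \<psi> y \<le> \<psi> x" "\<And>x. X \<le> x \<Longrightarrow> C * x powr (-1/5) \<le> \<psi> x"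
    by (rule admissible_psi_regularity[OF x0 c2 h2 psi]) (rule that)
  have psi01: "0 < \<psi> x \<and> \<psi> x \<le> 1/2" if "1 \<le> x" for x
    using psi that unfolding admissible_psi_def by blast
  define N1 where "N1 = max N0 (nat \<lceil>max X (h1 x0)\<rceil>)"
  have N1: "X \<le> real n" "h1 x0 \<le> real n" "1 \<le> real n" "N0 \<le> n" if "N1 \<le> n" for n
  proof -
    have "nat \<lceil>max X (h1 x0)\<rceil> \<le> n" "N0 \<le> n" using that by (auto simp: N1_def)
    then show "X \<le> real n" "h1 x0 \<le> real n" "1 \<le> real n" "N0 \<le> n" using X(1) by linarith+
  qed
  have ex: "\<exists>N2 C. \<forall>N N' \<xi>. N2 \<le> N \<longrightarrow> N' \<le> 2 * N \<longrightarrow> 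
    norm (\<Sum>n=N..<N'. of_real (of_bool (frac (\<sigma> * p (real n)) < \<psi> (real n)) - \<psi> (real n)) * ee (\<xi> * real n)) \<le> C * (\<psi> (real N) * real N powr (99/100))"
  proof (rule return_time_block[where ?N0.0 = N1 and c = C])
    fix N N' m :: nat and \<xi> :: real
    assume "N1 \<le> N" "N' \<le> 2 * N" "1 \<le> m" "m \<le> N"
    then show "norm (\<Sum>n=N..<N'. ee (real m * p (real n) + \<xi> * real n)) \<le> 80 * (real m powr (1/2) * real N powr (13/25) + real m powr (-1/2) * real N powr (19/25))"
      using N0 N1(4) by blast
  next
    fix n assume n: "N1 \<le> n"
    show "\<psi> (real (Suc n)) \<le> \<psi> (real n)" using X(3) N1(1)[OF n] by simp
    show "0 < \<psi> (real n) \<and> \<psi> (real n) \<le> 1" using psi01[OF N1(3)[OF n]] by simp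
    show "C * real n powr (-1/5) \<le> \<psi> (real n)" using X(4) N1(1)[OF n] by simp
  qed (use X \<sigma> in auto)
  obtain N2 C' where bl: "\<And>N N' \<xi>. N2 \<le> N \<Longrightarrow> N' \<le> 2 * N \<Longrightarrow>
    norm (\<Sum>n=N..<N'. of_real (of_bool (frac (\<sigma> * p (real n)) < \<psi> (real n)) - \<psi> (real n)) * ee (\<xi> * real n)) \<le> C' * (\<psi> (real N) * real N powr (99/100))"
    using ex by blast
  \<comment> \<open>Freezing \<open>\<psi>\<close> below \<open>N1\<close> makes the weight
    decreasing and at most 1 everywhere. Only finitely many terms change, and they lie outside the
    blocks of the Fourier bound.\<close>
  define w where "w n = \<psi> (real (max n N1))" for n
  have "fourier_close B w"
  proof (rule fourier_closeI[where ?N1.0 = "max N1 N2" and c = "min C (\<psi> (real N1))" and C = C'])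
    fix N N' \<xi> assume N: "max N1 N2 \<le> N" "N' \<le> 2 * N"
    have "(\<Sum>n=N..<N'. of_real (of_bool (n \<in> B) - w n) * ee (\<xi> * real n)) = 
       (\<Sum>n=N..<N'. of_real (of_bool (frac (\<sigma> * p (real n)) < \<psi> (real n)) - \<psi> (real n)) * ee (\<xi> * real n))"
    proof (rule sum.cong)
      fix n assume "n \<in> {N..<N'}"
      then have n: "N1 \<le> n" using N by simp
      have "n \<in> B \<longleftrightarrow> frac (\<sigma> * p (real n)) < \<psi> (real n)"
        using N1(3)[OF n] img[OF N1(2)[OF n]] by (auto simp: B')
      then show "of_real (of_bool (n \<in> B) - w n) * ee (\<xi> * real n) = 
          of_real (of_bool (frac (\<sigma> * p (real n)) < \<psi> (real n)) - \<psi> (real n)) * ee (\<xi> * real n)"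
        using n by (simp add: w_def max_absorb1)
    qed simp
    then show "norm (\<Sum>n=N..<N'. of_real (of_bool (n \<in> B) - w n) * ee (\<xi> * real n)) \<le> C' * (w N * real N powr (99/100))"
      using bl[of N N'] N by (simp add: w_def max_absorb1)
  next
    fix n show "0 < w n \<and> w n \<le> 1" using psi01[OF N1(3), of "max n N1"] by (simp add: w_def)
  next
    show "antimono w" unfolding antimono_def w_def
    proof (intro allI impI)
      fix m n :: nat assume "m \<le> n"
      then show "\<psi> (real (max n N1)) \<le> \<psi> (real (max m N1))"
        using N1(1)[of "max m N1"] by (intro X(3)) auto
    qed
    show "0 < min C (\<psi> (real N1))" using X(2) psi01[OF N1(3)[of N1]] by simp
  next
    fix n :: nat assume n: "1 \<le> n"
    show "min C (\<psi> (real N1)) * real n powr (-1/5) \<le> w n"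
    proof (cases "N1 \<le> n")
      case True
      have "min C (\<psi> (real N1)) * real n powr (-1/5) \<le> C * real n powr (-1/5)" by (intro mult_right_mono) auto
      also have "\<dots> \<le> w n" using X(4)[OF N1(1)[OF True]] True by (simp add: w_def max_absorb1)
      finally show ?thesis .
    next
      case False
      have "real n powr (-1/5) \<le> 1" using n powr_mono[of "-1/5" 0 "real n"] by simp
      then have "min C (\<psi> (real N1)) * real n powr (-1/5) \<le> \<psi> (real N1) * 1"
        using psi01[OF N1(3)[of N1]] by (intro mult_mono) auto
      then show ?thesis using False by (simp add: w_def max_absorb2)
    qed
  qed
  then show ?thesis by blast
qed

section \<open>Birkhoff averages on infinite measure spaces\<close>

locale measure_preserving = sigma_finite_measure M for M :: "'a measure" +
  fixes T :: "'a \<Rightarrow> 'a"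
  assumes T_measurable [measurable]: "T \<in> measurable M M"
    and distr_T: "distr M M T = M"
begin

lemma funpow_measurable [measurable]: "(T ^^ n) \<in> measurable M M"
proof (induction n)
  case (Suc n)
  then show ?case unfolding funpow.simps by (rule measurable_comp[OF _ T_measurable])
qed (simp add: measurable_ident)

lemma compose_funpow_measurable:
  "f \<in> measurable M N \<Longrightarrow> (\<lambda>x. f ((T ^^ n) x)) \<in> measurable M N"
  by (rule measurable_compose[OF funpow_measurable])

lemma nn_integral_T: 
  assumes [measurable]: "f \<in> borel_measurable M" shows "(\<integral>\<^sup>+x. f (T x) \<partial>M) = (\<integral>\<^sup>+x. f x \<partial>M)"
proof -
  have "(\<integral>\<^sup>+x. f x \<partial>M) = (\<integral>\<^sup>+x. f x \<partial>distr M M T)" by (simp add: distr_T)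
  also have "\<dots> = (\<integral>\<^sup>+x. f (T x) \<partial>M)" by (rule nn_integral_distr) auto
  finally show ?thesis by simp
qed

lemma nn_integral_funpow: 
  assumes [measurable]: "f \<in> borel_measurable M" shows "(\<integral>\<^sup>+x. f ((T ^^ n) x) \<partial>M) = (\<integral>\<^sup>+x. f x \<partial>M)"
proof (induction n)
  case (Suc n)
  have "(\<integral>\<^sup>+x. f ((T ^^ n) (T x)) \<partial>M) = (\<integral>\<^sup>+x. f ((T ^^ n) x) \<partial>M)"
    by (rule nn_integral_T) measurable
  then show ?case using Suc by (simp add: funpow_swap1)
qed simp

lemma integrable_T:
  fixes f :: "'a \<Rightarrow> real"
  assumes [measurable]: "integrable M f" shows "integrable M (\<lambda>x. f (T x))" 
proof -
  have "integrable (distr M M T) f" by (simp add: distr_T assms)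
  then show ?thesis by (subst (asm) integrable_distr_eq) auto
qed

lemma integral_T:
  fixes f :: "'a \<Rightarrow> real"
  assumes [measurable]: "f \<in> borel_measurable M" shows "(\<integral>x. f (T x) \<partial>M) = (\<integral>x. f x \<partial>M)"
proof -
  have "(\<integral>x. f x \<partial>M) = (\<integral>x. f x \<partial>distr M M T)" by (simp add: distr_T)
  also have "\<dots> = (\<integral>x. f (T x) \<partial>M)" by (rule integral_distr) auto
  finally show ?thesis by simp
qed

lemma integrable_indicator_mult:
  fixes f :: "'a \<Rightarrow> real"
  assumes "A \<in> sets M" "integrable M f" shows "integrable M (\<lambda>x. indicator A x * f x)"
  using integrable_mult_indicator[OF assms] by simp

text \<open>Preimages of null sets are null, and only countably many iterates occur.\<close>

lemma AE_funpow:
  assumes "AE x in M. P x" shows "AE x in M. \<forall>n. P ((T ^^ n) x)"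
proof -
  have "AE x in M. P ((T ^^ n) x)" for n
  proof (induction n)
    case (Suc n)
    from Suc obtain N where N: "{x \<in> space M. \<not> P ((T ^^ n) x)} \<subseteq> N" "N \<in> sets M" "emeasure M N = 0"
      by (auto elim: AE_E)
    have "emeasure M (T -` N \<inter> space M) = emeasure (distr M M T) N"
      using N by (simp add: emeasure_distr)
    then have "emeasure M (T -` N \<inter> space M) = 0" using N by (simp add: distr_T)
    moreover have "{x \<in> space M. \<not> P ((T ^^ Suc n) x)} \<subseteq> T -` N \<inter> space M"
    proof
      fix x assume "x \<in> {x \<in> space M. \<not> P ((T ^^ Suc n) x)}"
      then have "x \<in> space M" "\<not> P ((T ^^ n) (T x))" by (auto simp: funpow_swap1)
      moreover have "T x \<in> space M" using \<open>x \<in> space M\<close> measurable_space[OF T_measurable] by blast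
      ultimately show "x \<in> T -` N \<inter> space M" using N(1) by blast
    qed
    ultimately show ?case using N(2) by (intro AE_I[of _ _ "T -` N \<inter> space M"]) auto
  qed (use assms in simp)
  then show ?thesis by (simp add: AE_all_countable)
qed

text \<open>Garsia's proof: on \<open>{m > 0}\<close>, where \<open>m = max {0, S 1, \<dots>, S N}\<close>, one has \<open>m \<le> f + m \<circ> T\<close>.\<close>

lemma maximal_ergodic_finite:
  fixes f :: "'a \<Rightarrow> real"
  assumes f: "integrable M f"
  defines "S \<equiv> \<lambda>n x. \<Sum>i<n. f ((T ^^ i) x)"
  defines "m \<equiv> \<lambda>N x. Max ((\<lambda>n. S n x) ` {..N})"
  shows "0 \<le> (\<integral>x. indicator {x \<in> space M. 0 < m N x} x * f x \<partial>M)"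
proof -
  note [measurable] = borel_measurable_integrable[OF f]
  have fi: "integrable M (\<lambda>x. f ((T ^^ i) x))" for i
  proof (induction i)
    case (Suc i)
    from integrable_T[OF Suc] show ?case by (simp add: funpow_swap1)
  qed (use f in simp)
  then have Si: "integrable M (S n)" for n unfolding S_def by (intro Bochner_Integration.integrable_sum) auto
  have mi: "integrable M (m N)"
  proof (induction N)
    case 0
    show ?case using Si by (simp add: m_def)
  next
    case (Suc N)
    have "m (Suc N) x = max (S (Suc N) x) (m N x)" for x
    proof -
      have "(\<lambda>n. S n x) ` {..Suc N} = insert (S (Suc N) x) ((\<lambda>n. S n x) ` {..N})" by (auto simp: atMost_Suc)
      then show ?thesis unfolding m_def by (simp add: Max_insert)
    qed
    then show ?case using integrable_max[OF Si Suc] by presburger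
  qed
  have [measurable]: "m N \<in> borel_measurable M" using mi by (rule borel_measurable_integrable)
  have m0: "0 \<le> m N x" for x
  proof -
    have "S 0 x \<le> m N x" unfolding m_def by (intro Max_ge) auto
    then show ?thesis by (simp add: S_def)
  qed
  let ?E = "{x \<in> space M. 0 < m N x}"
  have key: "m N x - m N (T x) \<le> indicator ?E x * f x" if x: "x \<in> space M" for x
  proof (cases "0 < m N x")
    case True
    have "m N x \<in> (\<lambda>n. S n x) ` {..N}" unfolding m_def by (intro Max_in) auto
    then obtain n where n: "n \<le> N" "m N x = S n x" by auto
    have "n \<noteq> 0"
    proof
      assume "n = 0"
      then show False using True n(2) by (simp add: S_def)
    qed
    then obtain n' where n': "n = Suc n'" by (cases n) auto
    have "S n x = f x + S n' (T x)"
      unfolding n' S_def by (subst sum.lessThan_Suc_shift) (simp add: funpow_swap1)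
    also have "S n' (T x) \<le> m N (T x)" unfolding m_def using n n' by (intro Max_ge) auto
    finally show ?thesis using n True x by simp
  next
    case False
    then show ?thesis using m0[of x] m0[of "T x"] by simp
  qed
  have "0 = (\<integral>x. m N x \<partial>M) - (\<integral>x. m N (T x) \<partial>M)" by (simp add: integral_T)
  also have "\<dots> = (\<integral>x. m N x - m N (T x) \<partial>M)" using mi integrable_T[OF mi] by simp
  also have "\<dots> \<le> (\<integral>x. indicator ?E x * f x \<partial>M)"
    using mi integrable_T[OF mi] f key by (intro integral_mono integrable_indicator_mult Bochner_Integration.integrable_diff) auto
  finally show ?thesis .
qed

text \<open>The sets belonging to finite \<open>N\<close> increase to the one here, and
  \<open>\<bar>f\<bar>\<close> is an integrable majorant.\<close>

lemma maximal_ergodic: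
  fixes f :: "'a \<Rightarrow> real"
  assumes f: "integrable M f"
  defines "S \<equiv> \<lambda>n x. \<Sum>i<n. f ((T ^^ i) x)"
  shows "0 \<le> (\<integral>x. indicator {x \<in> space M. \<exists>n. 0 < S n x} x * f x \<partial>M)"
proof -
  note [measurable] = borel_measurable_integrable[OF f]
  have [measurable]: "S n \<in> borel_measurable M" for n unfolding S_def by measurable
  let ?m = "\<lambda>N x. Max ((\<lambda>n. S n x) ` {..N})"
  have E: "{x \<in> space M. 0 < ?m N x} = {x \<in> space M. \<exists>n\<le>N. 0 < S n x}" for N
    by (subst Max_gr_iff) auto
  have "(\<lambda>N. \<integral>x. indicator {x \<in> space M. \<exists>n\<le>N. 0 < S n x} x * f x \<partial>M) \<longlonglongrightarrow> (\<integral>x. indicator {x \<in> space M. \<exists>n. 0 < S n x} x * f x \<partial>M)"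
  proof (rule integral_dominated_convergence[where w = "\<lambda>x. \<bar>f x\<bar>"])
    show "AE x in M. (\<lambda>N. indicator {x \<in> space M. \<exists>n\<le>N. 0 < S n x} x * f x) \<longlonglongrightarrow> indicator {x \<in> space M. \<exists>n. 0 < S n x} x * f x"
    proof (rule AE_I2)
      fix x assume x: "x \<in> space M"
      show "(\<lambda>N. indicator {x \<in> space M. \<exists>n\<le>N. 0 < S n x} x * f x) \<longlonglongrightarrow> indicator {x \<in> space M. \<exists>n. 0 < S n x} x * f x"
      proof (cases "\<exists>n. 0 < S n x")
        case True
        then obtain n where "0 < S n x" by blast
        have "\<forall>\<^sub>F N in sequentially. indicator {x \<in> space M. \<exists>n\<le>N. 0 < S n x} x * f x = indicator {x \<in> space M. \<exists>n. 0 < S n x} x * f x"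
          using eventually_ge_at_top[of n] by eventually_elim (use \<open>0 < S n x\<close> x in \<open>auto simp: indicator_def\<close>)
        then show ?thesis by (rule tendsto_eventually)
      next
        case False
        then show ?thesis by (simp add: indicator_def)
      qed
    qed
  qed (use f in \<open>auto simp: indicator_def\<close>)
  then show ?thesis
  proof (rule LIMSEQ_le_const)
    have "0 \<le> (\<integral>x. indicator {x \<in> space M. \<exists>n'\<le>n. 0 < S n' x} x * f x \<partial>M)" for n
      using maximal_ergodic_finite[OF f, of n] E[of n] by (simp add: S_def)
    then show "\<exists>N. \<forall>n\<ge>N. 0 \<le> (\<integral>x. indicator {x \<in> space M. \<exists>n'\<le>n. 0 < S n' x} x * f x \<partial>M)" by blast
  qed
qed

text \<open>The sum starts at \<open>i = 1\<close> to agree with averages over sets of positive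
  integers. Hence \<open>f (T x)\<close>, not \<open>f x\<close>, is the function to which the
  maximal ergodic lemma is applied.\<close>

definition avg :: "('a \<Rightarrow> real) \<Rightarrow> nat \<Rightarrow> 'a \<Rightarrow> real" where
  "avg f n x = (\<Sum>i=1..n. f ((T ^^ i) x)) / real n"

lemma avg_measurable [measurable]: "f \<in> borel_measurable M \<Longrightarrow> avg f n \<in> borel_measurable M"
  unfolding avg_def[abs_def]
  by (intro borel_measurable_divide borel_measurable_sum borel_measurable_const compose_funpow_measurable)

lemma sum_T_shift: "(\<Sum>i<n. f (T ((T ^^ i) x))) = (\<Sum>i=1..n. f ((T ^^ i) x))"
  by (induction n) auto

text \<open>On a space of infinite measure the constant \<open>l\<close> cannot be subtracted from
  \<open>f\<close>. It is subtracted only on a part \<open>C\<close> of finite measure of the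
  exceptional set: there the maximal ergodic lemma for \<open>f (T x) - l * indicator C x\<close>
  gives the bound, and by sigma-finiteness such parts exhaust the set.\<close>

lemma weak_type_1:
  fixes f :: "'a \<Rightarrow> real"
  assumes f [measurable]: "f \<in> borel_measurable M" and f0: "\<And>x. 0 \<le> f x" and l: "0 < l"
  shows "ennreal l * emeasure M {x \<in> space M. \<exists>n\<ge>1. l < avg f n x} \<le> (\<integral>\<^sup>+x. f x \<partial>M)"
proof (cases "(\<integral>\<^sup>+x. f x \<partial>M) = \<infinity>")
  case False
  then have fi: "integrable M f" using f0 by (intro integrableI_nonneg) (auto simp: less_top[symmetric])
  define E where "E = {x \<in> space M. \<exists>n\<ge>1. l < avg f n x}"
  have [measurable]: "E \<in> sets M" unfolding E_def by measurable
  obtain A :: "nat \<Rightarrow> 'a set" where A: "range A \<subseteq> sets M" "(\<Union>i. A i) = space M" "\<And>i. emeasure M (A i) \<noteq> \<infinity>" "incseq A"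
    using sigma_finite_incseq by metis
  have bnd: "ennreal l * emeasure M (E \<inter> A i) \<le> (\<integral>\<^sup>+x. f x \<partial>M)" for i
  proof -
    define C where "C = E \<inter> A i"
    have [measurable]: "C \<in> sets M" using A(1) by (auto simp: C_def)
    have Cfin: "emeasure M C < \<infinity>"
      using A(1) A(3)[of i] emeasure_mono[of C "A i" M] by (auto simp: C_def less_top[symmetric] top_unique)
    define g where "g x = f (T x) - l * indicator C x" for x
    have ic: "integrable M (indicator C :: 'a \<Rightarrow> real)" using Cfin by (intro integrable_real_indicator) auto
    have gi: "integrable M g" unfolding g_def using integrable_T[OF fi] ic by (intro Bochner_Integration.integrable_diff) auto
    let ?S = "\<lambda>n x. \<Sum>i<n. g ((T ^^ i) x)"
    let ?E = "{x \<in> space M. \<exists>n. 0 < ?S n x}"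
    have CE: "C \<subseteq> ?E"
    proof
      fix x assume x: "x \<in> C"
      then obtain n where n: "n \<ge> 1" "l < avg f n x" and xs: "x \<in> space M" by (auto simp: C_def E_def)
      have "l * n < (\<Sum>i=1..n. f ((T ^^ i) x))" using n by (simp add: avg_def field_simps)
      also have "\<dots> = (\<Sum>i<n. f (T ((T ^^ i) x)))" by (simp add: sum_T_shift)
      also have "\<dots> - l * n \<le> ?S n x"
      proof -
        have "(\<Sum>i<n. l * indicator C ((T ^^ i) x)) \<le> (\<Sum>i<n. l * 1)"
          using l by (intro sum_mono mult_left_mono) (auto simp: indicator_def)
        then show ?thesis by (simp add: g_def sum_subtractf algebra_simps)
      qed
      finally show "x \<in> ?E" using xs by auto
    qed
    have [measurable]: "?E \<in> sets M" unfolding g_def by measurable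
    have "0 \<le> (\<integral>x. indicator ?E x * g x \<partial>M)" by (rule maximal_ergodic[OF gi])
    also have "\<dots> = (\<integral>x. indicator ?E x * f (T x) - l * indicator C x \<partial>M)"
      using CE by (intro Bochner_Integration.integral_cong) (auto simp: g_def indicator_def)
    also have "\<dots> = (\<integral>x. indicator ?E x * f (T x) \<partial>M) - l * measure M C"
      using integrable_T[OF fi] ic by (subst Bochner_Integration.integral_diff) (auto intro: integrable_indicator_mult)
    also have "(\<integral>x. indicator ?E x * f (T x) \<partial>M) \<le> (\<integral>x. f (T x) \<partial>M)"
      using integrable_T[OF fi] f0 by (intro integral_mono integrable_indicator_mult) (auto simp: indicator_def)
    also have "\<dots> = (\<integral>x. f x \<partial>M)" by (rule integral_T) auto
    finally have "l * measure M C \<le> (\<integral>x. f x \<partial>M)" by simp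
    then have "ennreal (l * measure M C) \<le> ennreal (\<integral>x. f x \<partial>M)" by (rule ennreal_leI)
    also have "\<dots> = (\<integral>\<^sup>+x. f x \<partial>M)" using fi f0 by (intro nn_integral_eq_integral[symmetric]) auto
    also have "ennreal (l * measure M C) = ennreal l * emeasure M C"
      using l Cfin by (simp add: ennreal_mult emeasure_eq_ennreal_measure less_top)
    finally show ?thesis by (simp add: C_def)
  qed
  have "(SUP i. emeasure M (E \<inter> A i)) = emeasure M (\<Union>i. E \<inter> A i)"
    using A(1,4) by (intro SUP_emeasure_incseq) (auto simp: incseq_def)
  also have "(\<Union>i. E \<inter> A i) = E" using A(2) sets.sets_into_space[of E M] by auto
  finally have "ennreal l * emeasure M E = (SUP i. ennreal l * emeasure M (E \<inter> A i))"
    by (simp add: SUP_mult_left_ennreal[symmetric])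
  also have "\<dots> \<le> (\<integral>\<^sup>+x. f x \<partial>M)" by (rule SUP_least) (rule bnd)
  finally show ?thesis by (simp add: E_def)
qed simp

text \<open>The slack \<open>1 / Suc k\<close> makes the set of oscillation exactly invariant.\<close>

definition osc :: "('a \<Rightarrow> real) \<Rightarrow> real \<Rightarrow> real \<Rightarrow> 'a set" where
  "osc f a b = {x \<in> space M. \<exists>k. (\<forall>m. \<exists>n\<ge>m. avg f n x < a - 1 / Suc k) \<and> (\<forall>m. \<exists>n\<ge>m. b + 1 / Suc k < avg f n x)}"

lemma avg_T: "real n * avg f n (T x) = real (Suc n) * avg f (Suc n) x - f (T x)"
proof -
  have "real n * avg f n (T x) = (\<Sum>i=1..n. f ((T ^^ Suc i) x))"
    by (simp add: avg_def funpow_swap1)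
  moreover have "real (Suc n) * avg f (Suc n) x = (\<Sum>i=1..Suc n. f ((T ^^ i) x))"
    by (simp add: avg_def del: of_nat_Suc)
  moreover have "(\<Sum>i=1..Suc n. f ((T ^^ i) x)) = f (T x) + (\<Sum>i=1..n. f ((T ^^ Suc i) x))"
    by (induction n) auto
  ultimately show ?thesis by simp
qed

text \<open>Passing from \<open>x\<close> to \<open>T x\<close> replaces \<open>n\<close> by
  \<open>n + 1\<close>, multiplies by \<open>1 + 1/n\<close> and subtracts
  \<open>f (T x) / n\<close>. For large \<open>n\<close> the loss is below \<open>e\<close>, which
  is what the slack gives up between \<open>1 / Suc k\<close> and \<open>1 / Suc (Suc k)\<close>.
  Averages may be unbounded, so each comparison is one-sided; where the factor
  \<open>1 + 1/n\<close> works in the wrong direction, its effect is measured by the fixed level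
  \<open>a\<close> or \<open>c\<close>.\<close>

lemma osc_invariant:
  assumes f0: "\<And>x. 0 \<le> f x" and x: "x \<in> space M" and ab: "0 \<le> a" "a < b"
  shows "T x \<in> osc f a b \<longleftrightarrow> x \<in> osc f a b"
proof -
  have Tx: "T x \<in> space M" using measurable_space[OF T_measurable x] .
  have ev: "\<forall>\<^sub>F n in sequentially. \<bar>u\<bar> / real n < e" if "0 < e" for u e :: real
    using that by real_asymp
  have half: "1 / real (Suc k) > 1 / real (Suc (Suc k))" for k by (simp add: field_simps)
  have avg0: "0 \<le> avg f n y" for n y using f0 by (auto simp: avg_def intro!: divide_nonneg_nonneg sum_nonneg)
  have sh: "avg f n (T x) = (1 + 1 / real n) * avg f (Suc n) x - f (T x) / real n" if "n > 0" for n
  proof -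
    have "real n * avg f n (T x) = real n * ((1 + 1 / real n) * avg f (Suc n) x - f (T x) / real n)"
      unfolding avg_T using that by (simp add: field_simps)
    then show ?thesis using that by simp
  qed
  have up: "(1 + 1 / real n) * avg f (Suc n) x = avg f n (T x) + f (T x) / real n" if "n > 0" for n
    using sh[OF that] by simp
  show ?thesis
  proof
    assume "T x \<in> osc f a b"
    then obtain k where k: "\<And>m. \<exists>n\<ge>m. avg f n (T x) < a - 1 / Suc k" "\<And>m. \<exists>n\<ge>m. b + 1 / Suc k < avg f n (T x)"
      by (auto simp: osc_def)
    define e where "e = 1 / real (Suc k) - 1 / real (Suc (Suc k))"
    have e: "e > 0" using half[of k] by (simp add: e_def)
    have lo: "\<exists>n\<ge>m. avg f n x < a - 1 / Suc (Suc k)" for m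
    proof -
      obtain m' where m': "\<And>n. n \<ge> m' \<Longrightarrow> \<bar>f (T x)\<bar> / real n < e"
        using ev[OF e, of "f (T x)"] unfolding eventually_sequentially by blast
      obtain n where n: "n \<ge> max (max m m') 1" "avg f n (T x) < a - 1 / Suc k" using k(1) by blast
      have "avg f (Suc n) x \<le> (1 + 1 / real n) * avg f (Suc n) x"
        using avg0[of "Suc n" x] by (simp add: algebra_simps)
      also have "\<dots> = avg f n (T x) + f (T x) / real n" using n by (intro up) auto
      also have "\<dots> < a - 1 / Suc k + e" using n m'[of n] f0[of "T x"] by simp
      finally show ?thesis using n by (intro exI[of _ "Suc n"]) (auto simp: e_def)
    qed
    have hi: "\<exists>n\<ge>m. b + 1 / Suc (Suc k) < avg f n x" for m
    proof -
      define c where "c = b + 1 / real (Suc k)"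
      obtain m' where m': "\<And>n. n \<ge> m' \<Longrightarrow> \<bar>c\<bar> / real n < e"
        using ev[OF e, of c] unfolding eventually_sequentially by blast
      obtain n where n: "n \<ge> max (max m m') 1" "c < avg f n (T x)" using k(2) unfolding c_def by blast
      have c: "c > 0" using ab by (simp add: c_def add_pos_pos)
      have "c < avg f n (T x)" by fact
      also have "\<dots> \<le> (1 + 1 / real n) * avg f (Suc n) x" using up[of n] n f0[of "T x"] by simp
      finally have "c / (1 + 1 / real n) < avg f (Suc n) x" using n by (simp add: field_simps)
      moreover have "c - c / real n \<le> c / (1 + 1 / real n)"
        using c n by (simp add: field_simps)
      ultimately show ?thesis using m'[of n] n c by (intro exI[of _ "Suc n"]) (auto simp: e_def c_def)
    qed
    show "x \<in> osc f a b" using lo hi x unfolding osc_def by blast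
  next
    assume "x \<in> osc f a b"
    then obtain k where k: "\<And>m. \<exists>n\<ge>m. avg f n x < a - 1 / Suc k" "\<And>m. \<exists>n\<ge>m. b + 1 / Suc k < avg f n x"
      by (auto simp: osc_def)
    define e where "e = 1 / real (Suc k) - 1 / real (Suc (Suc k))"
    have e: "e > 0" using half[of k] by (simp add: e_def)
    have lo: "\<exists>n\<ge>m. avg f n (T x) < a - 1 / Suc (Suc k)" for m
    proof -
      obtain m' where m': "\<And>n. n \<ge> m' \<Longrightarrow> \<bar>a\<bar> / real n < e"
        using ev[OF e, of a] unfolding eventually_sequentially by blast
      obtain n where n: "n \<ge> Suc (max (max m m') 1)" "avg f n x < a - 1 / Suc k" using k(1) by blast
      then obtain n' where n': "n = Suc n'" "n' \<ge> max (max m m') 1" by (cases n) auto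
      have "avg f n' (T x) \<le> (1 + 1 / real n') * avg f (Suc n') x"
        using sh[of n'] n' f0[of "T x"] by simp
      also have "\<dots> = avg f n x + avg f n x / real n'" using n' by (simp add: algebra_simps)
      also have "\<dots> \<le> (a - 1 / Suc k) + a / real n'"
      proof (intro add_mono divide_right_mono)
        have "0 \<le> 1 / real (Suc k)" by simp
        then show "avg f n x \<le> a" using n(2) by linarith
      qed (use n in auto)
      also have "\<dots> < a - 1 / Suc k + e" using m'[of n'] n' ab by simp
      finally show ?thesis using n' by (intro exI[of _ n']) (auto simp: e_def)
    qed
    have hi: "\<exists>n\<ge>m. b + 1 / Suc (Suc k) < avg f n (T x)" for m
    proof -
      obtain m' where m': "\<And>n. n \<ge> m' \<Longrightarrow> \<bar>f (T x)\<bar> / real n < e"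
        using ev[OF e, of "f (T x)"] unfolding eventually_sequentially by blast
      obtain n where n: "n \<ge> Suc (max (max m m') 1)" "b + 1 / Suc k < avg f n x" using k(2) by blast
      then obtain n' where n': "n = Suc n'" "n' \<ge> max (max m m') 1" by (cases n) auto
      have "b + 1 / Suc k - e < avg f n x - f (T x) / real n'" using n m'[of n'] n' f0[of "T x"] by simp
      also have "\<dots> \<le> (1 + 1 / real n') * avg f (Suc n') x - f (T x) / real n'"
        using avg0[of n x] n' by (simp add: algebra_simps)
      also have "\<dots> = avg f n' (T x)" using sh[of n'] n' by simp
      finally show ?thesis using n' by (intro exI[of _ n']) (auto simp: e_def)
    qed
    show "T x \<in> osc f a b" using lo hi Tx unfolding osc_def by blast
  qed
qed

text \<open>The set \<open>E\<close> is invariant and, by the weak-type bound at the positive level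
  \<open>b\<close>, of finite measure. So the maximal ergodic lemma applies to
  \<open>f (T x) - b\<close> and to \<open>a - f (T x)\<close>, both restricted to \<open>E\<close>,
  and the integral of \<open>f (T x)\<close> over \<open>E\<close> is at least \<open>b\<close>
  times and at most \<open>a\<close> times the measure of \<open>E\<close>. As \<open>a < b\<close>,
  this measure is 0.\<close>

lemma osc_null:
  fixes f :: "'a \<Rightarrow> real"
  assumes f [measurable]: "integrable M f" and f0: "\<And>x. 0 \<le> f x" and ab: "0 \<le> a" "a < b"
  shows "emeasure M (osc f a b) = 0"
proof -
  note [measurable] = borel_measurable_integrable[OF f]
  define E where "E = osc f a b"
  have E [measurable]: "E \<in> sets M" unfolding E_def osc_def by measurable
  have inv: "(T ^^ i) x \<in> E \<longleftrightarrow> x \<in> E" if "x \<in> space M" for i x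
  proof (induction i)
    case (Suc i)
    have "(T ^^ i) x \<in> space M" using measurable_space[OF funpow_measurable that] .
    then show ?case using osc_invariant[OF f0 _ ab, of "(T ^^ i) x"] Suc by (simp add: E_def)
  qed simp
  have ex: "(\<exists>n\<ge>1. avg f n x < a) \<and> (\<exists>n\<ge>1. b < avg f n x)" if "x \<in> E" for x
  proof -
    from that obtain k where k: "\<And>m. \<exists>n\<ge>m. avg f n x < a - 1 / Suc k" "\<And>m. \<exists>n\<ge>m. b + 1 / Suc k < avg f n x"
      by (auto simp: osc_def E_def)
    have k0: "0 < 1 / real (Suc k)" by simp
    obtain n where n: "n \<ge> 1" "avg f n x < a - 1 / Suc k" using k(1) by blast
    obtain n' where n': "n' \<ge> 1" "b + 1 / Suc k < avg f n' x" using k(2) by blast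
    have "avg f n x < a" "b < avg f n' x" using n(2) n'(2) k0 by linarith+
    then show ?thesis using n(1) n'(1) by blast
  qed
  have Efin: "emeasure M E < \<infinity>"
  proof -
    have b: "0 < b" using ab by simp
    have "ennreal b * emeasure M E \<le> ennreal b * emeasure M {x \<in> space M. \<exists>n\<ge>1. b < avg f n x}"
      using ex sets.sets_into_space[OF E] by (intro mult_left_mono emeasure_mono) auto
    also have "\<dots> \<le> (\<integral>\<^sup>+x. f x \<partial>M)" using f0 b by (intro weak_type_1) auto
    also have "\<dots> < \<infinity>" using f f0 by (simp add: nn_integral_eq_integral)
    finally show ?thesis using b by (auto simp: ennreal_mult_less_top ennreal_eq_0_iff)
  qed
  then have ic: "integrable M (indicator E :: 'a \<Rightarrow> real)" by (intro integrable_real_indicator) auto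
  have fiE: "integrable M (\<lambda>x. indicator E x * f (T x))" using integrable_T[OF f] by (intro integrable_indicator_mult) auto
  \<comment> \<open>Stated with a sign so that one argument serves both \<open>s = 1\<close>,
    \<open>c = b\<close> and \<open>s = -1\<close>, \<open>c = a\<close>.\<close>
  have main: "0 \<le> s * (\<integral>x. indicator E x * f (T x) \<partial>M) - s * c * measure M E"
    if s: "\<And>x. x \<in> E \<Longrightarrow> \<exists>n\<ge>1. 0 < s * (avg f n x - c)" for s c :: real
  proof -
    define g where "g x = s * (indicator E x * f (T x)) - s * c * indicator E x" for x
    have gi: "integrable M g" unfolding g_def using fiE ic by (intro Bochner_Integration.integrable_diff) auto
    let ?E = "{x \<in> space M. \<exists>n. 0 < (\<Sum>i<n. g ((T ^^ i) x))}"
    have sg: "(\<Sum>i<n. g ((T ^^ i) x)) = indicator E x * (s * (real n * (avg f n x - c)))" if x: "x \<in> space M" for n x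
    proof -
      have "(\<Sum>i<n. g ((T ^^ i) x)) = (\<Sum>i<n. indicator E x * (s * (f (T ((T ^^ i) x)) - c)))"
        using inv[OF x] by (intro sum.cong) (auto simp: g_def indicator_def algebra_simps)
      also have "\<dots> = indicator E x * (s * ((\<Sum>i<n. f (T ((T ^^ i) x))) - n * c))"
        by (simp add: sum_distrib_left[symmetric] sum_subtractf)
      also have "(\<Sum>i<n. f (T ((T ^^ i) x))) - n * c = real n * (avg f n x - c)"
        by (cases n) (simp_all add: sum_T_shift avg_def field_simps del: of_nat_Suc)
      finally show ?thesis .
    qed
    have "?E = E"
    proof (intro equalityI subsetI)
      fix x assume "x \<in> ?E"
      then obtain n where xs: "x \<in> space M" and n: "0 < (\<Sum>i<n. g ((T ^^ i) x))" by blast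
      show "x \<in> E"
      proof (rule ccontr)
        assume "x \<notin> E"
        then show False using n unfolding sg[OF xs] by simp
      qed
    next
      fix x assume x: "x \<in> E"
      then obtain n where n: "n \<ge> 1" "0 < s * (avg f n x - c)" using s by blast
      have xs: "x \<in> space M" using x sets.sets_into_space[OF E] by auto
      have "0 < real n" using n by simp
      then have "0 < real n * (s * (avg f n x - c))" using n(2) by (rule mult_pos_pos)
      then have "0 < (\<Sum>i<n. g ((T ^^ i) x))" unfolding sg[OF xs] using x by (simp add: algebra_simps)
      then show "x \<in> ?E" using xs by blast
    qed
    then have "0 \<le> (\<integral>x. indicator E x * g x \<partial>M)" using maximal_ergodic[OF gi] by simp
    also have "(\<integral>x. indicator E x * g x \<partial>M) = (\<integral>x. g x \<partial>M)"
      by (intro Bochner_Integration.integral_cong) (auto simp: g_def indicator_def)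
    also have "\<dots> = s * (\<integral>x. indicator E x * f (T x) \<partial>M) - s * c * measure M E"
      unfolding g_def using fiE ic by simp
    finally show ?thesis .
  qed
  have "0 \<le> 1 * (\<integral>x. indicator E x * f (T x) \<partial>M) - 1 * b * measure M E" using ex by (intro main) auto
  moreover have "0 \<le> (-1) * (\<integral>x. indicator E x * f (T x) \<partial>M) - (-1) * a * measure M E" using ex by (intro main) auto
  ultimately have "0 \<le> (a - b) * measure M E" by (simp add: algebra_simps)
  then have "measure M E \<le> 0" using ab by (simp add: zero_le_mult_iff not_le)
  then have "measure M E = 0" using measure_nonneg[of M E] by linarith
  then show ?thesis using Efin by (simp add: E_def emeasure_eq_ennreal_measure less_top)
qed

end

text \<open>If the lower limit were below the upper one, reals \<open>p < q\<close> would separate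
  them, and rationals \<open>a < b\<close> strictly between \<open>p\<close> and \<open>q\<close>
  leave room for the slack \<open>1 / Suc k\<close>. Rational levels keep the exceptional sets
  countable in number.\<close>

lemma convergent_if_no_oscillation:
  fixes X :: "nat \<Rightarrow> real"
  assumes X: "\<And>n. 0 \<le> X n" "\<And>n. X n \<le> K"
    and no: "\<And>a b :: rat. 0 \<le> a \<Longrightarrow> a < b \<Longrightarrow> 
       \<not> (\<exists>k. (\<forall>m. \<exists>n\<ge>m. X n < of_rat a - 1 / Suc k) \<and> (\<forall>m. \<exists>n\<ge>m. of_rat b + 1 / Suc k < X n))"
  shows "convergent X"
proof -
  define l u where "l = liminf (\<lambda>n. ereal (X n))" and "u = limsup (\<lambda>n. ereal (X n))"
  have lu: "l \<le> u" unfolding l_def u_def by (rule Liminf_le_Limsup) simp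
  have l0: "0 \<le> l" unfolding l_def using X(1) by (intro Liminf_bounded) auto
  have uK: "u \<le> ereal K" unfolding u_def using X(2) by (intro Limsup_bounded) auto
  have "\<not> l < u"
  proof
    assume "l < u"
    then obtain p where p: "l < ereal p" "ereal p < u" using ereal_dense2 by blast
    then obtain q where q: "ereal p < ereal q" "ereal q < u" using ereal_dense2 by blast
    obtain a where a: "p < of_rat a" "of_rat a < q" using of_rat_dense[of p q] q by auto
    obtain b where b: "of_rat a < (of_rat b :: real)" "of_rat b < q" using of_rat_dense[of "of_rat a" q] a by auto
    have "0 \<le> p" using l0 p(1) by (metis ereal_less_eq(5) less_imp_le order.trans)
    then have a0: "0 \<le> a" using a(1) by (metis less_eq_real_def order_trans zero_le_of_rat_iff)
    have "0 < min (of_rat a - p) (q - of_rat b)" using a b by simp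
    then obtain k where k: "1 / real (Suc k) < min (of_rat a - p) (q - of_rat b)" using nat_approx_posE by blast
    have 1: "\<exists>n\<ge>m. X n < p" for m
    proof (rule ccontr)
      assume "\<not> (\<exists>n\<ge>m. X n < p)"
      then have "\<forall>\<^sub>F n in sequentially. ereal p \<le> ereal (X n)"
        unfolding eventually_sequentially by (auto simp: not_less intro!: exI[of _ m])
      then have "ereal p \<le> l" unfolding l_def by (rule Liminf_bounded)
      with p show False by simp
    qed
    have 2: "\<exists>n\<ge>m. q < X n" for m
    proof (rule ccontr)
      assume "\<not> (\<exists>n\<ge>m. q < X n)"
      then have "\<forall>\<^sub>F n in sequentially. ereal (X n) \<le> ereal q"
        unfolding eventually_sequentially by (auto simp: not_less intro!: exI[of _ m])
      then have "u \<le> ereal q" unfolding u_def by (rule Limsup_bounded)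
      with q show False by simp
    qed
    have "\<exists>n\<ge>m. X n < of_rat a - 1 / Suc k" for m
    proof -
      obtain n where "n \<ge> m" "X n < p" using 1 by blast
      moreover have "p < of_rat a - 1 / Suc k" using k by simp
      ultimately show ?thesis by (meson less_trans)
    qed
    moreover have "\<exists>n\<ge>m. of_rat b + 1 / Suc k < X n" for m 
    proof -
      obtain n where "n \<ge> m" "q < X n" using 2 by blast
      moreover have "of_rat b + 1 / Suc k < q" using k by simp
      ultimately show ?thesis by (meson less_trans)
    qed
    moreover have "a < b" using b(1) by (simp add: of_rat_less)
    ultimately show False using no[OF a0, of b] by blast
  qed
  then have "l = u" using lu by simp
  moreover obtain r where r: "l = ereal r" using l0 uK \<open>l = u\<close> by (cases l) auto
  ultimately have "((\<lambda>n. ereal (X n)) \<longlongrightarrow> ereal r) sequentially"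
    by (subst tendsto_iff_Liminf_eq_Limsup) (auto simp: l_def u_def)
  then show ?thesis by (auto simp: convergent_def)
qed

lemma ennreal_le_all_imp_0:
  assumes "\<And>n::nat. ennreal (real n) * e \<le> c" "c < (\<infinity>::ennreal)" shows "e = 0"
proof -
  have "e \<le> c" using assms(1)[of 1] by simp
  then have "e < \<infinity>" using assms(2) by (rule le_less_trans)
  then obtain r where r: "e = ennreal r" "0 \<le> r" by (cases e) auto
  obtain s where s: "c = ennreal s" "0 \<le> s" using assms(2) by (cases c) auto
  have "real n * r \<le> s" for n
    using assms(1)[of n] r s by (simp add: ennreal_mult[symmetric] ennreal_le_iff)
  then have "r \<le> 0"
    by (metis linorder_not_le mult.commute reals_Archimedean3)
  then show ?thesis using r by simp
qed

lemma nn_integral_powr_Ioo: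
  assumes "-1 < a" "0 \<le> t"
  shows "(\<integral>\<^sup>+l. ennreal (l powr a) * indicator {0<..<t} l \<partial>lborel) = ennreal (t powr (a + 1) / (a + 1))"
proof -
  have "((\<lambda>x. x powr a) has_integral (t powr (a + 1) / (a + 1))) {0<..<t}"
    using has_integral_powr_from_0[OF assms] by (simp add: has_integral_Icc_iff_Ioo)
  then show ?thesis by (intro nn_integral_has_integral_lebesgue') auto
qed

section \<open>Layer-cake formula and real interpolation\<close>

context sigma_finite_measure
begin

text \<open>Fubini's theorem for \<open>F powr p\<close>, written as the integral of
  \<open>p * l powr (p - 1)\<close> over \<open>0 < l < F\<close>.\<close>

lemma layer_cake:
  assumes [measurable]: "F \<in> borel_measurable M" and F: "\<And>x. 0 \<le> F x" and p: "1 < p"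
  shows "(\<integral>\<^sup>+x. ennreal (F x powr p) \<partial>M) = (\<integral>\<^sup>+l. ennreal (p * l powr (p - 1)) * indicator {0<..} l * emeasure M {x \<in> space M. l < F x} \<partial>lborel)"
proof -
  interpret pair_sigma_finite M lborel ..
  have "(\<integral>\<^sup>+x. ennreal (F x powr p) \<partial>M) = (\<integral>\<^sup>+x. (\<integral>\<^sup>+l. ennreal (p * l powr (p - 1)) * indicator {0<..} l * indicator {l. l < F x} l \<partial>lborel) \<partial>M)"
  proof (rule nn_integral_cong)
    fix x
    have "(\<integral>\<^sup>+l. ennreal (p * l powr (p - 1)) * indicator {0<..} l * indicator {l. l < F x} l \<partial>lborel) = 
       (\<integral>\<^sup>+l. ennreal p * (ennreal (l powr (p - 1)) * indicator {0<..<F x} l) \<partial>lborel)"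
      using p by (intro nn_integral_cong) (auto simp: indicator_def ennreal_mult)
    also have "\<dots> = ennreal p * ennreal (F x powr (p - 1 + 1) / (p - 1 + 1))"
      using p F[of x] by (subst nn_integral_cmult) (auto simp: nn_integral_powr_Ioo)
    also have "\<dots> = ennreal (F x powr p)" using p by (simp add: ennreal_mult[symmetric])
    finally show "ennreal (F x powr p) = (\<integral>\<^sup>+l. ennreal (p * l powr (p - 1)) * indicator {0<..} l * indicator {l. l < F x} l \<partial>lborel)" by simp
  qed
  also have "\<dots> = (\<integral>\<^sup>+l. (\<integral>\<^sup>+x. ennreal (p * l powr (p - 1)) * indicator {0<..} l * indicator {l. l < F x} l \<partial>M) \<partial>lborel)"
    by (rule Fubini'[symmetric]) (simp add: indicator_def[abs_def])
  also have "\<dots> = (\<integral>\<^sup>+l. ennreal (p * l powr (p - 1)) * indicator {0<..} l * emeasure M {x \<in> space M. l < F x} \<partial>lborel)"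
  proof (rule nn_integral_cong)
    fix l :: real
    have "(\<integral>\<^sup>+x. ennreal (p * l powr (p - 1)) * indicator {0<..} l * indicator {l. l < F x} l \<partial>M) = 
        (\<integral>\<^sup>+x. ennreal (p * l powr (p - 1)) * indicator {0<..} l * indicator {x \<in> space M. l < F x} x \<partial>M)"
      by (intro nn_integral_cong) (auto simp: indicator_def)
    also have "\<dots> = ennreal (p * l powr (p - 1)) * indicator {0<..} l * emeasure M {x \<in> space M. l < F x}"
      by (subst nn_integral_cmult_indicator) auto
    finally show "(\<integral>\<^sup>+x. ennreal (p * l powr (p - 1)) * indicator {0<..} l * indicator {l. l < F x} l \<partial>M) = ennreal (p * l powr (p - 1)) * indicator {0<..} l * emeasure M {x \<in> space M. l < F x}" .
  qed
  finally show ?thesis .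
qed

text \<open>A form of Marcinkiewicz interpolation made for two uses. The first term of
  \<open>weak\<close> is a truncated weak-type (1,1) bound; by Fubini it leads to the integral of
  \<open>l powr (p - 2)\<close> up to \<open>f x / s\<close>, so that a large \<open>s\<close>
  yields decay. The second is a rescaled distribution function of \<open>f\<close>. The maximal
  inequality takes \<open>L = 0\<close>; the error estimate along a return set uses both
  terms.\<close>

lemma Marcinkiewicz:
  assumes [measurable]: "F \<in> borel_measurable M" "f \<in> borel_measurable M" 
    and F: "\<And>x. 0 \<le> F x" and f: "\<And>x. 0 \<le> f x" and p: "1 < p"
    and K: "0 \<le> K" and L: "0 \<le> L" and s: "0 < s" and c: "0 < c"
    and weak: "\<And>l. 0 < l \<Longrightarrow> emeasure M {x \<in> space M. l < F x} \<le> 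
       ennreal (K / l) * (\<integral>\<^sup>+x. ennreal (f x) * indicator {x. s * l < f x} x \<partial>M) + ennreal L * emeasure M {x \<in> space M. c * l < f x}"
  shows "(\<integral>\<^sup>+x. ennreal (F x powr p) \<partial>M) \<le> ennreal (p * K / ((p - 1) * s powr (p - 1)) + L / c powr p) * (\<integral>\<^sup>+x. ennreal (f x powr p) \<partial>M)"
proof -
  note lc = layer_cake and bm = borel_measurable_nn_integral
  interpret pair_sigma_finite M lborel ..
  have i1: "(\<integral>\<^sup>+l. (\<integral>\<^sup>+x. ennreal (p * K * l powr (p - 2)) * indicator {0<..} l * (ennreal (f x) * indicator {x. s * l < f x} x) \<partial>M) \<partial>lborel)
     = ennreal (p * K / ((p - 1) * s powr (p - 1))) * (\<integral>\<^sup>+x. ennreal (f x powr p) \<partial>M)"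
  proof -
    have "(\<integral>\<^sup>+l. (\<integral>\<^sup>+x. ennreal (p * K * l powr (p - 2)) * indicator {0<..} l * (ennreal (f x) * indicator {x. s * l < f x} x) \<partial>M) \<partial>lborel)
       = (\<integral>\<^sup>+x. (\<integral>\<^sup>+l. ennreal (p * K * l powr (p - 2)) * indicator {0<..} l * (ennreal (f x) * indicator {x. s * l < f x} x) \<partial>lborel) \<partial>M)"
      by (rule Fubini') (simp add: indicator_def[abs_def])
    also have "\<dots> = (\<integral>\<^sup>+x. ennreal (p * K / ((p - 1) * s powr (p - 1))) * ennreal (f x powr p) \<partial>M)"
    proof (rule nn_integral_cong)
      fix x
      have "(\<integral>\<^sup>+l. ennreal (p * K * l powr (p - 2)) * indicator {0<..} l * (ennreal (f x) * indicator {x. s * l < f x} x) \<partial>lborel)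
         = (\<integral>\<^sup>+l. ennreal (p * K * f x) * (ennreal (l powr (p - 2)) * indicator {0<..<f x / s} l) \<partial>lborel)"
        using p K f[of x] s by (intro nn_integral_cong) (auto simp: indicator_def ennreal_mult[symmetric] field_simps)
      also have "\<dots> = ennreal (p * K * f x) * ennreal ((f x / s) powr (p - 2 + 1) / (p - 2 + 1))"
        using p f[of x] s by (subst nn_integral_cmult) (auto simp: nn_integral_powr_Ioo)
      also have "\<dots> = ennreal (p * K * f x * ((f x / s) powr (p - 1) / (p - 1)))"
        using p K f[of x] s by (simp add: ennreal_mult[symmetric])
      also have "p * K * f x * ((f x / s) powr (p - 1) / (p - 1)) = p * K / ((p - 1) * s powr (p - 1)) * (f x powr p)"
        using p s f[of x] powr_mult_base[of "f x" "p - 1"] by (simp add: powr_divide field_simps)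
      also have "ennreal \<dots> = ennreal (p * K / ((p - 1) * s powr (p - 1))) * ennreal (f x powr p)"
        using p K s by (intro ennreal_mult) auto
      finally show "(\<integral>\<^sup>+l. ennreal (p * K * l powr (p - 2)) * indicator {0<..} l * (ennreal (f x) * indicator {x. s * l < f x} x) \<partial>lborel) = 
        ennreal (p * K / ((p - 1) * s powr (p - 1))) * ennreal (f x powr p)" .
    qed
    also have "\<dots> = ennreal (p * K / ((p - 1) * s powr (p - 1))) * (\<integral>\<^sup>+x. ennreal (f x powr p) \<partial>M)"
      by (rule nn_integral_cmult) measurable
    finally show ?thesis .
  qed
  have i2: "(\<integral>\<^sup>+l. ennreal (p * l powr (p - 1)) * indicator {0<..} l * emeasure M {x \<in> space M. c * l < f x} \<partial>lborel) = ennreal (1 / c powr p) * (\<integral>\<^sup>+x. ennreal (f x powr p) \<partial>M)"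
  proof -
    have "(\<integral>\<^sup>+l. ennreal (p * l powr (p - 1)) * indicator {0<..} l * emeasure M {x \<in> space M. c * l < f x} \<partial>lborel)
      = (\<integral>\<^sup>+l. ennreal (p * l powr (p - 1)) * indicator {0<..} l * emeasure M {x \<in> space M. l < f x / c} \<partial>lborel)"
      using c by (simp add: field_simps)
    also have "\<dots> = (\<integral>\<^sup>+x. ennreal ((f x / c) powr p) \<partial>M)"
      using f c p by (intro lc[symmetric]) auto
    also have "\<dots> = (\<integral>\<^sup>+x. ennreal (1 / c powr p) * ennreal (f x powr p) \<partial>M)"
      using f c by (intro nn_integral_cong) (simp add: powr_divide ennreal_mult[symmetric])
    also have "\<dots> = ennreal (1 / c powr p) * (\<integral>\<^sup>+x. ennreal (f x powr p) \<partial>M)"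
      by (rule nn_integral_cmult) measurable
    finally show ?thesis .
  qed
  \<comment> \<open>Measurability in \<open>l\<close> follows by writing the distribution function
    as a parameter integral of a jointly measurable indicator.\<close>
  have mm: "(\<lambda>l. emeasure M {x \<in> space M. c * l < f x}) \<in> borel_measurable lborel"
  proof -
    have "(\<lambda>l. \<integral>\<^sup>+x. indicator {z. c * fst z < f (snd z)} (l, x) \<partial>M) \<in> borel_measurable lborel"
      by (rule bm) (simp add: indicator_def[abs_def] split_beta')
    also have "(\<lambda>l. \<integral>\<^sup>+x. indicator {z. c * fst z < f (snd z)} (l, x) \<partial>M) = (\<lambda>l. emeasure M {x \<in> space M. c * l < f x})"
    proof
      fix l :: real
      have "(\<integral>\<^sup>+x. indicator {z. c * fst z < f (snd z)} (l, x) \<partial>M) = (\<integral>\<^sup>+x. indicator {x \<in> space M. c * l < f x} x \<partial>M)"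
        by (intro nn_integral_cong) (auto simp: indicator_def)
      then show "(\<integral>\<^sup>+x. indicator {z. c * fst z < f (snd z)} (l, x) \<partial>M) = emeasure M {x \<in> space M. c * l < f x}"
        by simp
    qed
    finally show ?thesis .
  qed
  have m1: "(\<lambda>l. (\<integral>\<^sup>+x. ennreal (p * K * l powr (p - 2)) * indicator {0<..} l * (ennreal (f x) * indicator {x. s * l < f x} x) \<partial>M)) \<in> borel_measurable lborel"
    by (rule bm) (simp add: indicator_def[abs_def] split_beta')
  have "(\<integral>\<^sup>+x. ennreal (F x powr p) \<partial>M) = (\<integral>\<^sup>+l. ennreal (p * l powr (p - 1)) * indicator {0<..} l * emeasure M {x \<in> space M. l < F x} \<partial>lborel)"
    by (rule lc[OF _ F p]) measurable
  also have "\<dots> \<le> (\<integral>\<^sup>+l. (\<integral>\<^sup>+x. ennreal (p * K * l powr (p - 2)) * indicator {0<..} l * (ennreal (f x) * indicator {x. s * l < f x} x) \<partial>M)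
      + ennreal L * (ennreal (p * l powr (p - 1)) * indicator {0<..} l * emeasure M {x \<in> space M. c * l < f x}) \<partial>lborel)"
  proof (rule nn_integral_mono)
    fix l :: real
    show "ennreal (p * l powr (p - 1)) * indicator {0<..} l * emeasure M {x \<in> space M. l < F x} \<le> 
      (\<integral>\<^sup>+x. ennreal (p * K * l powr (p - 2)) * indicator {0<..} l * (ennreal (f x) * indicator {x. s * l < f x} x) \<partial>M)
      + ennreal L * (ennreal (p * l powr (p - 1)) * indicator {0<..} l * emeasure M {x \<in> space M. c * l < f x})"
    proof (cases "0 < l")
      case True
      have e: "ennreal (p * l powr (p - 1)) * ennreal (K / l) = ennreal (p * K * l powr (p - 2))"
        using True p K powr_diff[of l "p - 1" 1] by (simp add: ennreal_mult[symmetric])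
      have "ennreal (p * l powr (p - 1)) * emeasure M {x \<in> space M. l < F x} \<le> ennreal (p * l powr (p - 1)) * 
         (ennreal (K / l) * (\<integral>\<^sup>+x. ennreal (f x) * indicator {x. s * l < f x} x \<partial>M) + ennreal L * emeasure M {x \<in> space M. c * l < f x})"
        by (intro mult_left_mono weak True) auto
      also have "\<dots> = ennreal (p * K * l powr (p - 2)) * (\<integral>\<^sup>+x. ennreal (f x) * indicator {x. s * l < f x} x \<partial>M) + 
          ennreal L * (ennreal (p * l powr (p - 1)) * emeasure M {x \<in> space M. c * l < f x})"
        unfolding e[symmetric] by (simp add: distrib_left mult_ac)
      also have "ennreal (p * K * l powr (p - 2)) * (\<integral>\<^sup>+x. ennreal (f x) * indicator {x. s * l < f x} x \<partial>M) = 
          (\<integral>\<^sup>+x. ennreal (p * K * l powr (p - 2)) * (ennreal (f x) * indicator {x. s * l < f x} x) \<partial>M)"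
        by (rule nn_integral_cmult[symmetric]) measurable
      finally show ?thesis using True by simp
    qed simp
  qed
  also have "\<dots> = (\<integral>\<^sup>+l. (\<integral>\<^sup>+x. ennreal (p * K * l powr (p - 2)) * indicator {0<..} l * (ennreal (f x) * indicator {x. s * l < f x} x) \<partial>M) \<partial>lborel)
      + ennreal L * (\<integral>\<^sup>+l. ennreal (p * l powr (p - 1)) * indicator {0<..} l * emeasure M {x \<in> space M. c * l < f x} \<partial>lborel)"
    using m1 mm by (subst nn_integral_add) (auto intro!: nn_integral_cmult)
  also have "\<dots> = ennreal (p * K / ((p - 1) * s powr (p - 1)) + L / c powr p) * (\<integral>\<^sup>+x. ennreal (f x powr p) \<partial>M)"
  proof -
    have "ennreal L * (ennreal (1 / c powr p) * I) = ennreal (L / c powr p) * I" for I :: ennreal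
      using L by (simp add: mult.assoc[symmetric] ennreal_mult[symmetric])
    then show ?thesis unfolding i1 i2 using p K L s
      by (simp add: ennreal_plus distrib_right)
  qed
  finally show ?thesis .
qed

end

section \<open>Birkhoff's theorem and the maximal inequality in L^p\<close>

context measure_preserving
begin

lemma avg_mono: "(\<And>x. f x \<le> g x) \<Longrightarrow> avg f n x \<le> avg g n x"
  unfolding avg_def by (intro divide_right_mono sum_mono) auto

lemma avg_le_cut:
  assumes "0 \<le> c" shows "avg f n x \<le> c + avg (\<lambda>x. f x * indicator {x. c < f x} x) n x"
proof -
  have "(\<Sum>i=1..n. f ((T ^^ i) x)) \<le> (\<Sum>i=1..n. c + f ((T ^^ i) x) * indicator {x. c < f x} ((T ^^ i) x))"
    using assms by (intro sum_mono) (auto simp: indicator_def)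
  also have "\<dots> = n * c + (\<Sum>i=1..n. f ((T ^^ i) x) * indicator {x. c < f x} ((T ^^ i) x))"
    by (simp add: sum.distrib)
  finally show ?thesis using assms by (cases "n = 0") (auto simp: avg_def field_simps)
qed

text \<open>Above height \<open>c\<close> one has \<open>f \<le> c powr (1 - p) * f powr p\<close>,
  whatever the total measure is.\<close>

lemma integrable_cut:
  assumes [measurable]: "f \<in> borel_measurable M" and f0: "\<And>x. 0 \<le> f x" and p: "1 \<le> p" and c: "0 < c"
    and fin: "(\<integral>\<^sup>+x. ennreal (f x powr p) \<partial>M) < \<infinity>"
  shows "integrable M (\<lambda>x. f x * indicator {x. c < f x} x)"
proof (rule integrableI_nonneg)
  have "(\<integral>\<^sup>+x. ennreal (f x * indicator {x. c < f x} x) \<partial>M) \<le> (\<integral>\<^sup>+x. ennreal (c powr (1 - p)) * ennreal (f x powr p) \<partial>M)"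
  proof (rule nn_integral_mono)
    fix x
    have "f x * indicator {x. c < f x} x \<le> c powr (1 - p) * f x powr p"
    proof (cases "c < f x")
      case True
      have "f x = f x powr (1 - p) * f x powr p" using True c by (simp flip: powr_add)
      also have "\<dots> \<le> c powr (1 - p) * f x powr p" using True c p by (intro mult_right_mono powr_mono2') auto
      finally show ?thesis using True by simp
    qed simp
    then show "ennreal (f x * indicator {x. c < f x} x) \<le> ennreal (c powr (1 - p)) * ennreal (f x powr p)"
      by (simp add: ennreal_mult[symmetric] ennreal_leI)
  qed
  also have "\<dots> < \<infinity>" using fin by (subst nn_integral_cmult) (auto simp: ennreal_mult_less_top)
  finally show "(\<integral>\<^sup>+x. ennreal (f x * indicator {x. c < f x} x) \<partial>M) < \<infinity>" .
qed (use f0 in auto)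

text \<open>By the weak-type bound, the set on which the averages exceed every integer has measure
  at most 1/k times the integral of \<open>f\<close>, for every positive integer k.\<close>

lemma avg_bounded_AE:
  assumes f: "integrable M f" and f0: "\<And>x. 0 \<le> f x"
  shows "AE x in M. \<exists>K. \<forall>n. avg f n x \<le> K"
proof -
  note [measurable] = borel_measurable_integrable[OF f]
  define E where "E = {x \<in> space M. \<forall>k::nat. \<exists>n\<ge>1. real k < avg f n x}"
  have [measurable]: "E \<in> sets M" unfolding E_def by measurable
  have "emeasure M E = 0"
  proof (rule ennreal_le_all_imp_0)
    show "ennreal (real k) * emeasure M E \<le> (\<integral>\<^sup>+x. f x \<partial>M)" for k
    proof (cases "k = 0")
      case False
      have "ennreal (real k) * emeasure M E \<le> ennreal (real k) * emeasure M {x \<in> space M. \<exists>n\<ge>1. real k < avg f n x}"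
        by (intro mult_left_mono emeasure_mono) (auto simp: E_def)
      also have "\<dots> \<le> (\<integral>\<^sup>+x. f x \<partial>M)" using f0 False by (intro weak_type_1) auto
      finally show ?thesis .
    qed simp
    show "(\<integral>\<^sup>+x. f x \<partial>M) < \<infinity>" using f f0 by (simp add: nn_integral_eq_integral)
  qed
  then have "AE x in M. x \<notin> E" by (intro AE_not_in) (auto simp: null_sets_def)
  then show ?thesis
  proof (rule AE_mp, intro AE_I2 impI)
    fix x assume "x \<in> space M" "x \<notin> E"
    then obtain k :: nat where "\<And>n. n \<ge> 1 \<Longrightarrow> avg f n x \<le> real k" by (auto simp: E_def not_less)
    moreover have "avg f 0 x \<le> real k" by (simp add: avg_def)
    ultimately show "\<exists>K. \<forall>n. avg f n x \<le> K" by (metis less_one not_le)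
  qed
qed

lemma Birkhoff_L1:
  assumes f: "integrable M f" and f0: "\<And>x. 0 \<le> f x"
  shows "AE x in M. convergent (\<lambda>n. avg f n x)"
proof -
  note [measurable] = borel_measurable_integrable[OF f]
  have "AE x in M. 0 \<le> a \<longrightarrow> a < b \<longrightarrow> x \<notin> osc f (of_rat a) (of_rat b)" for a b
  proof (cases "0 \<le> a \<and> a < b")
    case True
    have "osc f (of_rat a) (of_rat b) \<in> sets M" unfolding osc_def by measurable
    moreover have "emeasure M (osc f (of_rat a) (of_rat b)) = 0"
      using True by (intro osc_null[OF f f0]) (auto simp: of_rat_less)
    ultimately have "AE x in M. x \<notin> osc f (of_rat a) (of_rat b)" by (intro AE_not_in) (auto simp: null_sets_def)
    then show ?thesis by auto
  qed auto
  then have "AE x in M. \<forall>a b. 0 \<le> a \<longrightarrow> a < b \<longrightarrow> x \<notin> osc f (of_rat a) (of_rat b)"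
    by (simp add: AE_all_countable)
  then show ?thesis using avg_bounded_AE[OF f f0] AE_space
  proof eventually_elim
    case (elim x)
    then obtain K where K: "\<And>n. avg f n x \<le> K" by blast
    show ?case
    proof (rule convergent_if_no_oscillation[OF _ K])
      show "0 \<le> avg f n x" for n using f0 by (auto simp: avg_def intro!: divide_nonneg_nonneg sum_nonneg)
      fix a b :: rat assume "0 \<le> a" "a < b"
      then have "x \<notin> osc f (of_rat a) (of_rat b)" using elim by blast
      then show "\<not> (\<exists>k. (\<forall>m. \<exists>n\<ge>m. avg f n x < of_rat a - 1 / Suc k) \<and> (\<forall>m. \<exists>n\<ge>m. of_rat b + 1 / Suc k < avg f n x))"
        using elim by (auto simp: osc_def)
    qed
  qed
qed

text \<open>Cutting at height \<open>1 / Suc k\<close> leaves an integrable function whose averages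
  differ from those of \<open>f\<close> by at most that height, uniformly in \<open>n\<close>. Hence
  the averages of \<open>f\<close> are Cauchy wherever those of all the cuts converge.\<close>

lemma Birkhoff_Lp:
  assumes [measurable]: "f \<in> borel_measurable M" and f0: "\<And>x. 0 \<le> f x" and p: "1 \<le> p"
    and fin: "(\<integral>\<^sup>+x. ennreal (f x powr p) \<partial>M) < \<infinity>"
  shows "AE x in M. convergent (\<lambda>n. avg f n x)"
proof -
  define g where "g k x = f x * indicator {x. 1 / real (Suc k) < f x} x" for k x
  have "AE x in M. convergent (\<lambda>n. avg (g k) n x)" for k
  proof (rule Birkhoff_L1)
    show "integrable M (g k)" unfolding g_def by (rule integrable_cut[OF _ f0 p _ fin]) auto
    show "0 \<le> g k x" for x using f0 by (simp add: g_def)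
  qed
  then have "AE x in M. \<forall>k. convergent (\<lambda>n. avg (g k) n x)" by (simp add: AE_all_countable)
  then show ?thesis
  proof eventually_elim
    case (elim x)
    have close: "\<bar>avg f n x - avg (g k) n x\<bar> \<le> 1 / real (Suc k)" for n k
    proof -
      have "avg f n x \<le> 1 / real (Suc k) + avg (g k) n x"
        unfolding g_def by (rule avg_le_cut) simp
      moreover have "avg (g k) n x \<le> avg f n x"
        using f0 by (intro avg_mono) (auto simp: g_def indicator_def)
      ultimately show ?thesis by (simp add: abs_le_iff)
    qed
    have "Cauchy (\<lambda>n. avg f n x)"
    proof (rule metric_CauchyI)
      fix e :: real assume e: "0 < e"
      then obtain k where k: "1 / real (Suc k) < e / 3" using nat_approx_posE[of "e/3"] by auto
      have "Cauchy (\<lambda>n. avg (g k) n x)" using elim by (simp add: convergent_Cauchy)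
      then obtain n0 where n0: "\<And>m n. m \<ge> n0 \<Longrightarrow> n \<ge> n0 \<Longrightarrow> dist (avg (g k) m x) (avg (g k) n x) < e / 3"
        using e metric_CauchyD[of "\<lambda>n. avg (g k) n x" "e/3"] by auto
      have "dist (avg f m x) (avg f n x) < e" if "m \<ge> n0" "n \<ge> n0" for m n
        using close[of m k] close[of n k] n0[OF that] k unfolding dist_real_def by linarith
      then show "\<exists>M. \<forall>m\<ge>M. \<forall>n\<ge>M. dist (avg f m x) (avg f n x) < e" by blast
    qed
    then show ?case by (simp add: Cauchy_convergent_iff)
  qed
qed

text \<open>The part of \<open>f\<close> below \<open>l / 2\<close> contributes at most
  \<open>l / 2\<close> to any average, so the weak-type bound is needed only for the part above.
  This is the hypothesis of \<open>Marcinkiewicz\<close> with \<open>K = 2\<close>,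
  \<open>s = 1/2\<close> and \<open>L = 0\<close>.\<close>

lemma maximal_Lp:
  assumes [measurable]: "f \<in> borel_measurable M" and f0: "\<And>x. 0 \<le> f x" and p: "1 < p"
    and fin: "(\<integral>\<^sup>+x. ennreal (f x powr p) \<partial>M) < \<infinity>"
  shows "\<exists>F. F \<in> borel_measurable M \<and> (\<forall>x. 0 \<le> F x) \<and> (AE x in M. \<forall>n. avg f n x \<le> F x) \<and>
    (\<integral>\<^sup>+x. ennreal (F x powr p) \<partial>M) \<le> ennreal (p * 2 / ((p - 1) * (1/2) powr (p - 1))) * (\<integral>\<^sup>+x. ennreal (f x powr p) \<partial>M)"
proof -
  define S where "S x = (SUP n. ennreal (avg f n x))" for x
  define F where "F x = enn2real (S x)" for x
  have [measurable]: "S \<in> borel_measurable M" unfolding S_def by measurable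
  have [measurable]: "F \<in> borel_measurable M" unfolding F_def by measurable
  have a0: "0 \<le> avg f n x" for n x using f0 by (auto simp: avg_def intro!: divide_nonneg_nonneg sum_nonneg)
  have "AE x in M. \<forall>n. avg f n x \<le> F x"
  proof -
    \<comment> \<open>\<open>F\<close> is the real value of an extended supremum and dominates the
      averages only where that supremum is finite. The part of \<open>f\<close> above height 1 is
      integrable, which settles this almost everywhere.\<close>
    have "AE x in M. \<exists>K. \<forall>n. avg (\<lambda>x. f x * indicator {x. 1 < f x} x) n x \<le> K"
      using f0 p by (intro avg_bounded_AE integrable_cut[OF _ f0 _ _ fin]) auto
    then show ?thesis
    proof eventually_elim
      case (elim x)
      then obtain K where K: "\<And>n. avg (\<lambda>x. f x * indicator {x. 1 < f x} x) n x \<le> K" by blast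
      have "avg f n x \<le> 1 + K" for n using avg_le_cut[of 1 f n x] K[of n] by simp
      then have "S x \<le> ennreal (1 + K)" unfolding S_def by (intro SUP_least ennreal_leI)
      then have "S x < \<infinity>" by (rule le_less_trans) simp
      moreover have "ennreal (avg f n x) \<le> S x" for n unfolding S_def by (rule SUP_upper) simp
      ultimately have "enn2real (ennreal (avg f n x)) \<le> F x" for n
        unfolding F_def by (intro enn2real_mono) auto
      then show ?case using a0 by simp
    qed
  qed
  moreover have "(\<integral>\<^sup>+x. ennreal (F x powr p) \<partial>M) \<le> ennreal (p * 2 / ((p - 1) * (1/2) powr (p - 1)) + 0 / 1 powr p) * (\<integral>\<^sup>+x. ennreal (f x powr p) \<partial>M)"
  proof (rule Marcinkiewicz[OF _ _ _ f0 p])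
    fix l :: real assume l: "0 < l"
    define g where "g x = f x * indicator {x. l / 2 < f x} x" for x
    have [measurable]: "g \<in> borel_measurable M" unfolding g_def by measurable
    have "{x \<in> space M. l < F x} \<subseteq> {x \<in> space M. \<exists>n\<ge>1. l / 2 < avg g n x}"
    proof
      fix x assume "x \<in> {x \<in> space M. l < F x}"
      then have x: "x \<in> space M" "l < enn2real (S x)" by (auto simp: F_def)
      then have "S x \<noteq> \<infinity>" using l by auto
      then have "S x = ennreal (enn2real (S x))" by (simp add: less_top)
      then have "ennreal l < S x" using x l by (metis ennreal_less_iff less_imp_le)
      then obtain n where "ennreal l < ennreal (avg f n x)" unfolding S_def less_SUP_iff by auto
      then have n: "l < avg f n x" using l by (simp add: ennreal_less_iff)
      also have "\<dots> \<le> l / 2 + avg g n x" unfolding g_def using l by (intro avg_le_cut) simp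
      finally have "l / 2 < avg g n x" by simp
      moreover have "n \<ge> 1" using n l by (cases n) (auto simp: avg_def)
      ultimately show "x \<in> {x \<in> space M. \<exists>n\<ge>1. l / 2 < avg g n x}" using x by blast
    qed
    then have "emeasure M {x \<in> space M. l < F x} \<le> emeasure M {x \<in> space M. \<exists>n\<ge>1. l / 2 < avg g n x}"
      by (rule emeasure_mono) measurable
    also have "\<dots> = ennreal (2 / l) * (ennreal (l / 2) * emeasure M {x \<in> space M. \<exists>n\<ge>1. l / 2 < avg g n x})"
      using l by (simp add: mult.assoc[symmetric] ennreal_mult[symmetric])
    also have "\<dots> \<le> ennreal (2 / l) * (\<integral>\<^sup>+x. g x \<partial>M)"
      using l f0 by (intro mult_left_mono weak_type_1) (auto simp: g_def)
    also have "(\<integral>\<^sup>+x. g x \<partial>M) = (\<integral>\<^sup>+x. ennreal (f x) * indicator {x. 1/2 * l < f x} x \<partial>M)"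
      by (intro nn_integral_cong) (auto simp: g_def indicator_def)
    finally show "emeasure M {x \<in> space M. l < F x} \<le> ennreal (2 / l) * (\<integral>\<^sup>+x. ennreal (f x) * indicator {x. 1/2 * l < f x} x \<partial>M) + 
       ennreal 0 * emeasure M {x \<in> space M. 1 * l < f x}" by simp
  qed (auto simp: F_def)
  ultimately show ?thesis by (intro exI[of _ F]) (auto simp: F_def)
qed

end

section \<open>Transference and interpolation\<close>

text \<open>The sum of squares is the constant coefficient of \<open>f\<close> times its
  conjugate.\<close>

lemma Parseval:
  assumes c: "trigpoly d c f"
  shows "((\<lambda>u. (norm (f u))\<^sup>2) has_integral (\<Sum>m\<in>{- int d..int d}. (norm (c m))\<^sup>2)) {0..1}"
proof -
  have "((\<lambda>u. f (u + 0) * cnj (f (u + 0))) has_integral trig_conv d d c (\<lambda>m. cnj (c (- m))) 0) {0..1}"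
    by (rule trigpoly_integral[OF trigpoly_mult_conv[OF c trigpoly_cnj[OF c]]])
  moreover have "trig_conv d d c (\<lambda>m. cnj (c (- m))) 0 = (\<Sum>m\<in>{- int d..int d}. c m * cnj (c m))"
    unfolding trig_conv_def by (rule sum.reindex_bij_witness[of _ "\<lambda>m. (m, - m)" fst]) (auto simp: add_eq_0_iff)
  ultimately have "((\<lambda>u. complex_of_real ((norm (f u))\<^sup>2)) has_integral of_real (\<Sum>m\<in>{- int d..int d}. (norm (c m))\<^sup>2)) {0..1}"
    by (simp add: complex_norm_square del: of_real_power)
  from has_integral_Re[OF this] show ?thesis by simp
qed

text \<open>With \<open>a\<close> placed at negative and \<open>g\<close> at nonnegative
  frequencies, the correlations on the left are coefficients of the product \<open>P * G\<close>. By
  Parseval, multiplication by \<open>P\<close> increases the square sum by a factor of at most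
  \<open>A\<^sup>2\<close>. The window up to \<open>2 * N\<close> contains every
  \<open>r + n\<close> that occurs.\<close>

lemma transference_finite:
  fixes a g :: "nat \<Rightarrow> real"
  assumes A: "\<And>\<xi>. norm (\<Sum>n=1..N. of_real (a n) * ee (\<xi> * real n)) \<le> A"
  shows "(\<Sum>r<N. (\<Sum>n=1..N. a n * g (r + n))\<^sup>2) \<le> A\<^sup>2 * (\<Sum>k\<le>2*N. (g k)\<^sup>2)"
proof -
  define a' where "a' m = (if m < 0 then complex_of_real (a (nat (- m))) else 0)" for m :: int
  define b' where "b' m = (if 0 \<le> m then complex_of_real (g (nat m)) else 0)" for m :: int
  define P where "P v = (\<Sum>n=1..N. of_real (a n) * ee (- v * real n))" for v
  define G where "G v = (\<Sum>k\<le>2*N. of_real (g k) * ee (real k * v))" for v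
  have P: "trigpoly N a' P" unfolding trigpoly_def
  proof
    fix v
    have "(\<Sum>m\<in>{- int N..int N}. a' m * ee (of_int m * v)) = (\<Sum>m\<in>(\<lambda>n. - int n) ` {1..N}. a' m * ee (of_int m * v))"
    proof (rule sum.mono_neutral_right)
      show "\<forall>i\<in>{- int N..int N} - (\<lambda>n. - int n) ` {1..N}. a' i * ee (of_int i * v) = 0"
      proof
        fix i assume i: "i \<in> {- int N..int N} - (\<lambda>n. - int n) ` {1..N}"
        have "\<not> i < 0"
        proof
          assume "i < 0"
          then have "nat (-i) \<in> {1..N}" "i = - int (nat (-i))" using i by auto
          then show False using i by blast
        qed
        then show "a' i * ee (of_int i * v) = 0" by (simp add: a'_def)
      qed
    qed auto
    also have "\<dots> = P v"
      by (subst sum.reindex) (auto simp: inj_on_def P_def a'_def mult.commute intro!: sum.cong)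
    finally show "P v = (\<Sum>m\<in>{- int N..int N}. a' m * ee (of_int m * v))" by simp
  qed
  have G: "trigpoly (2 * N) b' G" unfolding trigpoly_def
  proof
    fix v
    have "(\<Sum>m\<in>{- int (2*N)..int (2*N)}. b' m * ee (of_int m * v)) = (\<Sum>m\<in>int ` {..2*N}. b' m * ee (of_int m * v))"
    proof (rule sum.mono_neutral_right)
      show "\<forall>i\<in>{- int (2*N)..int (2*N)} - int ` {..2*N}. b' i * ee (of_int i * v) = 0"
      proof
        fix i assume i: "i \<in> {- int (2*N)..int (2*N)} - int ` {..2*N}"
        have "\<not> 0 \<le> i"
        proof
          assume "0 \<le> i"
          then have "nat i \<in> {..2*N}" "i = int (nat i)" using i by auto
          then show False using i by blast
        qed
        then show "b' i * ee (of_int i * v) = 0" by (simp add: b'_def)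
      qed
    qed auto
    also have "\<dots> = G v"
      by (subst sum.reindex) (auto simp: inj_on_def G_def b'_def)
    finally show "G v = (\<Sum>m\<in>{- int (2*N)..int (2*N)}. b' m * ee (of_int m * v))" by simp
  qed
  let ?c = "trig_conv N (2 * N) a' b'"
  have cr: "?c (int r) = of_real (\<Sum>n=1..N. a n * g (r + n))" if r: "r < N" for r
  proof -
    have "?c (int r) = (\<Sum>p\<in>(\<lambda>n. (- int n, int (r + n))) ` {1..N}. a' (fst p) * b' (snd p))"
      unfolding trig_conv_def
    proof (rule sum.mono_neutral_right)
      show "\<forall>p\<in>{p \<in> {- int N..int N} \<times> {- int (2*N)..int (2*N)}. fst p + snd p = int r} - (\<lambda>n. (- int n, int (r + n))) ` {1..N}. a' (fst p) * b' (snd p) = 0"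
      proof
        fix p assume p: "p \<in> {p \<in> {- int N..int N} \<times> {- int (2*N)..int (2*N)}. fst p + snd p = int r} - (\<lambda>n. (- int n, int (r + n))) ` {1..N}"
        have "\<not> fst p < 0"
        proof
          assume "fst p < 0"
          then have "nat (- fst p) \<in> {1..N}" "p = (- int (nat (- fst p)), int (r + nat (- fst p)))" using p by (auto simp: prod_eq_iff)
          then show False using p by blast
        qed
        then show "a' (fst p) * b' (snd p) = 0" by (simp add: a'_def)
      qed
    qed (use r in auto)
    also have "\<dots> = (\<Sum>n=1..N. of_real (a n) * of_real (g (r + n)))"
      by (subst sum.reindex) (auto simp: inj_on_def a'_def b'_def nat_add_distrib)
    finally show ?thesis by simp
  qed
  have "(\<Sum>r<N. (\<Sum>n=1..N. a n * g (r + n))\<^sup>2) = (\<Sum>r<N. (norm (?c (int r)))\<^sup>2)"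
    by (intro sum.cong) (auto simp: cr simp del: of_real_sum)
  also have "\<dots> = (\<Sum>m\<in>int ` {..<N}. (norm (?c m))\<^sup>2)"
    by (subst sum.reindex) (auto simp: inj_on_def)
  also have "\<dots> \<le> (\<Sum>m\<in>{- int (N + 2*N)..int (N + 2*N)}. (norm (?c m))\<^sup>2)"
    by (intro sum_mono2) auto
  also have "\<dots> \<le> A\<^sup>2 * (\<Sum>m\<in>{- int (2*N)..int (2*N)}. (norm (b' m))\<^sup>2)"
  proof (rule has_integral_le[OF Parseval[OF trigpoly_mult_conv[OF P G]] has_integral_mult_right[OF Parseval[OF G]]])
    fix v :: real
    have "norm (P v) \<le> A" unfolding P_def by (rule A)
    then have "(norm (P v))\<^sup>2 \<le> A\<^sup>2" by (intro power_mono) auto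
    then show "(norm (P v * G v))\<^sup>2 \<le> A\<^sup>2 * (norm (G v))\<^sup>2"
      by (simp add: norm_mult power_mult_distrib mult_right_mono)
  qed
  also have "(\<Sum>m\<in>{- int (2*N)..int (2*N)}. (norm (b' m))\<^sup>2) = (\<Sum>m\<in>int ` {..2*N}. (norm (b' m))\<^sup>2)"
  proof (rule sum.mono_neutral_right)
    show "\<forall>i\<in>{- int (2*N)..int (2*N)} - int ` {..2*N}. (norm (b' i))\<^sup>2 = 0"
    proof
      fix i assume i: "i \<in> {- int (2*N)..int (2*N)} - int ` {..2*N}"
      have "\<not> 0 \<le> i"
      proof
        assume "0 \<le> i"
        then have "nat i \<in> {..2*N}" "i = int (nat i)" using i by auto
        then show False using i by blast
      qed
      then show "(norm (b' i))\<^sup>2 = 0" by (simp add: b'_def)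
    qed
  qed auto
  also have "\<dots> = (\<Sum>k\<le>2*N. (g k)\<^sup>2)"
    by (subst sum.reindex) (auto simp: inj_on_def b'_def)
  finally show ?thesis .
qed

context measure_preserving
begin

text \<open>Calderon's transference: by invariance the left-hand side may be averaged over the
  translates \<open>r < N\<close>, and on each orbit the finite inequality applies to the sequence
  of values of \<open>u\<close>. Integration gives \<open>N\<close> copies on the left against
  \<open>2 * N + 1\<close> on the right, a ratio of at most 3.\<close>

lemma transference_L2:
  fixes a :: "nat \<Rightarrow> real"
  assumes [measurable]: "u \<in> borel_measurable M" and N: "1 \<le> N"
    and A: "\<And>\<xi>. norm (\<Sum>n=1..N. of_real (a n) * ee (\<xi> * real n)) \<le> A"
  shows "(\<integral>\<^sup>+x. ennreal ((\<Sum>n=1..N. a n * u ((T ^^ n) x))\<^sup>2) \<partial>M) \<le> ennreal (3 * A\<^sup>2) * (\<integral>\<^sup>+x. ennreal ((u x)\<^sup>2) \<partial>M)"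
proof -
  define v where "v x = (\<Sum>n=1..N. a n * u ((T ^^ n) x))" for x
  have um [measurable]: "(\<lambda>x. u ((T ^^ n) x)) \<in> borel_measurable M" for n
    by (rule compose_funpow_measurable) measurable
  have [measurable]: "v \<in> borel_measurable M" unfolding v_def by measurable
  have "ennreal (real N) * (\<integral>\<^sup>+x. ennreal ((v x)\<^sup>2) \<partial>M) = (\<Sum>r<N. (\<integral>\<^sup>+x. ennreal ((v ((T ^^ r) x))\<^sup>2) \<partial>M))"
  proof -
    have "(\<integral>\<^sup>+x. ennreal ((v ((T ^^ r) x))\<^sup>2) \<partial>M) = (\<integral>\<^sup>+x. ennreal ((v x)\<^sup>2) \<partial>M)" for r
      by (rule nn_integral_funpow[of "\<lambda>x. ennreal ((v x)\<^sup>2)"]) measurable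
    then show ?thesis by (simp add: ennreal_of_nat_eq_real_of_nat)
  qed
  also have "\<dots> = (\<integral>\<^sup>+x. (\<Sum>r<N. ennreal ((v ((T ^^ r) x))\<^sup>2)) \<partial>M)"
    by (intro nn_integral_sum[symmetric]) (auto intro!: compose_funpow_measurable[of "\<lambda>x. ennreal ((v x)\<^sup>2)"])
  also have "\<dots> \<le> (\<integral>\<^sup>+x. ennreal (A\<^sup>2) * (\<Sum>k\<le>2*N. ennreal ((u ((T ^^ k) x))\<^sup>2)) \<partial>M)"
  proof (rule nn_integral_mono)
    fix x
    have "(\<Sum>r<N. (v ((T ^^ r) x))\<^sup>2) = (\<Sum>r<N. (\<Sum>n=1..N. a n * u ((T ^^ (r + n)) x))\<^sup>2)"
    proof -
      have "(T ^^ n) ((T ^^ r) x) = (T ^^ (r + n)) x" for n r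
        by (metis add.commute comp_apply funpow_add)
      then show ?thesis by (simp add: v_def)
    qed
    also have "\<dots> \<le> A\<^sup>2 * (\<Sum>k\<le>2*N. (u ((T ^^ k) x))\<^sup>2)"
      by (rule transference_finite[OF A])
    finally have "ennreal (\<Sum>r<N. (v ((T ^^ r) x))\<^sup>2) \<le> ennreal (A\<^sup>2 * (\<Sum>k\<le>2*N. (u ((T ^^ k) x))\<^sup>2))"
      by (rule ennreal_leI)
    then show "(\<Sum>r<N. ennreal ((v ((T ^^ r) x))\<^sup>2)) \<le> ennreal (A\<^sup>2) * (\<Sum>k\<le>2*N. ennreal ((u ((T ^^ k) x))\<^sup>2))"
      by (simp add: sum_nonneg ennreal_mult)
  qed
  also have "\<dots> = ennreal (A\<^sup>2) * (\<Sum>k\<le>2*N. (\<integral>\<^sup>+x. ennreal ((u ((T ^^ k) x))\<^sup>2) \<partial>M))"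
    by (subst nn_integral_cmult, measurable, subst nn_integral_sum, measurable)
  also have "\<dots> = ennreal (A\<^sup>2) * (ennreal (real (2*N+1)) * (\<integral>\<^sup>+x. ennreal ((u x)\<^sup>2) \<partial>M))"
  proof -
    have "(\<integral>\<^sup>+x. ennreal ((u ((T ^^ k) x))\<^sup>2) \<partial>M) = (\<integral>\<^sup>+x. ennreal ((u x)\<^sup>2) \<partial>M)" for k
      by (rule nn_integral_funpow[of "\<lambda>x. ennreal ((u x)\<^sup>2)"]) measurable
    then show ?thesis by (simp add: ennreal_of_nat_eq_real_of_nat del: of_nat_add of_nat_Suc)
  qed
  also have "\<dots> \<le> ennreal (A\<^sup>2) * (ennreal (real (3*N)) * (\<integral>\<^sup>+x. ennreal ((u x)\<^sup>2) \<partial>M))"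
    using N by (intro mult_left_mono mult_right_mono ennreal_leI) auto
  finally have "ennreal (1 / real N) * (ennreal (real N) * (\<integral>\<^sup>+x. ennreal ((v x)\<^sup>2) \<partial>M)) \<le> 
     ennreal (1 / real N) * (ennreal (A\<^sup>2) * (ennreal (real (3*N)) * (\<integral>\<^sup>+x. ennreal ((u x)\<^sup>2) \<partial>M)))"
    by (rule mult_left_mono) simp
  then have "(\<integral>\<^sup>+x. ennreal ((v x)\<^sup>2) \<partial>M) \<le> ennreal (A\<^sup>2 * 3) * (\<integral>\<^sup>+x. ennreal ((u x)\<^sup>2) \<partial>M)" using N
    by (simp add: mult.assoc[symmetric] ennreal_mult[symmetric])
  then show ?thesis by (simp only: v_def mult.commute[of 3 "A\<^sup>2"])
qed

text \<open>Both sums are normalised by the total weight. The cardinality of the return set replaces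
  it only later, once the two are known to be asymptotically equal.\<close>

definition err :: "nat set \<Rightarrow> (nat \<Rightarrow> real) \<Rightarrow> nat \<Rightarrow> ('a \<Rightarrow> real) \<Rightarrow> 'a \<Rightarrow> real" where
  "err B w N u x = (\<Sum>n=1..N. (of_bool (n \<in> B) - w n) * u ((T ^^ n) x)) / (\<Sum>n=1..N. w n)"

lemma err_measurable [measurable]:
  assumes "u \<in> borel_measurable M" shows "err B w N u \<in> borel_measurable M"
  unfolding err_def[abs_def] 
  by (intro borel_measurable_divide borel_measurable_sum borel_measurable_times borel_measurable_const compose_funpow_measurable assms)

lemma err_add: "err B w N (\<lambda>x. u x + v x) x = err B w N u x + err B w N v x"
  by (simp add: err_def distrib_left sum.distrib add_divide_distrib)

text \<open>At level \<open>l\<close> the function is cut at heights \<open>c l\<close> and \<open>S l\<close>: the low part is harmless by the bound on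
  \<open>L\<^sup>\<infinity>\<close>, the high part is estimated in \<open>L\<^sup>1\<close>, where \<open>S\<close> being large gives decay, and the middle part in \<open>L\<^sup>2\<close>.\<close>

lemma err_Lp:
  assumes [measurable]: "u \<in> borel_measurable M" and u0: "\<And>x. 0 \<le> u x" and p: "1 < p" and N: "1 \<le> N"
    and w: "\<And>n. 0 < w n" and C: "0 < C" and d: "0 < d"
    and fc: "\<And>\<xi>. norm (\<Sum>n=1..N. of_real (of_bool (n \<in> B) - w n) * ee (\<xi> * real n)) \<le> C * real N powr (-d) * (\<Sum>n=1..N. w n)"
  shows "(\<integral>\<^sup>+x. ennreal (\<bar>err B w N u x\<bar> powr p) \<partial>M) \<le> 
    ennreal ((p * (3 * (2 + C)) / (p - 1) + 27 * C\<^sup>2 * (3 * (2 + C)) powr p) * real N powr (- (d * min 1 ((p - 1) / 2)))) * (\<integral>\<^sup>+x. ennreal (u x powr p) \<partial>M)"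
proof -
  define W where "W = (\<Sum>n=1..N. w n)"
  define D where "D = 2 + C"
  \<comment> \<open>\<open>S\<close> shares out the saving: in L^2 the factor
    \<open>N powr (-2 * d)\<close> pays for \<open>S\<^sup>2 = N powr d\<close> and leaves
    \<open>N powr (-d)\<close>, while the L^1 term gains \<open>S powr (-(p - 1))\<close>. The
    constant \<open>c\<close> is such that the low part has error at most
    \<open>l / 3\<close>.\<close>
  define S where "S = real N powr (d / 2)"
  define c where "c = 1 / (3 * D)"
  have W: "0 < W" unfolding W_def using N w by (intro sum_pos) auto
  have D: "2 < D" using C by (simp add: D_def)
  have S1: "1 \<le> S" using N d by (simp add: S_def ge_one_powr_ge_zero)
  have c: "0 < c" "c \<le> 1" using D by (auto simp: c_def)
  define b where "b n = of_bool (n \<in> B) + w n" for n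
  have b0: "0 \<le> b n" for n using w[of n] by (simp add: b_def)
  \<comment> \<open>Frequency 0 of the Fourier hypothesis compares the number of elements of
    \<open>B\<close> with the total weight.\<close>
  have bsum: "(\<Sum>n=1..N. b n) \<le> D * W"
  proof -
    have "\<bar>\<Sum>n=1..N. of_bool (n \<in> B) - w n\<bar> \<le> C * real N powr (-d) * W"
    proof -
      have "norm (complex_of_real (\<Sum>n=1..N. of_bool (n \<in> B) - w n)) \<le> C * real N powr (-d) * W"
        using fc[of 0] by (simp add: W_def)
      then show ?thesis unfolding norm_of_real .
    qed
    also have "\<dots> \<le> C * 1 * W"
      using N d C W powr_mono[of "-d" 0 "real N"] by (intro mult_right_mono mult_left_mono) auto
    finally have "(\<Sum>n=1..N. of_bool (n \<in> B)) - W \<le> C * W" by (simp add: W_def sum_subtractf)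
    then show ?thesis by (simp add: b_def D_def sum.distrib W_def algebra_simps)
  qed
  have err_le: "\<bar>err B w N v x\<bar> \<le> (\<Sum>n=1..N. b n / W * \<bar>v ((T ^^ n) x)\<bar>)" for v x
  proof -
    have "\<bar>\<Sum>n=1..N. (of_bool (n \<in> B) - w n) * v ((T ^^ n) x)\<bar> \<le> (\<Sum>n=1..N. b n * \<bar>v ((T ^^ n) x)\<bar>)"
    proof (rule order_trans[OF sum_abs sum_mono])
      fix n
      have "\<bar>of_bool (n \<in> B) - w n\<bar> \<le> b n" using w[of n] by (cases "n \<in> B") (auto simp: b_def abs_le_iff)
      then show "\<bar>(of_bool (n \<in> B) - w n) * v ((T ^^ n) x)\<bar> \<le> b n * \<bar>v ((T ^^ n) x)\<bar>"
        unfolding abs_mult by (intro mult_right_mono) auto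
    qed
    then have h: "\<bar>\<Sum>n=1..N. (of_bool (n \<in> B) - w n) * v ((T ^^ n) x)\<bar> / W \<le> (\<Sum>n=1..N. b n * \<bar>v ((T ^^ n) x)\<bar>) / W"
      using W by (intro divide_right_mono) auto
    have e1: "err B w N v x = (\<Sum>n=1..N. (of_bool (n \<in> B) - w n) * v ((T ^^ n) x)) / W" by (simp add: err_def W_def)
    have e2: "(\<Sum>n=1..N. b n / W * \<bar>v ((T ^^ n) x)\<bar>) = (\<Sum>n=1..N. b n * \<bar>v ((T ^^ n) x)\<bar>) / W" by (simp add: sum_divide_distrib)
    have "\<bar>W\<bar> = W" using W by simp
    with h show ?thesis unfolding e1 e2 abs_divide by (simp only:)
  qed
  have err_sup: "\<bar>err B w N v x\<bar> \<le> D * K" if "\<And>x. \<bar>v x\<bar> \<le> K" "0 \<le> K" for v x K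
  proof -
    have "\<bar>err B w N v x\<bar> \<le> (\<Sum>n=1..N. b n / W * \<bar>v ((T ^^ n) x)\<bar>)" by (rule err_le)
    also have "\<dots> \<le> (\<Sum>n=1..N. b n / W * K)" using b0 W that by (intro sum_mono mult_left_mono) auto
    also have "\<dots> = (\<Sum>n=1..N. b n) / W * K" by (simp add: sum_divide_distrib sum_distrib_right)
    also have "\<dots> \<le> D * K" using bsum W that by (intro mult_right_mono) (auto simp: field_simps)
    finally show ?thesis .
  qed
  have err_L1: "(\<integral>\<^sup>+x. ennreal \<bar>err B w N v x\<bar> \<partial>M) \<le> ennreal D * (\<integral>\<^sup>+x. ennreal \<bar>v x\<bar> \<partial>M)" 
    if [measurable]: "v \<in> borel_measurable M" for v
  proof -
    have vm: "(\<lambda>x. ennreal \<bar>v ((T ^^ n) x)\<bar>) \<in> borel_measurable M" for n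
      by (rule compose_funpow_measurable[of "\<lambda>x. ennreal \<bar>v x\<bar>"]) measurable
    have "(\<integral>\<^sup>+x. ennreal \<bar>err B w N v x\<bar> \<partial>M) \<le> (\<integral>\<^sup>+x. (\<Sum>n=1..N. ennreal (b n / W) * ennreal \<bar>v ((T ^^ n) x)\<bar>) \<partial>M)"
    proof (rule nn_integral_mono)
      fix x
      have "ennreal \<bar>err B w N v x\<bar> \<le> ennreal (\<Sum>n=1..N. b n / W * \<bar>v ((T ^^ n) x)\<bar>)"
        by (rule ennreal_leI[OF err_le])
      also have "\<dots> = (\<Sum>n=1..N. ennreal (b n / W) * ennreal \<bar>v ((T ^^ n) x)\<bar>)"
        using b0 W by (simp add: ennreal_mult[symmetric])
      finally show "ennreal \<bar>err B w N v x\<bar> \<le> (\<Sum>n=1..N. ennreal (b n / W) * ennreal \<bar>v ((T ^^ n) x)\<bar>)" .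
    qed
    also have "\<dots> = (\<Sum>n=1..N. ennreal (b n / W) * (\<integral>\<^sup>+x. ennreal \<bar>v ((T ^^ n) x)\<bar> \<partial>M))"
      using vm by (subst nn_integral_sum) (auto simp: nn_integral_cmult)
    also have "\<dots> = (\<Sum>n=1..N. ennreal (b n / W) * (\<integral>\<^sup>+x. ennreal \<bar>v x\<bar> \<partial>M))"
      by (intro sum.cong arg_cong2[where f = "(*)"] nn_integral_funpow[of "\<lambda>x. ennreal \<bar>v x\<bar>"]) auto
    also have "\<dots> = ennreal ((\<Sum>n=1..N. b n) / W) * (\<integral>\<^sup>+x. ennreal \<bar>v x\<bar> \<partial>M)"
      using b0 W by (simp add: sum_distrib_right[symmetric] sum_divide_distrib)
    also have "\<dots> \<le> ennreal D * (\<integral>\<^sup>+x. ennreal \<bar>v x\<bar> \<partial>M)"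
      using bsum W by (intro mult_right_mono ennreal_leI) (auto simp: field_simps)
    finally show ?thesis .
  qed
  have err_L2: "(\<integral>\<^sup>+x. ennreal ((err B w N v x)\<^sup>2) \<partial>M) \<le> ennreal (3 * (C * real N powr (-d))\<^sup>2) * (\<integral>\<^sup>+x. ennreal ((v x)\<^sup>2) \<partial>M)"
    if [measurable]: "v \<in> borel_measurable M" for v
  proof -
    have vm [measurable]: "(\<lambda>x. v ((T ^^ n) x)) \<in> borel_measurable M" for n
      by (rule compose_funpow_measurable) measurable
    have "(\<integral>\<^sup>+x. ennreal ((err B w N v x)\<^sup>2) \<partial>M) = (\<integral>\<^sup>+x. ennreal (1 / W\<^sup>2) * ennreal ((\<Sum>n=1..N. (of_bool (n \<in> B) - w n) * v ((T ^^ n) x))\<^sup>2) \<partial>M)"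
      by (intro nn_integral_cong) (simp add: err_def W_def power_divide ennreal_mult[symmetric])
    also have "\<dots> = ennreal (1 / W\<^sup>2) * (\<integral>\<^sup>+x. ennreal ((\<Sum>n=1..N. (of_bool (n \<in> B) - w n) * v ((T ^^ n) x))\<^sup>2) \<partial>M)"
      by (rule nn_integral_cmult) measurable
    also have "\<dots> \<le> ennreal (1 / W\<^sup>2) * (ennreal (3 * (C * real N powr (-d) * W)\<^sup>2) * (\<integral>\<^sup>+x. ennreal ((v x)\<^sup>2) \<partial>M))"
      using fc by (intro mult_left_mono transference_L2 N that) (auto simp: W_def)
    also have "\<dots> = ennreal (3 * (C * real N powr (-d))\<^sup>2) * (\<integral>\<^sup>+x. ennreal ((v x)\<^sup>2) \<partial>M)"
      using W by (simp add: mult.assoc[symmetric] ennreal_mult[symmetric] power_mult_distrib)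
    finally show ?thesis .
  qed
  have "(\<integral>\<^sup>+x. ennreal (\<bar>err B w N u x\<bar> powr p) \<partial>M) \<le> 
     ennreal (p * (3 * D) / ((p - 1) * S powr (p - 1)) + (27 * C\<^sup>2 * real N powr (-d)) / c powr p) * (\<integral>\<^sup>+x. ennreal (u x powr p) \<partial>M)"
  proof (rule Marcinkiewicz[OF _ _ _ u0 p])
    fix l :: real assume l: "0 < l"
    define us where "us x = u x * indicator {x. u x \<le> c * l} x" for x
    define um where "um x = u x * indicator {x. c * l < u x \<and> u x \<le> S * l} x" for x
    define ul where "ul x = u x * indicator {x. S * l < u x} x" for x
    have [measurable]: "us \<in> borel_measurable M" "um \<in> borel_measurable M" "ul \<in> borel_measurable M"
      unfolding us_def um_def ul_def by measurable
    have cS: "c * l \<le> S * l" using c S1 l by (intro mult_right_mono) auto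
    have dec: "u = (\<lambda>x. us x + (um x + ul x))"
      using cS by (auto simp: us_def um_def ul_def indicator_def fun_eq_iff)
    have us: "\<bar>err B w N us x\<bar> \<le> l / 3" for x
    proof -
      have "\<bar>err B w N us x\<bar> \<le> D * (c * l)"
        using c l u0 by (intro err_sup) (auto simp: us_def indicator_def)
      then show ?thesis using D by (simp add: c_def)
    qed
    \<comment> \<open>As the low part accounts for at most \<open>l / 3\<close>, one of the other
      two has error at least \<open>l / 3\<close>. The inequalities are arranged for Markov's
      inequality, in L^1 for the high part and in L^2 for the middle part.\<close>
    have sub: "{x \<in> space M. l < \<bar>err B w N u x\<bar>} \<subseteq> {x \<in> space M. 1 \<le> ennreal (3 / l) * ennreal \<bar>err B w N ul x\<bar>} \<union> 
        {x \<in> space M. 1 \<le> ennreal (9 / l\<^sup>2) * ennreal ((err B w N um x)\<^sup>2)}"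
    proof
      fix x assume x: "x \<in> {x \<in> space M. l < \<bar>err B w N u x\<bar>}"
      have "err B w N u x = err B w N us x + (err B w N um x + err B w N ul x)"
        by (subst dec) (simp add: err_add)
      then have "l / 3 \<le> \<bar>err B w N ul x\<bar> \<or> l / 3 \<le> \<bar>err B w N um x\<bar>" using x us[of x] by auto
      then show "x \<in> {x \<in> space M. 1 \<le> ennreal (3 / l) * ennreal \<bar>err B w N ul x\<bar>} \<union> 
        {x \<in> space M. 1 \<le> ennreal (9 / l\<^sup>2) * ennreal ((err B w N um x)\<^sup>2)}"
      proof
        assume "l / 3 \<le> \<bar>err B w N ul x\<bar>"
        then have "1 \<le> 3 / l * \<bar>err B w N ul x\<bar>" using l by (simp add: field_simps)
        then have "ennreal 1 \<le> ennreal (3 / l * \<bar>err B w N ul x\<bar>)" by (rule ennreal_leI)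
        also have "\<dots> = ennreal (3 / l) * ennreal \<bar>err B w N ul x\<bar>" using l by (intro ennreal_mult) auto
        finally show ?thesis using x by simp
      next
        assume "l / 3 \<le> \<bar>err B w N um x\<bar>"
        then have "(l / 3)\<^sup>2 \<le> (err B w N um x)\<^sup>2" using l by (simp add: abs_le_square_iff[symmetric])
        then have "1 \<le> 9 / l\<^sup>2 * (err B w N um x)\<^sup>2" using l by (simp add: field_simps power2_eq_square)
        then have "ennreal 1 \<le> ennreal (9 / l\<^sup>2 * (err B w N um x)\<^sup>2)" by (rule ennreal_leI)
        also have "\<dots> = ennreal (9 / l\<^sup>2) * ennreal ((err B w N um x)\<^sup>2)" using l by (intro ennreal_mult) auto
        finally show ?thesis using x by simp
      qed
    qed
    have "emeasure M {x \<in> space M. l < \<bar>err B w N u x\<bar>} \<le> emeasure M {x \<in> space M. 1 \<le> ennreal (3 / l) * ennreal \<bar>err B w N ul x\<bar>} + 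
        emeasure M {x \<in> space M. 1 \<le> ennreal (9 / l\<^sup>2) * ennreal ((err B w N um x)\<^sup>2)}"
      by (rule order_trans[OF emeasure_mono[OF sub] emeasure_subadditive]) measurable
    also have "\<dots> \<le> ennreal (3 * D / l) * (\<integral>\<^sup>+x. ennreal (u x) * indicator {x. S * l < u x} x \<partial>M) + 
        ennreal (27 * C\<^sup>2 * real N powr (-d)) * emeasure M {x \<in> space M. c * l < u x}"
    proof (rule add_mono)
      have "emeasure M {x \<in> space M. 1 \<le> ennreal (3 / l) * ennreal \<bar>err B w N ul x\<bar>} \<le> ennreal (3 / l) * (\<integral>\<^sup>+x. ennreal \<bar>err B w N ul x\<bar> * indicator (space M) x \<partial>M)"
        using nn_integral_Markov_inequality[of "\<lambda>x. ennreal \<bar>err B w N ul x\<bar>" "space M" M "ennreal (3 / l)"] by simp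
      also have "(\<integral>\<^sup>+x. ennreal \<bar>err B w N ul x\<bar> * indicator (space M) x \<partial>M) = (\<integral>\<^sup>+x. ennreal \<bar>err B w N ul x\<bar> \<partial>M)"
        by (intro nn_integral_cong) auto
      also have "\<dots> \<le> ennreal D * (\<integral>\<^sup>+x. ennreal \<bar>ul x\<bar> \<partial>M)" by (rule err_L1) measurable
      also have "(\<integral>\<^sup>+x. ennreal \<bar>ul x\<bar> \<partial>M) = (\<integral>\<^sup>+x. ennreal (u x) * indicator {x. S * l < u x} x \<partial>M)"
        using u0 by (intro nn_integral_cong) (auto simp: ul_def indicator_def)
      also have "ennreal (3 / l) * (ennreal D * (\<integral>\<^sup>+x. ennreal (u x) * indicator {x. S * l < u x} x \<partial>M)) = ennreal (3 * D / l) * (\<integral>\<^sup>+x. ennreal (u x) * indicator {x. S * l < u x} x \<partial>M)"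
        using l D by (simp add: mult.assoc[symmetric] ennreal_mult[symmetric])
      finally show "emeasure M {x \<in> space M. 1 \<le> ennreal (3 / l) * ennreal \<bar>err B w N ul x\<bar>} \<le> ennreal (3 * D / l) * (\<integral>\<^sup>+x. ennreal (u x) * indicator {x. S * l < u x} x \<partial>M)"
        by (meson mult_left_mono zero_le)
    next
      have "emeasure M {x \<in> space M. 1 \<le> ennreal (9 / l\<^sup>2) * ennreal ((err B w N um x)\<^sup>2)} \<le> ennreal (9 / l\<^sup>2) * (\<integral>\<^sup>+x. ennreal ((err B w N um x)\<^sup>2) * indicator (space M) x \<partial>M)"
        using nn_integral_Markov_inequality[of "\<lambda>x. ennreal ((err B w N um x)\<^sup>2)" "space M" M "ennreal (9 / l\<^sup>2)"] by simp
      also have "(\<integral>\<^sup>+x. ennreal ((err B w N um x)\<^sup>2) * indicator (space M) x \<partial>M) = (\<integral>\<^sup>+x. ennreal ((err B w N um x)\<^sup>2) \<partial>M)"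
        by (intro nn_integral_cong) auto
      also have "\<dots> \<le> ennreal (3 * (C * real N powr (-d))\<^sup>2) * (\<integral>\<^sup>+x. ennreal ((um x)\<^sup>2) \<partial>M)" by (rule err_L2) measurable
      \<comment> \<open>The middle part is at most \<open>S * l\<close> and vanishes unless
        \<open>u > c * l\<close>, so its square integral is controlled by the distribution function
        alone.\<close>
      also have "(\<integral>\<^sup>+x. ennreal ((um x)\<^sup>2) \<partial>M) \<le> (\<integral>\<^sup>+x. ennreal ((S * l)\<^sup>2) * indicator {x \<in> space M. c * l < u x} x \<partial>M)"
      proof (rule nn_integral_mono)
        fix x assume x: "x \<in> space M"
        show "ennreal ((um x)\<^sup>2) \<le> ennreal ((S * l)\<^sup>2) * indicator {x \<in> space M. c * l < u x} x"
          using u0[of x] x by (auto simp: um_def indicator_def intro!: ennreal_leI power_mono)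
      qed
      also have "\<dots> = ennreal ((S * l)\<^sup>2) * emeasure M {x \<in> space M. c * l < u x}"
        by (rule nn_integral_cmult_indicator) measurable
      finally have "emeasure M {x \<in> space M. 1 \<le> ennreal (9 / l\<^sup>2) * ennreal ((err B w N um x)\<^sup>2)} \<le> 
         ennreal (9 / l\<^sup>2) * (ennreal (3 * (C * real N powr (-d))\<^sup>2) * (ennreal ((S * l)\<^sup>2) * emeasure M {x \<in> space M. c * l < u x}))"
        by (meson mult_left_mono zero_le)
      also have "\<dots> = ennreal (9 / l\<^sup>2 * (3 * (C * real N powr (-d))\<^sup>2 * (S * l)\<^sup>2)) * emeasure M {x \<in> space M. c * l < u x}"
        using l by (simp add: mult.assoc[symmetric] ennreal_mult[symmetric])
      also have "9 / l\<^sup>2 * (3 * (C * real N powr (-d))\<^sup>2 * (S * l)\<^sup>2) = 27 * C\<^sup>2 * ((real N powr (-d))\<^sup>2 * S\<^sup>2)"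
        using l by (simp add: power_mult_distrib field_simps)
      also have "(real N powr (-d))\<^sup>2 * S\<^sup>2 = real N powr (-d)"
        by (simp add: S_def power2_eq_square flip: powr_add)
      finally show "emeasure M {x \<in> space M. 1 \<le> ennreal (9 / l\<^sup>2) * ennreal ((err B w N um x)\<^sup>2)} \<le> ennreal (27 * C\<^sup>2 * real N powr (-d)) * emeasure M {x \<in> space M. c * l < u x}" .
    qed
    finally show "emeasure M {x \<in> space M. l < \<bar>err B w N u x\<bar>} \<le> ennreal (3 * D / l) * (\<integral>\<^sup>+x. ennreal (u x) * indicator {x. S * l < u x} x \<partial>M) + 
        ennreal (27 * C\<^sup>2 * real N powr (-d)) * emeasure M {x \<in> space M. c * l < u x}" .
  qed (use D S1 c in auto)
  also have "\<dots> \<le> ennreal ((p * (3 * D) / (p - 1) + 27 * C\<^sup>2 * (3 * D) powr p) * real N powr (- (d * min 1 ((p - 1) / 2)))) * (\<integral>\<^sup>+x. ennreal (u x powr p) \<partial>M)"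
  proof (intro mult_right_mono ennreal_leI)
    let ?e = "real N powr (- (d * min 1 ((p - 1) / 2)))"
    have m: "d * min 1 ((p - 1) / 2) \<le> d * ((p - 1) / 2)" "d * min 1 ((p - 1) / 2) \<le> d * 1"
      using mult_left_mono[OF min.cobounded2 less_imp_le[OF d], of 1 "(p - 1) / 2"]
        mult_left_mono[OF min.cobounded1 less_imp_le[OF d], of 1 "(p - 1) / 2"] by blast+
    have Sp: "1 / S powr (p - 1) = real N powr (- (d * ((p - 1) / 2)))"
      unfolding S_def powr_powr powr_minus inverse_eq_divide by simp
    have "p * (3 * D) / ((p - 1) * S powr (p - 1)) = p * (3 * D) / (p - 1) * (1 / S powr (p - 1))" by simp
    also have "\<dots> = p * (3 * D) / (p - 1) * real N powr (- (d * ((p - 1) / 2)))" by (simp only: Sp)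
    also have "\<dots> \<le> p * (3 * D) / (p - 1) * ?e"
      using p D N by (intro mult_left_mono powr_mono) (use m in auto)
    finally have 1: "p * (3 * D) / ((p - 1) * S powr (p - 1)) \<le> p * (3 * D) / (p - 1) * ?e" .
    have "(27 * C\<^sup>2 * real N powr (-d)) / c powr p = 27 * C\<^sup>2 * (3 * D) powr p * real N powr (-d)"
      using D by (simp add: c_def powr_divide)
    also have "\<dots> \<le> 27 * C\<^sup>2 * (3 * D) powr p * ?e"
      using N by (intro mult_left_mono powr_mono) (use m in auto)
    finally show "p * (3 * D) / ((p - 1) * S powr (p - 1)) + (27 * C\<^sup>2 * real N powr (-d)) / c powr p \<le> 
       (p * (3 * D) / (p - 1) + 27 * C\<^sup>2 * (3 * D) powr p) * ?e"
      using 1 by (simp add: distrib_right)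
  qed simp
  finally show ?thesis unfolding D_def .
qed

end

section \<open>Averages along a return set\<close>

lemma Abel_sum:
  fixes w y :: "nat \<Rightarrow> real"
  assumes "1 \<le> N"
  shows "(\<Sum>n=1..N. w n * y n) = w N * (\<Sum>i=1..N. y i) + (\<Sum>n=1..<N. (w n - w (Suc n)) * (\<Sum>i=1..n. y i))"
  using assms
proof (induction N rule: dec_induct)
  case (step n)
  then show ?case by (simp add: algebra_simps)
qed simp

text \<open>Summation by parts writes a sum with decreasing weights as a combination of ordinary
  partial sums with nonnegative coefficients. The same coefficients applied to \<open>y = 1\<close>
  give the total weight.\<close>

lemma weighted_mean_le:
  fixes w y :: "nat \<Rightarrow> real"
  assumes w: "antimono w" "\<And>n. 0 < w n" and N: "1 \<le> N" and K: "\<And>n. (\<Sum>i=1..n. y i) / real n \<le> K"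
  shows "(\<Sum>n=1..N. w n * y n) \<le> K * (\<Sum>n=1..N. w n)"
proof -
  have Y: "(\<Sum>i=1..n. y i) \<le> K * (\<Sum>i=1..n. 1)" for n
    using K[of n] by (cases "n = 0") (auto simp: field_simps)
  have "(\<Sum>n=1..N. w n * y n) \<le> w N * (K * (\<Sum>i=1..N. 1)) + (\<Sum>n=1..<N. (w n - w (Suc n)) * (K * (\<Sum>i=1..n. 1)))"
    unfolding Abel_sum[OF N] using w by (intro add_mono mult_left_mono Y sum_mono) (auto simp: antimono_def less_imp_le)
  also have "\<dots> = K * (w N * (\<Sum>i=1..N. 1) + (\<Sum>n=1..<N. (w n - w (Suc n)) * (\<Sum>i=1..n. 1)))"
    by (simp add: algebra_simps sum_distrib_left)
  also have "\<dots> = K * (\<Sum>n=1..N. w n * 1)"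
    by (subst Abel_sum[OF N]) simp
  finally show ?thesis by simp
qed

text \<open>The same decomposition is applied to \<open>y - L\<close>: ordinary means from
  \<open>n0\<close> on are below e/2, and the finitely many earlier partial sums contribute at most
  \<open>K\<close>, negligible once the total weight is large.\<close>

lemma weighted_mean_tendsto:
  fixes w y :: "nat \<Rightarrow> real"
  assumes w: "antimono w" "\<And>n. 0 < w n \<and> w n \<le> 1" and W: "filterlim (\<lambda>N. \<Sum>n=1..N. w n) at_top sequentially"
    and lim: "(\<lambda>n. (\<Sum>i=1..n. y i) / real n) \<longlonglongrightarrow> L"
  shows "(\<lambda>N. (\<Sum>n=1..N. w n * y n) / (\<Sum>n=1..N. w n)) \<longlonglongrightarrow> L"
proof (rule LIMSEQ_I)
  fix e :: real assume e: "0 < e"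
  define z where "z n = y n - L" for n
  have Z: "(\<Sum>i=1..n. z i) = real n * ((\<Sum>i=1..n. y i) / real n - L)" for n
    by (cases "n = 0") (auto simp: z_def sum_subtractf field_simps)
  obtain n0 where n0: "\<And>n. n \<ge> n0 \<Longrightarrow> \<bar>(\<Sum>i=1..n. y i) / real n - L\<bar> < e / 2"
    using LIMSEQ_D[OF lim, of "e/2"] e by auto
  define K where "K = (\<Sum>n<n0. \<bar>\<Sum>i=1..n. z i\<bar>)"
  have K0: "0 \<le> K" unfolding K_def by (intro sum_nonneg) auto
  have Zb: "\<bar>\<Sum>i=1..n. z i\<bar> \<le> e / 2 * real n + (if n < n0 then \<bar>\<Sum>i=1..n. z i\<bar> else 0)" for n
  proof (cases "n < n0")
    case False
    then have "real n * \<bar>(\<Sum>i=1..n. y i) / real n - L\<bar> \<le> real n * (e / 2)"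
      using n0[of n] by (intro mult_left_mono) auto
    moreover have "\<bar>\<Sum>i=1..n. z i\<bar> = real n * \<bar>(\<Sum>i=1..n. y i) / real n - L\<bar>" unfolding Z abs_mult by simp
    ultimately have "\<bar>\<Sum>i=1..n. z i\<bar> \<le> real n * (e / 2)" by (simp only:)
    then show ?thesis using False by (simp add: mult.commute)
  qed (use e in simp)
  obtain N0 where N0: "\<And>N. N \<ge> N0 \<Longrightarrow> (2 * K + 1) / e \<le> (\<Sum>n=1..N. w n)"
    using W unfolding filterlim_at_top eventually_sequentially by blast
  show "\<exists>no. \<forall>N\<ge>no. norm ((\<Sum>n=1..N. w n * y n) / (\<Sum>n=1..N. w n) - L) < e"
  proof (intro exI[of _ "max (max N0 n0) 1"] allI impI)
    fix N assume N: "max (max N0 n0) 1 \<le> N"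
    then have N1: "1 \<le> N" by simp
    define WN where "WN = (\<Sum>n=1..N. w n)"
    have WN: "0 < WN" unfolding WN_def using N1 w by (intro sum_pos) auto
    have WK: "2 * K + 1 \<le> e * WN" using N0[of N] N e by (simp add: WN_def field_simps)
    have mono: "0 \<le> w n - w (Suc n)" for n using w(1) by (auto simp: antimono_def)
    have "\<bar>\<Sum>n=1..N. w n * z n\<bar> \<le> w N * \<bar>\<Sum>i=1..N. z i\<bar> + (\<Sum>n=1..<N. (w n - w (Suc n)) * \<bar>\<Sum>i=1..n. z i\<bar>)"
      unfolding Abel_sum[OF N1] using w(2)[of N] mono
      by (intro order_trans[OF abs_triangle_ineq] add_mono order_trans[OF sum_abs] sum_mono) (auto simp: abs_mult)
    also have "\<dots> \<le> w N * (e / 2 * real N) + (\<Sum>n=1..<N. (w n - w (Suc n)) * (e / 2 * real n) + (if n < n0 then \<bar>\<Sum>i=1..n. z i\<bar> else 0))"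
    proof (intro add_mono sum_mono)
      show "w N * \<bar>\<Sum>i=1..N. z i\<bar> \<le> w N * (e / 2 * real N)"
        using Zb[of N] N w(2)[of N] by (intro mult_left_mono) auto
      fix n
      have "(w n - w (Suc n)) * \<bar>\<Sum>i=1..n. z i\<bar> \<le> (w n - w (Suc n)) * (e / 2 * real n + (if n < n0 then \<bar>\<Sum>i=1..n. z i\<bar> else 0))"
        by (intro mult_left_mono Zb mono)
      also have "\<dots> \<le> (w n - w (Suc n)) * (e / 2 * real n) + 1 * (if n < n0 then \<bar>\<Sum>i=1..n. z i\<bar> else 0)"
        unfolding distrib_left using w(2)[of n] w(2)[of "Suc n"] e by (intro add_mono mult_right_mono) auto
      finally show "(w n - w (Suc n)) * \<bar>\<Sum>i=1..n. z i\<bar> \<le> (w n - w (Suc n)) * (e / 2 * real n) + (if n < n0 then \<bar>\<Sum>i=1..n. z i\<bar> else 0)" by simp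
    qed
    also have "\<dots> = e / 2 * (w N * (\<Sum>i=1..N. 1) + (\<Sum>n=1..<N. (w n - w (Suc n)) * (\<Sum>i=1..n. 1))) + (\<Sum>n=1..<N. (if n < n0 then \<bar>\<Sum>i=1..n. z i\<bar> else 0))"
    proof -
      have r: "(\<Sum>n=1..<N. (w n - w (Suc n)) * (e / 2 * real n)) = e / 2 * (\<Sum>n=1..<N. (w n - w (Suc n)) * (\<Sum>i=1..n. 1))"
        unfolding sum_distrib_left by (intro sum.cong) auto
      show ?thesis unfolding sum.distrib r by (simp add: distrib_left)
    qed
    also have "w N * (\<Sum>i=1..N. 1) + (\<Sum>n=1..<N. (w n - w (Suc n)) * (\<Sum>i=1..n. 1)) = WN"
      using Abel_sum[OF N1, of w "\<lambda>_. 1"] by (simp add: WN_def)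
    also have "(\<Sum>n=1..<N. (if n < n0 then \<bar>\<Sum>i=1..n. z i\<bar> else 0)) \<le> K"
    proof -
      have "(\<Sum>n=1..<N. (if n < n0 then \<bar>\<Sum>i=1..n. z i\<bar> else 0)) = (\<Sum>n\<in>{1..<N} \<inter> {..<n0}. \<bar>\<Sum>i=1..n. z i\<bar>)"
        by (subst sum.inter_restrict) auto
      also have "\<dots> \<le> K" unfolding K_def by (intro sum_mono2) auto
      finally show ?thesis .
    qed
    finally have "\<bar>\<Sum>n=1..N. w n * z n\<bar> \<le> e / 2 * WN + K" by simp
    also have "\<dots> < e * WN" using WK by simp
    finally have "\<bar>\<Sum>n=1..N. w n * z n\<bar> / WN < e" using WN by (simp add: field_simps)
    moreover have "(\<Sum>n=1..N. w n * z n) = (\<Sum>n=1..N. w n * y n) - L * WN"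
      by (simp add: z_def WN_def right_diff_distrib sum_subtractf sum_distrib_left mult.commute)
    moreover have "((\<Sum>n=1..N. w n * y n) - L * WN) / WN = (\<Sum>n=1..N. w n * y n) / WN - L"
      using WN by (simp add: diff_divide_distrib)
    ultimately show "norm ((\<Sum>n=1..N. w n * y n) / (\<Sum>n=1..N. w n) - L) < e"
      using WN unfolding WN_def[symmetric] by (metis abs_divide abs_of_pos real_norm_def)
  qed
qed

text \<open>Terms after \<open>N\<close> are at most \<open>w N\<close>, hence at most the mean of
  the first \<open>N\<close> terms. The lemma bounds the growth of the total weight across a gap
  between sampled indices.\<close>

lemma antimono_partial_sum_ratio:
  fixes w :: "nat \<Rightarrow> real"
  assumes w: "antimono w" "\<And>n. 0 < w n" and NM: "1 \<le> N" "N \<le> M"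
  shows "(\<Sum>n=1..M. w n) * real N \<le> real M * (\<Sum>n=1..N. w n)"
proof -
  have "(\<Sum>n=1..N. w N) \<le> (\<Sum>n=1..N. w n)" using w by (intro sum_mono) (auto simp: antimono_def)
  then have 1: "real N * w N \<le> (\<Sum>n=1..N. w n)" by simp
  have "(\<Sum>n=1..M. w n) = (\<Sum>n=1..N. w n) + (\<Sum>n=Suc N..M. w n)"
    using NM sum.ub_add_nat[of 1 N w "M - N"] by simp
  also have "(\<Sum>n=Suc N..M. w n) \<le> (\<Sum>n=Suc N..M. w N)" using w by (intro sum_mono) (auto simp: antimono_def)
  also have "\<dots> = (real M - real N) * w N" using NM by (simp add: of_nat_diff)
  finally have "(\<Sum>n=1..M. w n) * real N \<le> ((\<Sum>n=1..N. w n) + (real M - real N) * w N) * real N"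
    by (intro mult_right_mono) auto
  also have "\<dots> = (\<Sum>n=1..N. w n) * real N + (real M - real N) * (real N * w N)" by (simp add: algebra_simps)
  also have "\<dots> \<le> (\<Sum>n=1..N. w n) * real N + (real M - real N) * (\<Sum>n=1..N. w n)"
    using NM 1 by (intro add_left_mono mult_left_mono) auto
  finally show ?thesis by (simp add: algebra_simps)
qed

text \<open>For \<open>n\<close> between \<open>N (j n)\<close> and \<open>N (Suc (j n))\<close>,
  monotonicity of numerators and denominators traps \<open>s n / c n\<close> between two sampled
  quotients, up to the ratio of neighbouring denominators, which tends to 1.\<close>

lemma mean_tendsto_from_subsequence:
  fixes s c :: "nat \<Rightarrow> real" and N :: "nat \<Rightarrow> nat"
  assumes s: "mono s" "\<And>n. 0 \<le> s n" and c: "mono c" "\<And>n. 0 \<le> c n"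
    and N: "strict_mono N" and cN: "\<forall>\<^sub>F i in sequentially. 0 < c (N i)"
    and ratio: "(\<lambda>i. c (N (Suc i)) / c (N i)) \<longlonglongrightarrow> 1"
    and lim: "(\<lambda>i. s (N i) / c (N i)) \<longlonglongrightarrow> L"
  shows "(\<lambda>n. s n / c n) \<longlonglongrightarrow> L"
proof -
  define j where "j n = (LEAST i. n < N (Suc i))" for n
  have ex: "\<exists>i. n < N (Suc i)" for n
    using seq_suble[OF N, of "Suc n"] by (intro exI[of _ n]) simp
  have j1: "n < N (Suc (j n))" for n unfolding j_def using ex[of n] by (rule LeastI_ex)
  have j2: "N (j n) \<le> n" if "N 0 \<le> n" for n
  proof (cases "j n")
    case (Suc i)
    have "\<not> n < N (Suc i)" using not_less_Least[of i "\<lambda>i. n < N (Suc i)"] Suc by (simp add: j_def)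
    then show ?thesis using Suc by simp
  qed (use that in simp)
  have jlim: "filterlim j at_top sequentially"
    unfolding filterlim_at_top eventually_sequentially
  proof (intro allI exI impI)
    fix Z n assume n: "N Z \<le> n"
    show "Z \<le> j n"
    proof (rule ccontr)
      assume "\<not> Z \<le> j n"
      then have "N (Suc (j n)) \<le> N Z" using N by (simp add: strict_mono_less_eq)
      then show False using j1[of n] n by simp
    qed
  qed
  have lim': "(\<lambda>i. s (N (Suc i)) / c (N (Suc i))) \<longlonglongrightarrow> L" using lim by (rule LIMSEQ_Suc)
  have lo: "(\<lambda>n. s (N (j n)) / c (N (j n)) / (c (N (Suc (j n))) / c (N (j n)))) \<longlonglongrightarrow> L / 1"
    by (intro tendsto_divide filterlim_compose[OF lim jlim] filterlim_compose[OF ratio jlim]) auto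
  have hi: "(\<lambda>n. s (N (Suc (j n))) / c (N (Suc (j n))) * (c (N (Suc (j n))) / c (N (j n)))) \<longlonglongrightarrow> L * 1"
    by (intro tendsto_mult filterlim_compose[OF lim' jlim] filterlim_compose[OF ratio jlim])
  have cj: "\<forall>\<^sub>F n in sequentially. 0 < c (N (j n))" using jlim cN by (rule eventually_compose_filterlim[rotated])
  have b: "\<forall>\<^sub>F n in sequentially. s (N (j n)) / c (N (j n)) / (c (N (Suc (j n))) / c (N (j n))) \<le> s n / c n \<and>
      s n / c n \<le> s (N (Suc (j n))) / c (N (Suc (j n))) * (c (N (Suc (j n))) / c (N (j n)))"
    using cj eventually_ge_at_top[of "N 0"]
  proof eventually_elim
    case (elim n)
    have o: "N (j n) \<le> n" "n \<le> N (Suc (j n))" using j2[of n] j1[of n] elim by auto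
    have c1: "c (N (j n)) \<le> c n" "c n \<le> c (N (Suc (j n)))" using c(1) o by (auto dest: monoD)
    have s1: "s (N (j n)) \<le> s n" "s n \<le> s (N (Suc (j n)))" using s(1) o by (auto dest: monoD)
    have "s (N (j n)) / c (N (Suc (j n))) \<le> s n / c n" "s n / c n \<le> s (N (Suc (j n))) / c (N (j n))"
      using c1 s1 elim s(2) by (auto intro!: frac_le)
    then show ?case using elim c1 by simp
  qed
  show ?thesis
    by (rule tendsto_sandwich[OF _ _ lo[simplified] hi[simplified]]) (use b in \<open>auto elim: eventually_mono\<close>)
qed

lemma sum_of_bool_card:
  fixes B :: "nat set"
  shows "(\<Sum>n=1..N. of_bool (n \<in> B) :: real) = real (card (B \<inter> {1..N}))"
proof -
  have "(\<Sum>n=1..N. of_bool (n \<in> B) :: real) = (\<Sum>n=1..N. if n \<in> B then 1 else 0)" by (simp add: of_bool_def)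
  also have "\<dots> = (\<Sum>n\<in>{1..N} \<inter> B. 1)" by (rule sum.inter_restrict[symmetric]) simp
  finally show ?thesis by (simp add: Int_commute)
qed

context measure_preserving
begin

text \<open>If the set has no element up to \<open>N\<close>, division by 0 makes the value 0, which
  a nonnegative majorant absorbs.\<close>

definition bavg :: "nat set \<Rightarrow> ('a \<Rightarrow> real) \<Rightarrow> nat \<Rightarrow> 'a \<Rightarrow> real" where
  "bavg B u N x = (\<Sum>n\<in>B \<inter> {1..N}. u ((T ^^ n) x)) / real (card (B \<inter> {1..N}))"

lemma bavg_decomposition:
  fixes w :: "nat \<Rightarrow> real"
  assumes "(\<Sum>n=1..N. w n) \<noteq> 0"
  shows "(\<Sum>n\<in>B \<inter> {1..N}. u ((T ^^ n) x)) = (\<Sum>n=1..N. w n * u ((T ^^ n) x)) + (\<Sum>n=1..N. w n) * err B w N u x"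
proof -
  have "(\<Sum>n\<in>B \<inter> {1..N}. u ((T ^^ n) x)) = (\<Sum>n=1..N. of_bool (n \<in> B) * u ((T ^^ n) x))"
    by (subst Int_commute) (auto simp: sum.inter_restrict intro!: sum.cong)
  also have "\<dots> = (\<Sum>n=1..N. w n * u ((T ^^ n) x)) + (\<Sum>n=1..N. (of_bool (n \<in> B) - w n) * u ((T ^^ n) x))"
    by (simp add: sum.distrib[symmetric] algebra_simps)
  finally show ?thesis using assms by (simp add: err_def)
qed

text \<open>Since \<open>k * d' \<ge> 2\<close>, the p-th powers of the errors along
  \<open>Suc i ^ k\<close> have integrals bounded by a multiple of \<open>Suc i powr (-2)\<close>.
  Their sum is therefore finite almost everywhere: its p-th root dominates all the errors, and its
  terms tend to 0. \<open>K\<close> and \<open>k\<close> do not depend on \<open>u\<close>, as a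
  maximal inequality requires.\<close>

lemma err_lacunary:
  assumes fc: "fourier_close B w" and p: "1 < p"
  shows "\<exists>K k. 1 \<le> k \<and> 0 \<le> K \<and> (\<forall>u. u \<in> borel_measurable M \<longrightarrow> (\<forall>x. 0 \<le> u x) \<longrightarrow> (\<integral>\<^sup>+x. ennreal (u x powr p) \<partial>M) < \<infinity> \<longrightarrow> 
    (\<exists>U. U \<in> borel_measurable M \<and> (\<forall>x. 0 \<le> U x) \<and> (\<integral>\<^sup>+x. ennreal (U x powr p) \<partial>M) \<le> ennreal K * (\<integral>\<^sup>+x. ennreal (u x powr p) \<partial>M) \<and>
      (AE x in M. (\<forall>i. \<bar>err B w (Suc i ^ k) u x\<bar> \<le> U x) \<and> (\<lambda>i. err B w (Suc i ^ k) u x) \<longlonglongrightarrow> 0)))"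
proof -
  have w: "\<And>n. 0 < w n" using fc unfolding fourier_close_def by blast
  obtain C d where C: "0 < C" "0 < d" and bd: "\<And>N \<xi>. 1 \<le> N \<Longrightarrow> norm (\<Sum>n=1..N. of_real (of_bool (n \<in> B) - w n) * ee (\<xi> * real n)) 
        \<le> C * real N powr (-d) * (\<Sum>n=1..N. w n)" using fc unfolding fourier_close_def by blast
  define E where "E = p * (3 * (2 + C)) / (p - 1) + 27 * C\<^sup>2 * (3 * (2 + C)) powr p"
  define d' where "d' = d * min 1 ((p - 1) / 2)"
  define k where "k = nat \<lceil>2 / d'\<rceil>"
  have d': "0 < d'" using C p by (simp add: d'_def)
  then have "0 < 2 / d'" by simp
  then have k: "1 \<le> k" "2 / d' \<le> real k" unfolding k_def by linarith+
  then have kd: "2 \<le> real k * d'" using d' by (simp add: field_simps)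
  have E: "0 \<le> E" using p C by (simp add: E_def)
  define Z where "Z = (\<Sum>i. real (Suc i) powr (-2))"
  have sZ: "summable (\<lambda>i. real (Suc i) powr (-2))"
    using summable_real_powr_iff[of "-2"] by (subst summable_Suc_iff) simp
  have Z0: "0 \<le> Z" unfolding Z_def using sZ by (intro suminf_nonneg) auto
  show ?thesis
  proof (intro exI[of _ "E * Z"] exI[of _ k] conjI allI impI)
    fix u :: "'a \<Rightarrow> real"
    assume u [measurable]: "u \<in> borel_measurable M" and u0: "\<forall>x. 0 \<le> u x" and fin: "(\<integral>\<^sup>+x. ennreal (u x powr p) \<partial>M) < \<infinity>"
    define e where "e i = err B w (Suc i ^ k) u" for i
    have [measurable]: "e i \<in> borel_measurable M" for i unfolding e_def by measurable
    define G where "G x = (\<Sum>i. ennreal (\<bar>e i x\<bar> powr p))" for x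
    have [measurable]: "G \<in> borel_measurable M" unfolding G_def by measurable
    define I where "I = (\<integral>\<^sup>+x. ennreal (u x powr p) \<partial>M)"
    have "(\<integral>\<^sup>+x. G x \<partial>M) = (\<Sum>i. \<integral>\<^sup>+x. ennreal (\<bar>e i x\<bar> powr p) \<partial>M)"
      unfolding G_def by (rule nn_integral_suminf) measurable
    also have "\<dots> \<le> (\<Sum>i. ennreal (E * real (Suc i) powr (-2)) * I)"
    proof (intro suminf_le summableI)
      fix i
      have "(\<integral>\<^sup>+x. ennreal (\<bar>e i x\<bar> powr p) \<partial>M) \<le> ennreal (E * real (Suc i ^ k) powr (- d')) * I"
        unfolding e_def E_def d'_def I_def by (rule err_Lp[OF u u0[rule_format] p _ w C bd]) auto
      also have "\<dots> \<le> ennreal (E * real (Suc i) powr (-2)) * I"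
      proof (intro mult_right_mono ennreal_leI mult_left_mono E)
        have "real (Suc i ^ k) powr (- d') = real (Suc i) powr (real k * - d')"
          by (simp add: powr_realpow[symmetric] powr_powr del: of_nat_Suc)
        also have "\<dots> \<le> real (Suc i) powr (-2)" using kd by (intro powr_mono) auto
        finally show "real (Suc i ^ k) powr (- d') \<le> real (Suc i) powr (-2)" .
      qed simp
      finally show "(\<integral>\<^sup>+x. ennreal (\<bar>e i x\<bar> powr p) \<partial>M) \<le> ennreal (E * real (Suc i) powr (-2)) * I" .
    qed
    also have "\<dots> = (\<Sum>i. ennreal (E * real (Suc i) powr (-2))) * I" by simp
    also have "(\<Sum>i. ennreal (E * real (Suc i) powr (-2))) = ennreal (E * Z)"
      unfolding Z_def using E sZ by (subst suminf_ennreal2) (auto simp: suminf_mult summable_mult)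
    finally have GI: "(\<integral>\<^sup>+x. G x \<partial>M) \<le> ennreal (E * Z) * I" .
    define U where "U x = enn2real (G x) powr (1 / p)" for x
    have [measurable]: "U \<in> borel_measurable M" unfolding U_def by measurable
    have "(\<integral>\<^sup>+x. ennreal (U x powr p) \<partial>M) \<le> (\<integral>\<^sup>+x. G x \<partial>M)"
    proof (rule nn_integral_mono)
      fix x
      show "ennreal (U x powr p) \<le> G x"
        using p by (cases "G x") (auto simp: U_def powr_powr)
    qed
    with GI have UI: "(\<integral>\<^sup>+x. ennreal (U x powr p) \<partial>M) \<le> ennreal (E * Z) * I" by (rule order_trans[rotated])
    have "(\<integral>\<^sup>+x. G x \<partial>M) \<noteq> \<infinity>"
    proof -
      have "ennreal (E * Z) * I < \<infinity>" using fin unfolding I_def[symmetric] by (simp add: ennreal_mult_less_top)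
      with GI show ?thesis by (auto simp: top_unique)
    qed
    then have "AE x in M. G x \<noteq> \<infinity>" by (intro nn_integral_PInf_AE) auto
    then have "AE x in M. (\<forall>i. \<bar>e i x\<bar> \<le> U x) \<and> (\<lambda>i. e i x) \<longlonglongrightarrow> 0"
    proof eventually_elim
      case (elim x)
      have sm: "summable (\<lambda>i. \<bar>e i x\<bar> powr p)"
        using elim unfolding G_def by (intro summable_suminf_not_top) auto
      have Gx: "enn2real (G x) = (\<Sum>i. \<bar>e i x\<bar> powr p)"
        unfolding G_def using sm suminf_nonneg[OF sm] by (subst suminf_ennreal2) auto
      have root: "(\<bar>e i x\<bar> powr p) powr (1 / p) = \<bar>e i x\<bar>" for i using p by (simp add: powr_powr)
      have "\<bar>e i x\<bar> \<le> U x" for i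
      proof -
        have "\<bar>e i x\<bar> powr p \<le> enn2real (G x)"
          unfolding Gx using sum_le_suminf[OF sm, of "{i}"] by simp
        then have "(\<bar>e i x\<bar> powr p) powr (1 / p) \<le> U x" unfolding U_def using p by (intro powr_mono2) auto
        then show ?thesis by (simp add: root)
      qed
      moreover have "(\<lambda>i. e i x) \<longlonglongrightarrow> 0"
      proof -
        have "(\<lambda>i. (\<bar>e i x\<bar> powr p) powr (1 / p)) \<longlonglongrightarrow> 0"
          by (rule tendsto_zero_powrI[OF summable_LIMSEQ_zero[OF sm] tendsto_const]) (use p in auto)
        then show ?thesis unfolding root by (simp add: tendsto_rabs_zero_iff)
      qed
      ultimately show ?case by blast
    qed
    then show "\<exists>U. U \<in> borel_measurable M \<and> (\<forall>x. 0 \<le> U x) \<and> (\<integral>\<^sup>+x. ennreal (U x powr p) \<partial>M) \<le> ennreal (E * Z) * (\<integral>\<^sup>+x. ennreal (u x powr p) \<partial>M) \<and>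
      (AE x in M. (\<forall>i. \<bar>err B w (Suc i ^ k) u x\<bar> \<le> U x) \<and> (\<lambda>i. err B w (Suc i ^ k) u x) \<longlonglongrightarrow> 0)"
      using UI unfolding e_def I_def by (intro exI[of _ U]) (auto simp: U_def)
  qed (use k E Z0 in auto)
qed

end

lemma powr_add_le:
  fixes a b p :: real
  assumes "0 \<le> a" "0 \<le> b" "0 < p" shows "(a + b) powr p \<le> 2 powr p * (a powr p + b powr p)"
proof -
  have "(a + b) powr p \<le> (2 * max a b) powr p" using assms by (intro powr_mono2) auto
  also have "\<dots> = 2 powr p * max a b powr p" using assms by (simp add: powr_mult)
  also have "\<dots> \<le> 2 powr p * (a powr p + b powr p)" by (intro mult_left_mono) (auto simp: max_def)
  finally show ?thesis .
qed

lemma nn_integral_powr_add_le: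
  fixes f g :: "'a \<Rightarrow> real"
  assumes [measurable]: "f \<in> borel_measurable M" "g \<in> borel_measurable M" and nn: "\<And>x. 0 \<le> f x" "\<And>x. 0 \<le> g x" and p: "0 < p" and c: "0 \<le> c"
  shows "(\<integral>\<^sup>+x. ennreal ((c * (f x + g x)) powr p) \<partial>M) \<le> ennreal ((2 * c) powr p) * ((\<integral>\<^sup>+x. ennreal (f x powr p) \<partial>M) + (\<integral>\<^sup>+x. ennreal (g x powr p) \<partial>M))"
proof -
  have "(\<integral>\<^sup>+x. ennreal ((c * (f x + g x)) powr p) \<partial>M) \<le> (\<integral>\<^sup>+x. ennreal ((2 * c) powr p) * (ennreal (f x powr p) + ennreal (g x powr p)) \<partial>M)"
  proof (rule nn_integral_mono)
    fix x
    have "(c * (f x + g x)) powr p = c powr p * (f x + g x) powr p" using c nn[of x] by (simp add: powr_mult)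
    also have "\<dots> \<le> c powr p * (2 powr p * (f x powr p + g x powr p))" using nn p by (intro mult_left_mono powr_add_le) auto
    also have "\<dots> = (2 * c) powr p * (f x powr p + g x powr p)" using c by (simp add: powr_mult)
    finally have "ennreal ((c * (f x + g x)) powr p) \<le> ennreal ((2 * c) powr p * (f x powr p + g x powr p))" by (rule ennreal_leI)
    also have "\<dots> = ennreal ((2 * c) powr p) * (ennreal (f x powr p) + ennreal (g x powr p))" by (simp add: ennreal_mult ennreal_plus)
    finally show "ennreal ((c * (f x + g x)) powr p) \<le> ennreal ((2 * c) powr p) * (ennreal (f x powr p) + ennreal (g x powr p))" .
  qed
  also have "\<dots> = ennreal ((2 * c) powr p) * ((\<integral>\<^sup>+x. ennreal (f x powr p) \<partial>M) + (\<integral>\<^sup>+x. ennreal (g x powr p) \<partial>M))"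
    by (subst nn_integral_cmult, measurable, subst nn_integral_add, measurable)
  finally show ?thesis .
qed

context
  fixes B :: "nat set" and w :: "nat \<Rightarrow> real"
  assumes fc: "fourier_close B w"
begin

lemma fourier_close_weights: "antimono w" "0 < w n" "w n \<le> 1"
  using fc unfolding fourier_close_def by blast+

lemma fourier_close_sum_pos: "1 \<le> N \<Longrightarrow> 0 < (\<Sum>n=1..N. w n)"
  using fourier_close_weights by (intro sum_pos) auto

lemma fourier_close_sum_at_top: "filterlim (\<lambda>N. \<Sum>n=1..N. w n) at_top sequentially"
proof -
  obtain c where c: "0 < c" "\<And>N. 1 \<le> N \<Longrightarrow> c * real N powr (4/5) \<le> (\<Sum>n=1..N. w n)"
    using fc unfolding fourier_close_def by blast
  have "filterlim (\<lambda>N. c * real N powr (4/5)) at_top sequentially" using c(1) by real_asymp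
  then show ?thesis
    by (rule filterlim_at_top_mono) (use c(2) in \<open>auto simp: eventually_sequentially intro!: exI[of _ 1]\<close>)
qed

text \<open>This is the Fourier bound at frequency 0, divided by the total weight.\<close>

lemma fourier_close_card: "(\<lambda>N. real (card (B \<inter> {1..N})) / (\<Sum>n=1..N. w n)) \<longlonglongrightarrow> 1"
proof -
  obtain C d where C: "0 < C" "0 < d" and bd: "\<And>N \<xi>. 1 \<le> N \<Longrightarrow> norm (\<Sum>n=1..N. of_real (of_bool (n \<in> B) - w n) * ee (\<xi> * real n)) 
        \<le> C * real N powr (-d) * (\<Sum>n=1..N. w n)" using fc unfolding fourier_close_def by blast
  have ev: "\<forall>\<^sub>F N in sequentially. norm (real (card (B \<inter> {1..N})) / (\<Sum>n=1..N. w n) - 1) \<le> C * real N powr (-d)"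
    using eventually_ge_at_top[of 1]
  proof eventually_elim
    case (elim N)
    define W where "W = (\<Sum>n=1..N. w n)"
    have W: "0 < W" unfolding W_def by (rule fourier_close_sum_pos[OF elim])
    have "norm (complex_of_real (\<Sum>n=1..N. of_bool (n \<in> B) - w n)) \<le> C * real N powr (-d) * W"
      using bd[OF elim, of 0] by (simp add: W_def)
    then have "\<bar>\<Sum>n=1..N. of_bool (n \<in> B) - w n\<bar> \<le> C * real N powr (-d) * W" unfolding norm_of_real .
    moreover have "(\<Sum>n=1..N. of_bool (n \<in> B) - w n) = (real (card (B \<inter> {1..N})) / W - 1) * W"
      unfolding sum_subtractf sum_of_bool_card W_def[symmetric] using W by (simp add: field_simps)
    ultimately have "\<bar>real (card (B \<inter> {1..N})) / W - 1\<bar> * W \<le> C * real N powr (-d) * W" using W by (simp add: abs_mult)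
    then show ?case using W by (simp add: W_def)
  qed
  have "(\<lambda>N. C * real N powr (-d)) \<longlonglongrightarrow> 0" using C by real_asymp
  from Lim_null_comparison[OF ev this] have "(\<lambda>N. real (card (B \<inter> {1..N})) / (\<Sum>n=1..N. w n) - 1) \<longlonglongrightarrow> 0" .
  then show ?thesis by (simp add: LIM_zero_iff)
qed

end

context measure_preserving
begin

text \<open>For nonnegative \<open>u\<close> the range may be enlarged to the next
  \<open>Suc i ^ k\<close>. There the sum splits into a weighted mean, dominated by the Birkhoff
  maximal function, and an error, dominated by the supremum from \<open>err_lacunary\<close>. The
  enlargement costs a bounded factor, because that index is at most
  \<open>2 ^ k * N\<close>.\<close>

lemma bavg_maximal:
  assumes fc: "fourier_close B w" and p: "1 < p"
  shows "\<exists>K\<ge>0. \<forall>u. u \<in> borel_measurable M \<longrightarrow> (\<forall>x. 0 \<le> u x) \<longrightarrow> (\<integral>\<^sup>+x. ennreal (u x powr p) \<partial>M) < \<infinity> \<longrightarrow> 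
    (\<exists>U. U \<in> borel_measurable M \<and> (\<forall>x. 0 \<le> U x) \<and> (\<integral>\<^sup>+x. ennreal (U x powr p) \<partial>M) \<le> ennreal K * (\<integral>\<^sup>+x. ennreal (u x powr p) \<partial>M) \<and>
      (AE x in M. \<forall>N. bavg B u N x \<le> U x))"
proof -
  note w = fourier_close_weights[OF fc]
  obtain K2 k where k: "1 \<le> k" "0 \<le> K2" and lac: "\<And>u. u \<in> borel_measurable M \<Longrightarrow> (\<forall>x. 0 \<le> u x) \<Longrightarrow> (\<integral>\<^sup>+x. ennreal (u x powr p) \<partial>M) < \<infinity> \<Longrightarrow>
    (\<exists>U. U \<in> borel_measurable M \<and> (\<forall>x. 0 \<le> U x) \<and> (\<integral>\<^sup>+x. ennreal (U x powr p) \<partial>M) \<le> ennreal K2 * (\<integral>\<^sup>+x. ennreal (u x powr p) \<partial>M) \<and>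
      (AE x in M. (\<forall>i. \<bar>err B w (Suc i ^ k) u x\<bar> \<le> U x) \<and> (\<lambda>i. err B w (Suc i ^ k) u x) \<longlonglongrightarrow> 0))"
    using err_lacunary[OF fc p] by blast
  define K1 where "K1 = p * 2 / ((p - 1) * (1/2) powr (p - 1))"
  have K1: "0 \<le> K1" using p by (simp add: K1_def)
  have "\<forall>\<^sub>F N in sequentially. 1/2 < real (card (B \<inter> {1..N})) / (\<Sum>n=1..N. w n)"
    using fourier_close_card[OF fc] by (rule order_tendstoD) simp
  then obtain N0 where N0: "\<And>N. N0 \<le> N \<Longrightarrow> 1/2 < real (card (B \<inter> {1..N})) / (\<Sum>n=1..N. w n)"
    unfolding eventually_sequentially by blast
  \<comment> \<open>For small \<open>N\<close> the count may be far from the total weight, but if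
    nonzero it is at least 1, while the total weight is at most \<open>N0\<close>.\<close>
  have Wc: "(\<Sum>n=1..N. w n) \<le> (2 + real N0) * real (card (B \<inter> {1..N}))" if "0 < card (B \<inter> {1..N})" for N
  proof (cases "N0 \<le> N")
    case True
    have N1: "1 \<le> N" using that by (cases N) auto
    then have "(\<Sum>n=1..N. w n) \<le> 2 * real (card (B \<inter> {1..N}))" 
      using N0[OF True] fourier_close_sum_pos[OF fc N1] by (simp add: field_simps)
    also have "\<dots> \<le> (2 + real N0) * real (card (B \<inter> {1..N}))" by (intro mult_right_mono) auto
    finally show ?thesis .
  next
    case False
    have "(\<Sum>n=1..N. w n) \<le> (\<Sum>n=1..N. 1)" using w by (intro sum_mono) auto
    also have "\<dots> \<le> (2 + real N0) * 1" using False by simp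
    also have "\<dots> \<le> (2 + real N0) * real (card (B \<inter> {1..N}))" using that by (intro mult_left_mono) auto
    finally show ?thesis .
  qed
  define c where "c = 2 ^ k * (2 + real N0)"
  have c0: "0 \<le> c" by (simp add: c_def)
  have cover: "\<exists>i. N \<le> Suc i ^ k \<and> Suc i ^ k \<le> 2 ^ k * N" if N: "1 \<le> N" for N
  proof -
    define i where "i = (LEAST i. N \<le> Suc i ^ k)"
    have "N \<le> Suc N ^ k" using k self_le_power[of "Suc N" k] by simp
    then have i: "N \<le> Suc i ^ k" unfolding i_def by (rule LeastI)
    have "Suc i ^ k \<le> 2 ^ k * N"
    proof (cases i)
      case 0
      then show ?thesis using N by simp
    next
      case (Suc i')
      have "\<not> N \<le> Suc i' ^ k" using not_less_Least[of i' "\<lambda>i. N \<le> Suc i ^ k"] Suc by (simp add: i_def)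
      then have "i ^ k \<le> N" using Suc by simp
      moreover have "Suc i ^ k \<le> (2 * i) ^ k" using Suc by (intro power_mono) auto
      then have "Suc i ^ k \<le> 2 ^ k * i ^ k" by (simp add: power_mult_distrib)
      ultimately show ?thesis by (meson le_trans mult_le_mono2)
    qed
    with i show ?thesis by blast
  qed
  show ?thesis
  proof (intro exI[of _ "(2 * c) powr p * (K1 + K2)"] conjI allI impI)
    show "0 \<le> (2 * c) powr p * (K1 + K2)" using K1 k by simp
    fix u :: "'a \<Rightarrow> real"
    assume u [measurable]: "u \<in> borel_measurable M" and u0: "\<forall>x. 0 \<le> u x" and fin: "(\<integral>\<^sup>+x. ennreal (u x powr p) \<partial>M) < \<infinity>"
    define I where "I = (\<integral>\<^sup>+x. ennreal (u x powr p) \<partial>M)"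
    obtain U1 where U1 [measurable]: "U1 \<in> borel_measurable M" and U1': "\<forall>x. 0 \<le> U1 x" "AE x in M. \<forall>n. avg u n x \<le> U1 x" "(\<integral>\<^sup>+x. ennreal (U1 x powr p) \<partial>M) \<le> ennreal K1 * I"
      using maximal_Lp[OF u u0[rule_format] p fin] unfolding K1_def I_def by blast
    obtain U2 where U2 [measurable]: "U2 \<in> borel_measurable M" and U2': "\<forall>x. 0 \<le> U2 x" "(\<integral>\<^sup>+x. ennreal (U2 x powr p) \<partial>M) \<le> ennreal K2 * I"
      "AE x in M. (\<forall>i. \<bar>err B w (Suc i ^ k) u x\<bar> \<le> U2 x) \<and> (\<lambda>i. err B w (Suc i ^ k) u x) \<longlonglongrightarrow> 0"
      using lac[OF u u0 fin] unfolding I_def by blast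
    define U where "U x = c * (U1 x + U2 x)" for x
    have "(\<integral>\<^sup>+x. ennreal (U x powr p) \<partial>M) \<le> ennreal ((2 * c) powr p) * ((\<integral>\<^sup>+x. ennreal (U1 x powr p) \<partial>M) + (\<integral>\<^sup>+x. ennreal (U2 x powr p) \<partial>M))"
      unfolding U_def using U1' U2' p c0 by (intro nn_integral_powr_add_le) auto
    also have "\<dots> \<le> ennreal ((2 * c) powr p) * (ennreal K1 * I + ennreal K2 * I)"
      using U1' U2' by (intro mult_left_mono add_mono) auto
    also have "\<dots> = ennreal ((2 * c) powr p * (K1 + K2)) * I"
      using K1 k by (simp add: ennreal_mult ennreal_plus distrib_right distrib_left mult.assoc)
    finally have UI: "(\<integral>\<^sup>+x. ennreal (U x powr p) \<partial>M) \<le> ennreal ((2 * c) powr p * (K1 + K2)) * I" .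
    have "AE x in M. \<forall>N. bavg B u N x \<le> U x"
      using U1'(2) U2'(3)
    proof eventually_elim
      case (elim x)
      have U0: "0 \<le> U1 x + U2 x" using U1' U2' by simp
      show ?case
      proof
        fix N
        show "bavg B u N x \<le> U x"
        proof (cases "card (B \<inter> {1..N}) = 0")
          case True
          then show ?thesis using U0 c0 by (simp add: bavg_def U_def)
        next
          case False
          then have N: "1 \<le> N" and cp: "0 < card (B \<inter> {1..N})" by (cases N; auto)+
          obtain i where i: "N \<le> Suc i ^ k" "Suc i ^ k \<le> 2 ^ k * N" using cover[OF N] by blast
          define M' where "M' = Suc i ^ k"
          have M': "1 \<le> M'" "N \<le> M'" "real M' \<le> 2 ^ k * real N"
          proof -
            show "1 \<le> M'" "N \<le> M'" using i N by (auto simp: M'_def)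
            have "real M' \<le> real (2 ^ k * N)" using i(2) unfolding M'_def by (rule of_nat_mono)
            then show "real M' \<le> 2 ^ k * real N" by simp
          qed
          have Wp: "0 < (\<Sum>n=1..M'. w n)" by (rule fourier_close_sum_pos[OF fc M'(1)])
          have "(\<Sum>n\<in>B \<inter> {1..N}. u ((T ^^ n) x)) \<le> (\<Sum>n\<in>B \<inter> {1..M'}. u ((T ^^ n) x))"
            using M' u0 by (intro sum_mono2) auto
          also have "\<dots> = (\<Sum>n=1..M'. w n * u ((T ^^ n) x)) + (\<Sum>n=1..M'. w n) * err B w M' u x"
            using Wp by (intro bavg_decomposition) auto
          also have "\<dots> \<le> U1 x * (\<Sum>n=1..M'. w n) + (\<Sum>n=1..M'. w n) * U2 x"
          proof (intro add_mono mult_left_mono)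
            show "(\<Sum>n=1..M'. w n * u ((T ^^ n) x)) \<le> U1 x * (\<Sum>n=1..M'. w n)"
              using elim(1) w M' by (intro weighted_mean_le) (auto simp: avg_def)
            show "err B w M' u x \<le> U2 x" using elim(2) unfolding M'_def by (meson abs_le_D1)
          qed (use Wp in auto)
          also have "\<dots> = (\<Sum>n=1..M'. w n) * (U1 x + U2 x)" by (simp add: algebra_simps)
          also have "\<dots> \<le> (c * real (card (B \<inter> {1..N}))) * (U1 x + U2 x)"
          proof (rule mult_right_mono[OF _ U0])
            have "(\<Sum>n=1..M'. w n) * real N \<le> real M' * (\<Sum>n=1..N. w n)"
              using w N M' by (intro antimono_partial_sum_ratio) auto
            also have "\<dots> \<le> (2 ^ k * real N) * ((2 + real N0) * real (card (B \<inter> {1..N})))"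
              using M' Wc[OF cp] fourier_close_sum_pos[OF fc N] by (intro mult_mono) auto
            also have "\<dots> = (c * real (card (B \<inter> {1..N}))) * real N" by (simp add: c_def)
            finally show "(\<Sum>n=1..M'. w n) \<le> c * real (card (B \<inter> {1..N}))" using N by simp
          qed
          finally show ?thesis using cp by (simp add: bavg_def U_def field_simps)
        qed
      qed
    qed
    then show "\<exists>U. U \<in> borel_measurable M \<and> (\<forall>x. 0 \<le> U x) \<and> (\<integral>\<^sup>+x. ennreal (U x powr p) \<partial>M) \<le> ennreal ((2 * c) powr p * (K1 + K2)) * (\<integral>\<^sup>+x. ennreal (u x powr p) \<partial>M) \<and>
      (AE x in M. \<forall>N. bavg B u N x \<le> U x)"
      using UI U1' U2' c0 unfolding I_def by (intro exI[of _ U]) (auto simp: U_def[abs_def])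
  qed
qed

text \<open>Along \<open>N i = Suc i ^ k\<close> the errors vanish and the weighted means converge
  with the Birkhoff averages. It remains to exchange total weight for cardinality and to fill the
  gaps; the latter needs neighbouring counts to have ratio tending to 1, which they inherit from the
  total weights, whose ratio lies between 1 and \<open>((i + 2) / (i + 1)) ^ k\<close>.\<close>

lemma bavg_convergent:
  assumes fc: "fourier_close B w" and p: "1 < p"
    and u [measurable]: "u \<in> borel_measurable M" and u0: "\<And>x. 0 \<le> u x" and fin: "(\<integral>\<^sup>+x. ennreal (u x powr p) \<partial>M) < \<infinity>"
  shows "AE x in M. convergent (\<lambda>N. bavg B u N x)"
proof -
  note w = fourier_close_weights[OF fc]
  obtain k U where k: "1 \<le> k" and ae: "AE x in M. (\<forall>i. \<bar>err B w (Suc i ^ k) u x\<bar> \<le> U x) \<and> (\<lambda>i. err B w (Suc i ^ k) u x) \<longlonglongrightarrow> 0"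
    using err_lacunary[OF fc p] u u0 fin by meson
  define N where "N i = Suc i ^ k" for i
  have Nm: "strict_mono N" unfolding N_def using k by (intro strict_monoI power_strict_mono) auto
  have N1: "1 \<le> N i" for i by (simp add: N_def)
  define W where "W n = (\<Sum>j=1..n. w j)" for n
  define c where "c n = real (card (B \<inter> {1..n}))" for n
  have cW: "(\<lambda>i. c (N i) / W (N i)) \<longlonglongrightarrow> 1"
    using LIMSEQ_subseq_LIMSEQ[OF fourier_close_card[OF fc] Nm] by (simp add: o_def c_def W_def)
  have Wp: "0 < W (N i)" for i unfolding W_def by (rule fourier_close_sum_pos[OF fc N1])
  have Wn [simp]: "W (N i) \<noteq> 0" for i using Wp[of i] by simp
  have cp: "\<forall>\<^sub>F i in sequentially. 0 < c (N i)"
  proof -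
    have "\<forall>\<^sub>F i in sequentially. 0 < c (N i) / W (N i)" using cW by (rule order_tendstoD) simp
    then show ?thesis by eventually_elim (use Wp in \<open>auto simp: zero_less_divide_iff dest: less_asym\<close>)
  qed
  have WW: "(\<lambda>i. W (N (Suc i)) / W (N i)) \<longlonglongrightarrow> 1"
  proof (rule tendsto_sandwich[where f = "\<lambda>_. 1" and h = "\<lambda>i. (real (Suc (Suc i)) / real (Suc i)) ^ k"])
    show "\<forall>\<^sub>F i in sequentially. 1 \<le> W (N (Suc i)) / W (N i)"
    proof (rule always_eventually, rule allI)
      fix i
      have "N i \<le> N (Suc i)" using Nm by (simp add: strict_mono_less_eq)
      then have "W (N i) \<le> W (N (Suc i))" unfolding W_def using w by (intro sum_mono2) (auto intro: less_imp_le)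
      then show "1 \<le> W (N (Suc i)) / W (N i)" using Wp[of i] by simp
    qed
    show "\<forall>\<^sub>F i in sequentially. W (N (Suc i)) / W (N i) \<le> (real (Suc (Suc i)) / real (Suc i)) ^ k"
    proof (rule always_eventually, rule allI)
      fix i
      have "N i \<le> N (Suc i)" using Nm by (simp add: strict_mono_less_eq)
      then have "W (N (Suc i)) * real (N i) \<le> real (N (Suc i)) * W (N i)"
        unfolding W_def using w N1 by (intro antimono_partial_sum_ratio) auto
      then have "W (N (Suc i)) / W (N i) \<le> real (N (Suc i)) / real (N i)"
        using Wp[of i] N1[of i] by (simp add: field_simps)
      also have "\<dots> = (real (Suc (Suc i)) / real (Suc i)) ^ k" by (simp add: N_def power_divide)
      finally show "W (N (Suc i)) / W (N i) \<le> (real (Suc (Suc i)) / real (Suc i)) ^ k" .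
    qed
    have "(\<lambda>i. real (Suc (Suc i)) / real (Suc i)) \<longlonglongrightarrow> 1" by real_asymp
    then have "(\<lambda>i. (real (Suc (Suc i)) / real (Suc i)) ^ k) \<longlonglongrightarrow> 1 ^ k" by (rule tendsto_power)
    then show "(\<lambda>i. (real (Suc (Suc i)) / real (Suc i)) ^ k) \<longlonglongrightarrow> 1" by simp
  qed simp
  have ratio: "(\<lambda>i. c (N (Suc i)) / c (N i)) \<longlonglongrightarrow> 1"
  proof -
    have "(\<lambda>i. (c (N (Suc i)) / W (N (Suc i))) * (W (N (Suc i)) / W (N i)) / (c (N i) / W (N i))) \<longlonglongrightarrow> 1 * 1 / 1"
      by (intro tendsto_divide tendsto_mult WW cW LIMSEQ_Suc[OF cW]) simp
    moreover have "(c (N (Suc i)) / W (N (Suc i))) * (W (N (Suc i)) / W (N i)) / (c (N i) / W (N i)) = c (N (Suc i)) / c (N i)" for i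
      using Wp[of i] Wp[of "Suc i"] by simp
    ultimately show ?thesis by simp
  qed
  have "AE x in M. convergent (\<lambda>n. avg u n x)" using p by (intro Birkhoff_Lp[OF u u0 _ fin]) simp
  then show ?thesis using ae
  proof eventually_elim
    case (elim x)
    then obtain L where L: "(\<lambda>n. avg u n x) \<longlonglongrightarrow> L" by (auto simp: convergent_def)
    define s where "s n = (\<Sum>j\<in>B \<inter> {1..n}. u ((T ^^ j) x))" for n
    have "(\<lambda>n. (\<Sum>j=1..n. w j * u ((T ^^ j) x)) / W n) \<longlonglongrightarrow> L"
      unfolding W_def using w L by (intro weighted_mean_tendsto fourier_close_sum_at_top[OF fc]) (auto simp: avg_def)
    from LIMSEQ_subseq_LIMSEQ[OF this Nm] have wl: "(\<lambda>i. (\<Sum>j=1..N i. w j * u ((T ^^ j) x)) / W (N i)) \<longlonglongrightarrow> L"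
      by (simp add: o_def)
    have a1: "(\<lambda>i. ((\<Sum>j=1..N i. w j * u ((T ^^ j) x)) / W (N i) + err B w (N i) u x) / (c (N i) / W (N i))) \<longlonglongrightarrow> (L + 0) / 1"
      using elim by (intro tendsto_divide tendsto_add wl cW) (auto simp: N_def)
    have a2: "((\<Sum>j=1..N i. w j * u ((T ^^ j) x)) / W (N i) + err B w (N i) u x) / (c (N i) / W (N i)) = s (N i) / c (N i)" for i
    proof -
      have "s (N i) = (\<Sum>j=1..N i. w j * u ((T ^^ j) x)) + W (N i) * err B w (N i) u x"
        unfolding s_def W_def using Wp[of i] by (intro bavg_decomposition) (simp add: W_def)
      then have "(\<Sum>j=1..N i. w j * u ((T ^^ j) x)) / W (N i) + err B w (N i) u x = s (N i) / W (N i)"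
        using Wp[of i] by (simp add: field_simps)
      then show ?thesis using Wp[of i] by simp
    qed
    have lim: "(\<lambda>i. s (N i) / c (N i)) \<longlonglongrightarrow> L" using a1 unfolding a2 by simp
    have "(\<lambda>n. s n / c n) \<longlonglongrightarrow> L"
    proof (rule mean_tendsto_from_subsequence[OF _ _ _ _ Nm cp ratio lim])
      show "mono s" unfolding s_def mono_def using u0 by (auto intro!: sum_mono2)
      show "0 \<le> s n" for n unfolding s_def using u0 by (intro sum_nonneg) auto
      show "mono c" unfolding c_def mono_def by (auto intro!: card_mono)
      show "0 \<le> c n" for n by (simp add: c_def)
    qed
    then show ?case unfolding convergent_def s_def c_def bavg_def by blast
  qed
qed

end

section \<open>Several transformations\<close>

lemma multi_pow_cong:
  "(\<And>i. i \<in> {1..k} \<Longrightarrow> l i = l' i) \<Longrightarrow> multi_pow S k l = multi_pow S k l'"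
proof (induction k)
  case (Suc k)
  have "multi_pow S k l = multi_pow S k l'" using Suc.prems by (intro Suc.IH) auto
  moreover have "l (Suc k) = l' (Suc k)" using Suc.prems by simp
  ultimately show ?case by (simp only: multi_pow.simps)
qed simp

text \<open>Lets a supremum over all multi-indices run over the extensional ones only. These are
  countably many, so the supremum is measurable.\<close>

lemma ergodic_avg_restrict: "ergodic_avg B S k f (restrict N {1..k}) = ergodic_avg B S k f N"
proof -
  have 1: "(\<Pi>\<^sub>E i\<in>{1..k}. B i \<inter> {1..restrict N {1..k} i}) = (\<Pi>\<^sub>E i\<in>{1..k}. B i \<inter> {1..N i})"
    by (intro PiE_cong) auto
  have 2: "(\<Prod>i\<in>{1..k}. card (B i \<inter> {1..restrict N {1..k} i})) = (\<Prod>i\<in>{1..k}. card (B i \<inter> {1..N i}))"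
    by (intro prod.cong) auto
  show ?thesis unfolding ergodic_avg_def[abs_def] 1 2 ..
qed

text \<open>In \<open>multi_pow\<close> the last transformation acts first, so the sum over the last
  index averages the inner ergodic average along an orbit of \<open>S (Suc k)\<close>.\<close>

lemma ergodic_avg_Suc:
  "ergodic_avg B S (Suc k) f N x = 
     (\<Sum>n\<in>B (Suc k) \<inter> {1..N (Suc k)}. ergodic_avg B S k f N ((S (Suc k) ^^ n) x)) / of_nat (card (B (Suc k) \<inter> {1..N (Suc k)}))"
proof -
  let ?C = "\<lambda>i. B i \<inter> {1..N i}"
  have ins: "{1..Suc k} = insert (Suc k) {1..k}" by auto
  have "(\<Sum>l\<in>(\<Pi>\<^sub>E i\<in>{1..Suc k}. ?C i). f (multi_pow S (Suc k) l x)) = 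
      (\<Sum>(n, l)\<in>?C (Suc k) \<times> (\<Pi>\<^sub>E i\<in>{1..k}. ?C i). f (multi_pow S (Suc k) (l(Suc k := n)) x))"
    unfolding ins PiE_insert_eq
    by (subst sum.reindex[OF inj_combinator]) (auto simp: case_prod_unfold o_def)
  also have "\<dots> = (\<Sum>n\<in>?C (Suc k). \<Sum>l\<in>(\<Pi>\<^sub>E i\<in>{1..k}. ?C i). f (multi_pow S (Suc k) (l(Suc k := n)) x))"
    by (rule sum.cartesian_product[symmetric])
  also have "\<dots> = (\<Sum>n\<in>?C (Suc k). \<Sum>l\<in>(\<Pi>\<^sub>E i\<in>{1..k}. ?C i). f (multi_pow S k l ((S (Suc k) ^^ n) x)))"
  proof (intro sum.cong refl)
    fix n l
    have "multi_pow S k (l(Suc k := n)) = multi_pow S k l" by (rule multi_pow_cong) auto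
    then show "f (multi_pow S (Suc k) (l(Suc k := n)) x) = f (multi_pow S k l ((S (Suc k) ^^ n) x))" by simp
  qed
  finally have sm: "(\<Sum>l\<in>(\<Pi>\<^sub>E i\<in>{1..Suc k}. ?C i). f (multi_pow S (Suc k) l x)) = 
    (\<Sum>n\<in>?C (Suc k). \<Sum>l\<in>(\<Pi>\<^sub>E i\<in>{1..k}. ?C i). f (multi_pow S k l ((S (Suc k) ^^ n) x)))" .
  have pr: "(\<Prod>i\<in>{1..Suc k}. card (?C i)) = (\<Prod>i\<in>{1..k}. card (?C i)) * card (?C (Suc k))"
    by (simp add: prod.nat_ivl_Suc')
  show ?thesis unfolding ergodic_avg_def sm pr of_nat_mult
    by (simp add: sum_divide_distrib[symmetric])
qed

context measure_preserving
begin

definition cavg :: "nat set \<Rightarrow> ('a \<Rightarrow> complex) \<Rightarrow> nat \<Rightarrow> 'a \<Rightarrow> complex" where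
  "cavg B u N x = (\<Sum>n\<in>B \<inter> {1..N}. u ((T ^^ n) x)) / of_nat (card (B \<inter> {1..N}))"

lemma cavg_measurable [measurable]:
  assumes "u \<in> borel_measurable M" shows "cavg B u N \<in> borel_measurable M"
  unfolding cavg_def[abs_def] 
  by (intro borel_measurable_divide borel_measurable_sum borel_measurable_const compose_funpow_measurable assms)

lemma norm_cavg_le:
  assumes "\<And>n. norm (u ((T ^^ n) x)) \<le> v ((T ^^ n) x)"
  shows "norm (cavg B u N x) \<le> bavg B v N x"
proof -
  have "norm (\<Sum>n\<in>B \<inter> {1..N}. u ((T ^^ n) x)) \<le> (\<Sum>n\<in>B \<inter> {1..N}. v ((T ^^ n) x))"
    by (intro sum_norm_le assms)
  then show ?thesis by (simp add: cavg_def bavg_def norm_divide divide_right_mono)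
qed

lemma cavg_diff: "cavg B (\<lambda>y. u y - v y) N x = cavg B u N x - cavg B v N x"
  by (simp add: cavg_def sum_subtractf diff_divide_distrib)

text \<open>Filling the gaps needs nonnegative functions, so the positive and negative parts of the
  real and imaginary parts are treated separately.\<close>

lemma cavg_convergent:
  assumes fc: "fourier_close B w" and p: "1 < p"
    and u [measurable]: "u \<in> borel_measurable M" and fin: "(\<integral>\<^sup>+x. ennreal (norm (u x) powr p) \<partial>M) < \<infinity>"
  shows "AE x in M. convergent (\<lambda>N. cavg B u N x)"
proof -
  have conv: "AE x in M. convergent (\<lambda>N. bavg B v N x)" 
    if [measurable]: "v \<in> borel_measurable M" and v: "\<And>x. 0 \<le> v x" "\<And>x. v x \<le> norm (u x)" for v
  proof (rule bavg_convergent[OF fc p _ v(1)])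
    have "(\<integral>\<^sup>+x. ennreal (v x powr p) \<partial>M) \<le> (\<integral>\<^sup>+x. ennreal (norm (u x) powr p) \<partial>M)"
      using v p by (intro nn_integral_mono ennreal_leI powr_mono2) auto
    also note fin
    finally show "(\<integral>\<^sup>+x. ennreal (v x powr p) \<partial>M) < \<infinity>" .
  qed measurable
  define v1 v2 v3 v4 where "v1 x = max (Re (u x)) 0" and "v2 x = max (- Re (u x)) 0" 
    and "v3 x = max (Im (u x)) 0" and "v4 x = max (- Im (u x)) 0" for x
  have [measurable]: "v1 \<in> borel_measurable M" "v2 \<in> borel_measurable M" "v3 \<in> borel_measurable M" "v4 \<in> borel_measurable M"
    unfolding v1_def v2_def v3_def v4_def by measurable
  have b: "0 \<le> v1 x" "v1 x \<le> norm (u x)" "0 \<le> v2 x" "v2 x \<le> norm (u x)" "0 \<le> v3 x" "v3 x \<le> norm (u x)" "0 \<le> v4 x" "v4 x \<le> norm (u x)" for x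
    using abs_Re_le_cmod[of "u x"] abs_Im_le_cmod[of "u x"] by (auto simp: v1_def v2_def v3_def v4_def)
  have "AE x in M. convergent (\<lambda>N. bavg B v1 N x)" by (rule conv) (auto simp: b)
  moreover have "AE x in M. convergent (\<lambda>N. bavg B v2 N x)" by (rule conv) (auto simp: b)
  moreover have "AE x in M. convergent (\<lambda>N. bavg B v3 N x)" by (rule conv) (auto simp: b)
  moreover have "AE x in M. convergent (\<lambda>N. bavg B v4 N x)" by (rule conv) (auto simp: b)
  ultimately show ?thesis
  proof eventually_elim
    case (elim x)
    obtain L1 L2 L3 L4 where L: "(\<lambda>N. bavg B v1 N x) \<longlonglongrightarrow> L1" "(\<lambda>N. bavg B v2 N x) \<longlonglongrightarrow> L2" 
      "(\<lambda>N. bavg B v3 N x) \<longlonglongrightarrow> L3" "(\<lambda>N. bavg B v4 N x) \<longlonglongrightarrow> L4"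
      using elim unfolding convergent_def by blast
    have eq: "cavg B u N x = Complex (bavg B v1 N x - bavg B v2 N x) (bavg B v3 N x - bavg B v4 N x)" for N
    proof -
      have "Re (u y) = v1 y - v2 y" "Im (u y) = v3 y - v4 y" for y by (auto simp: v1_def v2_def v3_def v4_def)
      then show ?thesis
        by (simp add: cavg_def bavg_def complex_eq_iff Re_divide_of_nat Im_divide_of_nat Re_sum Im_sum sum_subtractf diff_divide_distrib)
    qed
    have "(\<lambda>N. cavg B u N x) \<longlonglongrightarrow> Complex (L1 - L2) (L3 - L4)"
      unfolding eq by (intro tendsto_Complex tendsto_diff L)
    then show ?case by (auto simp: convergent_def)
  qed
qed

end

text \<open>By Fatou's lemma the lower limit of the p-th powers vanishes almost everywhere. The
  functions themselves need not converge pointwise, but one small member at each point is all that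
  the induction step uses.\<close>

lemma AE_liminf_zero:
  fixes U :: "nat \<Rightarrow> 'a \<Rightarrow> real"
  assumes U [measurable]: "\<And>n. U n \<in> borel_measurable M" and U0: "\<And>n x. 0 \<le> U n x" and p: "0 < p"
    and lim: "(\<lambda>n. \<integral>\<^sup>+x. ennreal (U n x powr p) \<partial>M) \<longlonglongrightarrow> 0"
  shows "AE x in M. \<forall>e>0. \<exists>n. U n x < e"
proof -
  have "(\<integral>\<^sup>+x. liminf (\<lambda>n. ennreal (U n x powr p)) \<partial>M) \<le> liminf (\<lambda>n. \<integral>\<^sup>+x. ennreal (U n x powr p) \<partial>M)"
    by (rule nn_integral_liminf) measurable
  also have "\<dots> = 0" using lim by (intro lim_imp_Liminf) auto
  finally have "(\<integral>\<^sup>+x. liminf (\<lambda>n. ennreal (U n x powr p)) \<partial>M) = 0" by simp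
  then have "AE x in M. liminf (\<lambda>n. ennreal (U n x powr p)) = 0"
    by (subst (asm) nn_integral_0_iff_AE) auto
  then show ?thesis
  proof eventually_elim
    case (elim x)
    show ?case
    proof (intro allI impI, rule ccontr)
      fix e :: real assume e: "0 < e" "\<nexists>n. U n x < e"
      then have "e powr p \<le> U n x powr p" for n using p by (intro powr_mono2) (auto simp: not_less)
      then have "ennreal (e powr p) \<le> liminf (\<lambda>n. ennreal (U n x powr p))"
        by (intro Liminf_bounded always_eventually allI ennreal_leI)
      then have "ennreal (e powr p) = 0" using elim by simp
      then show False using e by (simp add: ennreal_eq_0_iff)
    qed
  qed
qed

lemma nn_integral_powr_mono_finite:
  fixes f g :: "'a \<Rightarrow> real"
  assumes "AE x in M. f x \<le> c * g x" "\<And>x. 0 \<le> f x" "g \<in> borel_measurable M" "\<And>x. 0 \<le> g x" "0 < p" "0 \<le> c"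
    "(\<integral>\<^sup>+x. ennreal (g x powr p) \<partial>M) < \<infinity>"
  shows "(\<integral>\<^sup>+x. ennreal (f x powr p) \<partial>M) < \<infinity>"
proof -
  have [measurable]: "g \<in> borel_measurable M" by fact
  have "(\<integral>\<^sup>+x. ennreal (f x powr p) \<partial>M) \<le> (\<integral>\<^sup>+x. ennreal (c powr p) * ennreal (g x powr p) \<partial>M)"
  proof (rule nn_integral_mono_AE)
    show "AE x in M. ennreal (f x powr p) \<le> ennreal (c powr p) * ennreal (g x powr p)"
      using assms(1)
    proof eventually_elim
      case (elim x)
      have "f x powr p \<le> (c * g x) powr p" using elim assms by (intro powr_mono2) auto
      then show ?case using assms by (simp add: powr_mult ennreal_mult[symmetric] ennreal_leI)
    qed
  qed
  also have "\<dots> < \<infinity>" using assms(7) by (subst nn_integral_cmult) (auto simp: ennreal_mult_less_top)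
  finally show ?thesis .
qed

text \<open>The induction carries a majorant in L^p valid for all multi-indices at once, because
  this puts the tail suprema \<open>H n\<close> into L^p and makes their norms tend to 0. In the
  step, the averages of \<open>G N\<close> and of its limit \<open>g\<close> differ by at most an
  average of \<open>H n\<close>, hence by at most a maximal function of small norm, whatever the
  last coordinate is.\<close>

theorem multiparameter_ergodic:
  fixes f :: "'a \<Rightarrow> complex"
  assumes p: "1 < p" and f: "f \<in> borel_measurable M" and fin: "(\<integral>\<^sup>+x. ennreal (norm (f x) powr p) \<partial>M) < \<infinity>"
    and S: "\<And>i. i \<in> {1..k} \<Longrightarrow> measure_preserving M (S i)"
    and B: "\<And>i. i \<in> {1..k} \<Longrightarrow> \<exists>w. fourier_close (B i) w"
  shows "(\<forall>N. ergodic_avg B S k f N \<in> borel_measurable M) \<and>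
    (\<exists>F. F \<in> borel_measurable M \<and> (\<forall>x. 0 \<le> F x) \<and> (\<integral>\<^sup>+x. ennreal (F x powr p) \<partial>M) < \<infinity> \<and>
       (AE x in M. \<forall>N. norm (ergodic_avg B S k f N x) \<le> F x)) \<and>
    (AE x in M. \<exists>L. \<forall>e>0. \<exists>n. \<forall>N. (\<forall>i\<in>{1..k}. n \<le> N i) \<longrightarrow> norm (ergodic_avg B S k f N x - L) < e)"
  using S B
proof (induction k)
  case 0
  \<comment> \<open>For \<open>k = 0\<close> there is exactly one extensional index and the empty
    product is 1.\<close>
  have "ergodic_avg B S 0 f N x = f x" for N x by (simp add: ergodic_avg_def)
  then have e: "ergodic_avg B S 0 f N = f" for N by (simp add: fun_eq_iff)
  show ?case unfolding e
  proof (intro conjI)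
    show "\<exists>F. F \<in> borel_measurable M \<and> (\<forall>x. 0 \<le> F x) \<and> (\<integral>\<^sup>+x. ennreal (F x powr p) \<partial>M) < \<infinity> \<and>
       (AE x in M. \<forall>N::nat \<Rightarrow> nat. norm (f x) \<le> F x)"
      using f fin by (intro exI[of _ "\<lambda>x. norm (f x)"]) auto
    show "AE x in M. \<exists>L. \<forall>e>0. \<exists>n. \<forall>N. (\<forall>i\<in>{1..0}. n \<le> N i) \<longrightarrow> norm (f x - L) < e"
    proof (rule AE_I2)
      fix x show "\<exists>L. \<forall>e>0. \<exists>n. \<forall>N. (\<forall>i\<in>{1..0}. n \<le> N i) \<longrightarrow> norm (f x - L) < e"
        by (rule exI[of _ "f x"]) simp
    qed
  qed (use f in simp)
next
  case (Suc k)
  define T where "T = S (Suc k)"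
  define C where "C = B (Suc k)"
  define G where "G = ergodic_avg B S k f"
  interpret measure_preserving M T unfolding T_def by (rule Suc.prems(1)) simp
  obtain w where fc: "fourier_close C w" using Suc.prems(2)[of "Suc k"] unfolding C_def by auto
  have IH: "(\<forall>N. G N \<in> borel_measurable M) \<and>
    (\<exists>F. F \<in> borel_measurable M \<and> (\<forall>x. 0 \<le> F x) \<and> (\<integral>\<^sup>+x. ennreal (F x powr p) \<partial>M) < \<infinity> \<and>
       (AE x in M. \<forall>N. norm (G N x) \<le> F x)) \<and>
    (AE x in M. \<exists>L. \<forall>e>0. \<exists>n. \<forall>N. (\<forall>i\<in>{1..k}. n \<le> N i) \<longrightarrow> norm (G N x - L) < e)"
    unfolding G_def using Suc.prems by (intro Suc.IH) auto
  then have Gm [measurable]: "\<And>N. G N \<in> borel_measurable M" by blast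
  from IH obtain F where F [measurable]: "F \<in> borel_measurable M" and F0: "\<And>x. 0 \<le> F x" and Ffin: "(\<integral>\<^sup>+x. ennreal (F x powr p) \<partial>M) < \<infinity>"
    and FG: "AE x in M. \<forall>N. norm (G N x) \<le> F x" by blast
  from IH have Glim: "AE x in M. \<exists>L. \<forall>e>0. \<exists>n. \<forall>N. (\<forall>i\<in>{1..k}. n \<le> N i) \<longrightarrow> norm (G N x - L) < e" by blast
  have rec: "ergodic_avg B S (Suc k) f N = cavg C (G N) (N (Suc k))" for N
    unfolding ergodic_avg_Suc[abs_def] C_def[symmetric] T_def[symmetric] G_def[symmetric] cavg_def[abs_def] ..
  have meas: "ergodic_avg B S (Suc k) f N \<in> borel_measurable M" for N
    unfolding rec by measurable
  obtain K where K: "0 \<le> K" "\<And>u. u \<in> borel_measurable M \<Longrightarrow> (\<forall>x. 0 \<le> u x) \<Longrightarrow> (\<integral>\<^sup>+x. ennreal (u x powr p) \<partial>M) < \<infinity> \<Longrightarrow>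
    (\<exists>U. U \<in> borel_measurable M \<and> (\<forall>x. 0 \<le> U x) \<and> (\<integral>\<^sup>+x. ennreal (U x powr p) \<partial>M) \<le> ennreal K * (\<integral>\<^sup>+x. ennreal (u x powr p) \<partial>M) \<and>
      (AE x in M. \<forall>N. bavg C u N x \<le> U x))"
    using bavg_maximal[OF fc p] by blast
  have p0: "0 < p" using p by simp
  obtain UF where UF: "UF \<in> borel_measurable M" "\<forall>x. 0 \<le> UF x" "(\<integral>\<^sup>+x. ennreal (UF x powr p) \<partial>M) \<le> ennreal K * (\<integral>\<^sup>+x. ennreal (F x powr p) \<partial>M)"
    "AE x in M. \<forall>N. bavg C F N x \<le> UF x" using K(2)[OF F _ Ffin] F0 by blast
  have UFfin: "(\<integral>\<^sup>+x. ennreal (UF x powr p) \<partial>M) < \<infinity>"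
    by (rule le_less_trans[OF UF(3)]) (use Ffin in \<open>simp add: ennreal_mult_less_top\<close>)
  have max: "AE x in M. \<forall>N. norm (ergodic_avg B S (Suc k) f N x) \<le> UF x"
    using AE_funpow[OF FG] UF(4)
  proof eventually_elim
    case (elim x)
    have "norm (cavg C (G N) n x) \<le> UF x" for N n
    proof -
      have "norm (cavg C (G N) n x) \<le> bavg C F n x" using elim(1) by (intro norm_cavg_le) blast
      also have "\<dots> \<le> UF x" using elim(2) by blast
      finally show ?thesis .
    qed
    then show ?case unfolding rec by blast
  qed
  \<comment> \<open>The limit is read off along constant multi-indices, an ordinary sequence, so
    that it is measurable.\<close>
  define g where "g y = lim (\<lambda>n. G (\<lambda>_. n) y)" for y
  have gm [measurable]: "g \<in> borel_measurable M" unfolding g_def by (rule borel_measurable_lim_metric) measurable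
  have glim: "AE y in M. \<forall>e>0. \<exists>n. \<forall>N. (\<forall>i\<in>{1..k}. n \<le> N i) \<longrightarrow> norm (G N y - g y) < e"
    using Glim
  proof eventually_elim
    case (elim y)
    then obtain L where L: "\<forall>e>0. \<exists>n. \<forall>N. (\<forall>i\<in>{1..k}. n \<le> N i) \<longrightarrow> norm (G N y - L) < e" by blast
    have "(\<lambda>n. G (\<lambda>_. n) y) \<longlonglongrightarrow> L"
    proof (rule LIMSEQ_I)
      fix e :: real assume "0 < e"
      then obtain n where n: "\<And>N. (\<forall>i\<in>{1..k}. n \<le> N i) \<Longrightarrow> norm (G N y - L) < e" using L by blast
      show "\<exists>no. \<forall>n\<ge>no. norm (G (\<lambda>_. n) y - L) < e"
        by (intro exI[of _ n] allI impI n) simp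
    qed
    then have "g y = L" unfolding g_def by (rule limI)
    with L show ?case by simp
  qed
  have gF: "AE y in M. norm (g y) \<le> F y"
    using glim FG
  proof eventually_elim
    case (elim y)
    show ?case
    proof (rule field_le_epsilon)
      fix e :: real assume "0 < e"
      then obtain n where n: "\<forall>N. (\<forall>i\<in>{1..k}. n \<le> N i) \<longrightarrow> norm (G N y - g y) < e" using elim(1) by blast
      have "norm (g y) \<le> norm (G (\<lambda>_. n) y) + norm (G (\<lambda>_. n) y - g y)"
        by (metis add.commute norm_minus_commute norm_triangle_sub)
      also have "\<dots> \<le> F y + e" using n[rule_format, of "\<lambda>_. n"] elim(2) by (intro add_mono) (auto intro: less_imp_le)
      finally show "norm (g y) \<le> F y + e" .
    qed
  qed
  have gfin: "(\<integral>\<^sup>+x. ennreal (norm (g x) powr p) \<partial>M) < \<infinity>"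
    by (rule nn_integral_powr_mono_finite[where c = 1, OF _ _ F F0 p0 _ Ffin]) (use gF in simp_all)
  define D where "D n = {N \<in> {1..k} \<rightarrow>\<^sub>E (UNIV :: nat set). \<forall>i\<in>{1..k}. n \<le> N i}" for n :: nat
  have Dc: "countable (D n)" for n
  proof (rule countable_subset)
    show "D n \<subseteq> {1..k} \<rightarrow>\<^sub>E UNIV" by (auto simp: D_def)
    show "countable ({1..k} \<rightarrow>\<^sub>E (UNIV :: nat set))" by (intro countable_PiE) auto
  qed
  define E where "E n y = (SUP N\<in>D n. ennreal (norm (G N y - g y)))" for n y
  define H where "H n y = enn2real (E n y)" for n y
  have [measurable]: "E n \<in> borel_measurable M" for n
    unfolding E_def by (rule borel_measurable_SUP[OF Dc]) measurable
  have Hm [measurable]: "H n \<in> borel_measurable M" for n unfolding H_def by measurable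
  have H0: "0 \<le> H n y" for n y by (simp add: H_def)
  have Hprop: "AE y in M. (\<forall>n. H n y \<le> 2 * F y) \<and> (\<forall>n N. (\<forall>i\<in>{1..k}. n \<le> N i) \<longrightarrow> norm (G N y - g y) \<le> H n y) \<and> (\<lambda>n. H n y) \<longlonglongrightarrow> 0"
    using glim FG gF
  proof eventually_elim
    case (elim y)
    have E2: "E n y \<le> ennreal (2 * F y)" for n
      unfolding E_def
    proof (intro SUP_least ennreal_leI)
      fix N
      have "norm (G N y - g y) \<le> norm (G N y) + norm (g y)" by (rule norm_triangle_ineq4)
      then show "norm (G N y - g y) \<le> 2 * F y" using elim(2,3) by (smt (verit))
    qed
    then have Efin: "E n y < \<infinity>" for n by (metis ennreal_less_top infinity_ennreal_def le_less_trans)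
    have "H n y \<le> 2 * F y" for n
      unfolding H_def using enn2real_mono[OF E2[of n]] F0[of y] by simp
    moreover have Hge: "norm (G N y - g y) \<le> H n y" if "\<forall>i\<in>{1..k}. n \<le> N i" for n N
    proof -
      have "restrict N {1..k} \<in> D n" using that by (auto simp: D_def)
      then have "ennreal (norm (G (restrict N {1..k}) y - g y)) \<le> E n y" unfolding E_def by (rule SUP_upper)
      then have "enn2real (ennreal (norm (G (restrict N {1..k}) y - g y))) \<le> H n y"
        unfolding H_def using Efin by (intro enn2real_mono) auto
      then show ?thesis unfolding G_def ergodic_avg_restrict by simp
    qed
    moreover have "(\<lambda>n. H n y) \<longlonglongrightarrow> 0"
    proof (rule LIMSEQ_I)
      fix e :: real assume e: "0 < e"
      then have "0 < e / 2" by simp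
      then obtain n where n: "\<forall>N. (\<forall>i\<in>{1..k}. n \<le> N i) \<longrightarrow> norm (G N y - g y) < e / 2" using elim(1) by blast
      have "norm (H m y - 0) < e" if "n \<le> m" for m
      proof -
        have "E m y \<le> ennreal (e / 2)" unfolding E_def
        proof (intro SUP_least ennreal_leI)
          fix N assume "N \<in> D m"
          then have "\<forall>i\<in>{1..k}. n \<le> N i" using that by (auto simp: D_def intro: order_trans)
          then show "norm (G N y - g y) \<le> e / 2" using n by (auto intro: less_imp_le)
        qed
        then have "H m y \<le> e / 2" unfolding H_def using enn2real_mono[of "E m y" "ennreal (e/2)"] e by simp
        then show ?thesis using e H0[of m y] by simp
      qed
      then show "\<exists>no. \<forall>n\<ge>no. norm (H n y - 0) < e" by blast
    qed
    ultimately show ?case by blast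
  qed
  have Hfin: "(\<integral>\<^sup>+x. ennreal (H n x powr p) \<partial>M) < \<infinity>" for n
  proof (rule nn_integral_powr_mono_finite[where c = 2, OF _ H0 F F0 p0 _ Ffin])
    show "AE x in M. H n x \<le> 2 * F x" using Hprop by eventually_elim blast
  qed simp
  have "(\<lambda>n. \<integral>\<^sup>+x. ennreal (H n x powr p) \<partial>M) \<longlonglongrightarrow> (\<integral>\<^sup>+x. 0 \<partial>M)"
  proof (rule nn_integral_dominated_convergence[where w = "\<lambda>x. ennreal ((2 * F x) powr p)"])
    show "(\<integral>\<^sup>+x. ennreal ((2 * F x) powr p) \<partial>M) < \<infinity>"
      by (rule nn_integral_powr_mono_finite[where c = 2, OF _ _ F F0 p0 _ Ffin]) (use F0 in simp_all)
    show "AE x in M. ennreal (H n x powr p) \<le> ennreal ((2 * F x) powr p)" for n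
      using Hprop by eventually_elim (use H0 p0 in \<open>auto intro!: ennreal_leI powr_mono2\<close>)
    show "AE x in M. (\<lambda>n. ennreal (H n x powr p)) \<longlonglongrightarrow> 0"
      using Hprop
    proof eventually_elim
      case (elim x)
      then have "(\<lambda>n. H n x) \<longlonglongrightarrow> 0" by blast
      then have "(\<lambda>n. H n x powr p) \<longlonglongrightarrow> 0"
        by (rule tendsto_zero_powrI[OF _ tendsto_const]) (use p0 H0 in auto)
      then have "(\<lambda>n. ennreal (H n x powr p)) \<longlonglongrightarrow> ennreal 0" by (rule tendsto_ennrealI)
      then show ?case by simp
    qed
  qed (auto simp: measurable_ident)
  then have Hlim: "(\<lambda>n. \<integral>\<^sup>+x. ennreal (H n x powr p) \<partial>M) \<longlonglongrightarrow> 0" by simp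
  have "\<forall>n. \<exists>U. U \<in> borel_measurable M \<and> (\<forall>x. 0 \<le> U x) \<and> (\<integral>\<^sup>+x. ennreal (U x powr p) \<partial>M) \<le> ennreal K * (\<integral>\<^sup>+x. ennreal (H n x powr p) \<partial>M) \<and>
      (AE x in M. \<forall>N. bavg C (H n) N x \<le> U x)"
    using K(2)[OF Hm _ Hfin] H0 by blast
  from choice[OF this] obtain U where U': "\<And>n. U n \<in> borel_measurable M \<and> (\<forall>x. 0 \<le> U n x) \<and> 
      (\<integral>\<^sup>+x. ennreal (U n x powr p) \<partial>M) \<le> ennreal K * (\<integral>\<^sup>+x. ennreal (H n x powr p) \<partial>M) \<and>
      (AE x in M. \<forall>N. bavg C (H n) N x \<le> U n x)" by blast
  then have U: "\<And>n. U n \<in> borel_measurable M" "\<And>n x. 0 \<le> U n x" 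
     "\<And>n. (\<integral>\<^sup>+x. ennreal (U n x powr p) \<partial>M) \<le> ennreal K * (\<integral>\<^sup>+x. ennreal (H n x powr p) \<partial>M)"
     "\<And>n. AE x in M. \<forall>N. bavg C (H n) N x \<le> U n x" by blast+
  have "(\<lambda>n. ennreal K * (\<integral>\<^sup>+x. ennreal (H n x powr p) \<partial>M)) \<longlonglongrightarrow> ennreal K * 0"
    by (rule tendsto_mult_ennreal[OF tendsto_const Hlim]) auto
  then have KH: "(\<lambda>n. ennreal K * (\<integral>\<^sup>+x. ennreal (H n x powr p) \<partial>M)) \<longlonglongrightarrow> 0" by (simp only: mult_zero_right)
  have "(\<lambda>n. \<integral>\<^sup>+x. ennreal (U n x powr p) \<partial>M) \<longlonglongrightarrow> 0"
    by (rule tendsto_sandwich[OF always_eventually always_eventually tendsto_const KH]) (simp_all only: U(3) zero_le simp_thms)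
  from AE_liminf_zero[OF U(1,2) p0 this] have Usmall: "AE x in M. \<forall>e>0. \<exists>n. U n x < e" .
  have Uall: "AE x in M. \<forall>n. \<forall>N. bavg C (H n) N x \<le> U n x" using U(4) by (simp add: AE_all_countable)
  \<comment> \<open>Averages along \<open>T\<close> evaluate \<open>G N\<close>, \<open>g\<close>
    and \<open>H n\<close> on the whole orbit of \<open>x\<close>; \<open>AE_funpow\<close> makes
    their comparison available at each of its points.\<close>
  have "AE x in M. \<exists>L. \<forall>e>0. \<exists>n. \<forall>N. (\<forall>i\<in>{1..Suc k}. n \<le> N i) \<longrightarrow> norm (ergodic_avg B S (Suc k) f N x - L) < e"
    using cavg_convergent[OF fc p gm gfin] Usmall Uall AE_funpow[OF Hprop]
  proof eventually_elim
    case (elim x)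
    then obtain L where L: "(\<lambda>n. cavg C g n x) \<longlonglongrightarrow> L" by (auto simp: convergent_def)
    show ?case
    proof (intro exI[of _ L] allI impI)
      fix e :: real assume e: "0 < e"
      then have e2: "0 < e / 2" by simp
      obtain n1 where n1: "U n1 x < e / 2" using elim(2) e2 by blast
      obtain n2 where n2: "\<And>n. n2 \<le> n \<Longrightarrow> norm (cavg C g n x - L) < e / 2" using LIMSEQ_D[OF L e2] by blast
      show "\<exists>n. \<forall>N. (\<forall>i\<in>{1..Suc k}. n \<le> N i) \<longrightarrow> norm (ergodic_avg B S (Suc k) f N x - L) < e"
      \<comment> \<open>\<open>n1\<close> makes the averaged tail supremum small and constrains only
        the first \<open>k\<close> coordinates; \<open>n2\<close> constrains only the last
        one.\<close>
      proof (intro exI[of _ "max n1 n2"] allI impI)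
        fix N :: "nat \<Rightarrow> nat" assume N: "\<forall>i\<in>{1..Suc k}. max n1 n2 \<le> N i"
        have N1: "\<forall>i\<in>{1..k}. n1 \<le> N i" and N2: "n2 \<le> N (Suc k)" using N by auto
        have "norm (cavg C (\<lambda>y. G N y - g y) (N (Suc k)) x) \<le> bavg C (H n1) (N (Suc k)) x"
          using elim(4) N1 by (intro norm_cavg_le) blast
        also have "\<dots> \<le> U n1 x" using elim(3) by blast
        finally have "norm (cavg C (G N) (N (Suc k)) x - cavg C g (N (Suc k)) x) < e / 2" using n1 by (simp add: cavg_diff)
        from norm_diff_triangle_less[OF this n2[OF N2]] have "norm (cavg C (G N) (N (Suc k)) x - L) < e" by simp
        then show "norm (ergodic_avg B S (Suc k) f N x - L) < e" unfolding rec .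
      qed
    qed
  qed
  then show ?case using meas max UF(1,2) UFfin by blast
qed

theorem theorem1p8:
  fixes M :: "'a measure"
    and S :: "nat \<Rightarrow> 'a \<Rightarrow> 'a"
    and f :: "'a \<Rightarrow> complex"
    and B :: "nat \<Rightarrow> nat set"
    and h1 h2 \<psi> :: "nat \<Rightarrow> real \<Rightarrow> real"
    and c1 c2 :: "nat \<Rightarrow> real"
    and x0 p :: real
    and k :: nat
  assumes "1 \<le> x0"
    and "1 \<le> k"
    and "\<And>i. i \<in> {1..k} \<Longrightarrow> 1 \<le> c1 i \<and> c1 i < 2"
    and "\<And>i. i \<in> {1..k} \<Longrightarrow> 1 \<le> c2 i \<and> c2 i < 6 / 5"
    and "\<And>i. i \<in> {1..k} \<Longrightarrow> h1 i \<in> class_R x0 (c1 i)"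
    and "\<And>i. i \<in> {1..k} \<Longrightarrow> h2 i \<in> class_R x0 (c2 i)"
    and "\<And>i. i \<in> {1..k} \<Longrightarrow> admissible_psi x0 (h2 i) (\<psi> i)"
    and "\<And>i. i \<in> {1..k} \<Longrightarrow> B i = B_plus x0 (h1 i) (\<psi> i) \<or> B i = B_minus x0 (h1 i) (\<psi> i)"
    and "sigma_finite_measure M"
    and "\<And>i. i \<in> {1..k} \<Longrightarrow> invertible_invariant M (S i)"
    and "\<And>i j x. i \<in> {1..k} \<Longrightarrow> j \<in> {1..k} \<Longrightarrow> x \<in> space M \<Longrightarrow> S i (S j x) = S j (S i x)"
    and "1 < p"
    and "f \<in> borel_measurable M"
    and "integrable M (\<lambda>x. norm (f x) powr p)"
  shows "AE x in M. \<exists>L. ((\<lambda>N. ergodic_avg B S k f N x) \<longlongrightarrow> L)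
           (filtercomap (\<lambda>N :: nat \<Rightarrow> nat. Min (N ` {1..k})) at_top)"
proof -
  have mp: "measure_preserving M (S i)" if "i \<in> {1..k}" for i
    using assms(9) assms(10)[OF that]
    by (simp add: measure_preserving_def measure_preserving_axioms_def invertible_invariant_def)
  have fc: "\<exists>w. fourier_close (B i) w" if "i \<in> {1..k}" for i
    using assms(3-8)[OF that] assms(1) by (intro fourier_close_return_set[of x0 "c1 i" "c2 i" "h1 i" "h2 i" "\<psi> i"]) auto
  have fin: "(\<integral>\<^sup>+x. ennreal (norm (f x) powr p) \<partial>M) < \<infinity>"
    using assms(14) by (simp add: nn_integral_eq_integral)
  have "AE x in M. \<exists>L. \<forall>e>0. \<exists>n. \<forall>N. (\<forall>i\<in>{1..k}. n \<le> N i) \<longrightarrow> norm (ergodic_avg B S k f N x - L) < e"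
    using multiparameter_ergodic[where k = k and S = S and B = B, OF assms(12,13) fin mp fc] by blast
  then show ?thesis
  proof eventually_elim
    case (elim x)
    then obtain L where L: "\<forall>e>0. \<exists>n. \<forall>N. (\<forall>i\<in>{1..k}. n \<le> N i) \<longrightarrow> norm (ergodic_avg B S k f N x - L) < e" by blast
    have "((\<lambda>N. ergodic_avg B S k f N x) \<longlongrightarrow> L) (filtercomap (\<lambda>N :: nat \<Rightarrow> nat. Min (N ` {1..k})) at_top)"
    proof (rule tendstoI)
      fix e :: real assume "0 < e"
      then obtain n where n: "\<And>N. (\<forall>i\<in>{1..k}. n \<le> N i) \<Longrightarrow> norm (ergodic_avg B S k f N x - L) < e" using L by blast
      have "dist (ergodic_avg B S k f N x) L < e" if "n \<le> Min (N ` {1..k})" for N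
      proof -
        \<comment> \<open>As \<open>k \<ge> 1\<close>, the minimum is over a finite nonempty set, so
          bounding it from below bounds every coordinate.\<close>
        have "\<forall>i\<in>{1..k}. n \<le> N i" using that assms(2) by auto
        then show ?thesis using n by (simp add: dist_norm)
      qed
      then show "\<forall>\<^sub>F N in filtercomap (\<lambda>N. Min (N ` {1..k})) at_top. dist (ergodic_avg B S k f N x) L < e"
        unfolding eventually_filtercomap
        by (intro exI[of _ "\<lambda>m. n \<le> m"] conjI eventually_ge_at_top) auto
    qed
    then show ?case by blast
  qed
qed

end
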